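(* Let $E$ and $F$ be Banach spaces such that $E$ is an $\mathcal L_{2,\lambda'}$-space and $F$ is an $\mathcal L_{\infty,\lambda}$-space. Then $\overline{\mathcal F(E;F)}=\mathcal K_1^{min}(E;F)$ and $\kappa_1(T)\le K_G\,\lambda\,\lambda'\,\|T\|$ for every $T\in\overline{\mathcal F(E;F)}$.
   Context: $\overline{\mathcal F(E;F)}$ is the operator-norm closure of the finite rank operators from $E$ to $F$. A bounded operator $T\colon E\to F$ is $1$-compact, $T\in\mathcal K_1(E;F)$, if there is a sequence $(x_n)_n$ in $F$ with $\sum_n\|x_n\|<\infty$ and $T(B_E)\subset\{\sum_n\alpha_nx_n:(\alpha_n)_n\in B_{c_0}\}$; $\kappa_1(T)$ is the infimum of $\sum_n\|x_n\|$ over all such sequences. The minimal kernel $\mathcal K_1^{min}(E;F)$ consists of all $T=ST_0R$ with $R,S$ approximable operators (operator-norm limits of finite rank operators) between Banach spaces and $T_0$ $1$-compact. For $1\le p\le\infty$ and $\lambda\ge1$, a Banach space $X$ is an $\mathcal L_{p,\lambda}$-space if every finite dimensional subspace of $X$ is contained in a finite dimensional subspace $N\subset X$ with Banach-Mazur distance $d(N,\ell_p^{\dim N})\le\lambda$. $K_G$ is Grothendieck's constant (for the scalar field considered). *)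

theory Defs
  imports "HOL-Analysis.Analysis" "HOL-Library.Function_Algebras"
begin

section \<open>Scalars\<close>

text \<open>
  The scalar field is the real or the complex field.  The axioms force a model to be isometrically
  isomorphic to one of these two, and both types are instances; \<open>rc_conj\<close> is complex conjugation
  (the identity in the real case).
\<close>

class rc_field = real_normed_field +
  fixes to_complex :: "'a \<Rightarrow> complex"
    and rc_conj :: "'a \<Rightarrow> 'a"
  assumes to_complex_add: "to_complex (x + y) = to_complex x + to_complex y"
    and to_complex_mult: "to_complex (x * y) = to_complex x * to_complex y"
    and to_complex_one: "to_complex 1 = 1"
    and to_complex_scaleR: "to_complex (r *\<^sub>R x) = r *\<^sub>R to_complex x"
    and norm_to_complex: "norm (to_complex x) = norm x"
    and range_to_complex: "range to_complex = \<real> \<or> range to_complex = UNIV"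
    and to_complex_rc_conj: "to_complex (rc_conj x) = cnj (to_complex x)"

instantiation real :: rc_field
begin
definition "to_complex (x::real) = complex_of_real x"
definition "rc_conj (x::real) = x"
instance
  by standard (auto simp: to_complex_real_def rc_conj_real_def scaleR_conv_of_real Reals_def fun_eq_iff)
end

instantiation complex :: rc_field
begin
definition "to_complex (x::complex) = x"
definition "rc_conj (x::complex) = cnj x"
instance
  by standard (auto simp: to_complex_complex_def rc_conj_complex_def)
end

section \<open>Banach spaces and operators\<close>

text \<open>
  Normed spaces are structures rather than types, since subspaces carrying the induced norm,
  \<open>\<ell>\<^sub>p\<^sup>n\<close> for varying \<open>n\<close>, and existentially quantified Banach spaces are all needed below.
  Addition is that of the underlying type.
\<close>

record ('k, 'a) nvs =
  vcarrier :: "'a set"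
  vscale :: "'k \<Rightarrow> 'a \<Rightarrow> 'a"
  vnorm :: "'a \<Rightarrow> real"

definition normed_space :: "('k::rc_field, 'a::ab_group_add) nvs \<Rightarrow> bool" where
  "normed_space E \<longleftrightarrow>
     vector_space (vscale E) \<and> module.subspace (vscale E) (vcarrier E) \<and>
     (\<forall>x\<in>vcarrier E. 0 \<le> vnorm E x \<and> (vnorm E x = 0 \<longleftrightarrow> x = 0)) \<and>
     (\<forall>x\<in>vcarrier E. \<forall>y\<in>vcarrier E. vnorm E (x + y) \<le> vnorm E x + vnorm E y) \<and>
     (\<forall>c. \<forall>x\<in>vcarrier E. vnorm E (vscale E c x) = norm c * vnorm E x)"

definition converges_to ::
    "('k, 'a::ab_group_add) nvs \<Rightarrow> (nat \<Rightarrow> 'a) \<Rightarrow> 'a \<Rightarrow> bool" where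
  "converges_to E X x \<longleftrightarrow> x \<in> vcarrier E \<and> (\<lambda>n. vnorm E (X n - x)) \<longlonglongrightarrow> 0"

definition banach_space :: "('k::rc_field, 'a::ab_group_add) nvs \<Rightarrow> bool" where
  "banach_space E \<longleftrightarrow> normed_space E \<and>
     (\<forall>X. range X \<subseteq> vcarrier E \<and>
          (\<forall>e>0. \<exists>M. \<forall>m\<ge>M. \<forall>n\<ge>M. vnorm E (X m - X n) < e) \<longrightarrow>
          (\<exists>x. converges_to E X x))"

lemma banach_space_UNIV:
  "banach_space \<lparr>vcarrier = (UNIV :: 'a::banach set), vscale = (*\<^sub>R), vnorm = norm\<rparr>"
proof -
  have "convergent X" if "\<forall>e>0. \<exists>M. \<forall>m\<ge>M. \<forall>n\<ge>M. norm (X m - X n) < e" for X :: "nat \<Rightarrow> 'a"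
    using that by (simp add: Cauchy_convergent_iff[symmetric] Cauchy_iff)
  then show ?thesis
    by (auto simp: banach_space_def normed_space_def converges_to_def real_vector.vector_space_axioms
        module.subspace_UNIV module_iff_vector_space norm_triangle_ineq convergent_def
        tendsto_norm_zero_iff LIM_zero_iff)
qed

definition unit_ball :: "('k, 'a) nvs \<Rightarrow> 'a set" where
  "unit_ball E = {x \<in> vcarrier E. vnorm E x \<le> 1}"

text \<open>
  Operators are functions on the underlying types.  Every notion below depends only on their
  values on the carrier of the domain.
\<close>

definition bounded_ops ::
    "('k::rc_field, 'a::ab_group_add) nvs \<Rightarrow> ('k, 'b::ab_group_add) nvs \<Rightarrow> ('a \<Rightarrow> 'b) set" where
  "bounded_ops E F = {T.
     (\<forall>x\<in>vcarrier E. T x \<in> vcarrier F) \<and>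
     (\<forall>x\<in>vcarrier E. \<forall>y\<in>vcarrier E. T (x + y) = T x + T y) \<and>
     (\<forall>c. \<forall>x\<in>vcarrier E. T (vscale E c x) = vscale F c (T x)) \<and>
     (\<exists>C. \<forall>x\<in>vcarrier E. vnorm F (T x) \<le> C * vnorm E x)}"

definition opnorm :: "('k, 'a) nvs \<Rightarrow> ('k, 'b) nvs \<Rightarrow> ('a \<Rightarrow> 'b) \<Rightarrow> real" where
  "opnorm E F T = (SUP x\<in>unit_ball E. vnorm F (T x))"

definition finite_dim :: "('k::rc_field, 'a::ab_group_add) nvs \<Rightarrow> 'a set \<Rightarrow> bool" where
  "finite_dim E M \<longleftrightarrow> (\<exists>B. finite B \<and> B \<subseteq> vcarrier E \<and> M = module.span (vscale E) B)"

definition finite_rank_ops ::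
    "('k::rc_field, 'a::ab_group_add) nvs \<Rightarrow> ('k, 'b::ab_group_add) nvs \<Rightarrow> ('a \<Rightarrow> 'b) set" where
  "finite_rank_ops E F = {T \<in> bounded_ops E F. finite_dim F (T ` vcarrier E)}"

definition approximable_ops ::
    "('k::rc_field, 'a::ab_group_add) nvs \<Rightarrow> ('k, 'b::ab_group_add) nvs \<Rightarrow> ('a \<Rightarrow> 'b) set" where
  "approximable_ops E F = {T \<in> bounded_ops E F.
     \<forall>e>0. \<exists>A\<in>finite_rank_ops E F. opnorm E F (\<lambda>x. T x - A x) < e}"

section \<open>1-compact operators and their minimal kernel\<close>

definition c0_hull :: "('k::rc_field, 'b::ab_group_add) nvs \<Rightarrow> (nat \<Rightarrow> 'b) \<Rightarrow> 'b set" where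
  "c0_hull F x = {y. \<exists>\<alpha>::nat \<Rightarrow> 'k. \<alpha> \<longlonglongrightarrow> 0 \<and> (\<forall>n. norm (\<alpha> n) \<le> 1) \<and>
     converges_to F (\<lambda>N. \<Sum>n<N. vscale F (\<alpha> n) (x n)) y}"

definition compact_witnesses ::
    "('k::rc_field, 'a::ab_group_add) nvs \<Rightarrow> ('k, 'b::ab_group_add) nvs \<Rightarrow> ('a \<Rightarrow> 'b)
      \<Rightarrow> (nat \<Rightarrow> 'b) set" where
  "compact_witnesses E F T = {x. range x \<subseteq> vcarrier F \<and> summable (\<lambda>n. vnorm F (x n)) \<and>
     T ` unit_ball E \<subseteq> c0_hull F x}"

definition one_compact_ops ::
    "('k::rc_field, 'a::ab_group_add) nvs \<Rightarrow> ('k, 'b::ab_group_add) nvs \<Rightarrow> ('a \<Rightarrow> 'b) set" where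
  "one_compact_ops E F = {T \<in> bounded_ops E F. compact_witnesses E F T \<noteq> {}}"

definition kappa1 ::
    "('k::rc_field, 'a::ab_group_add) nvs \<Rightarrow> ('k, 'b::ab_group_add) nvs \<Rightarrow> ('a \<Rightarrow> 'b) \<Rightarrow> real" where
  "kappa1 E F T = (INF x\<in>compact_witnesses E F T. \<Sum>n. vnorm F (x n))"

definition minimal_kernel_via ::
    "('k::rc_field, 'a::ab_group_add) nvs \<Rightarrow> ('k, 'b::ab_group_add) nvs \<Rightarrow>
     ('k, 'x::ab_group_add) nvs \<Rightarrow> ('k, 'y::ab_group_add) nvs \<Rightarrow> ('a \<Rightarrow> 'b) set" where
  "minimal_kernel_via E F X Y = {T \<in> bounded_ops E F.
     \<exists>R\<in>approximable_ops E X. \<exists>T\<^sub>0\<in>one_compact_ops X Y. \<exists>S\<in>approximable_ops Y F.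
       \<forall>x\<in>vcarrier E. T x = S (T\<^sub>0 (R x))}"

text \<open>
  HOL cannot quantify over all types inside a definition, so the intermediate Banach spaces are
  taken to be linear subspaces of the space of scalar sequences, with an arbitrary complete norm.
  Every Banach space whose algebraic dimension is at most the continuum, in particular every
  separable one, is isometrically isomorphic to such a space.  This loses nothing: in a
  factorization \<open>S \<circ> T\<^sub>0 \<circ> R\<close> through \<open>X\<close> and \<open>Y\<close> one may replace \<open>X\<close> by the closed span of the
  ranges of a sequence of finite rank operators with limit \<open>R\<close>, and \<open>Y\<close> by the closed span of a
  sequence witnessing that \<open>T\<^sub>0\<close> is 1-compact, and both of these are separable.
\<close>

definition minimal_kernel ::
    "('k::rc_field, 'a::ab_group_add) nvs \<Rightarrow> ('k, 'b::ab_group_add) nvs \<Rightarrow> ('a \<Rightarrow> 'b) set" where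
  "minimal_kernel E F =
     {T. \<exists>(X :: ('k, nat \<Rightarrow> 'k) nvs) (Y :: ('k, nat \<Rightarrow> 'k) nvs).
           banach_space X \<and> banach_space Y \<and> T \<in> minimal_kernel_via E F X Y}"

section \<open>\<open>\<L>\<^sub>p\<close>-spaces\<close>

text \<open>The maximum is over a set that also contains \<open>0\<close> in order to cover \<open>n = 0\<close>.\<close>

definition lp_norm :: "ereal \<Rightarrow> nat \<Rightarrow> (nat \<Rightarrow> 'k::rc_field) \<Rightarrow> real" where
  "lp_norm p n x =
     (if p = \<infinity> then Max (insert 0 ((\<lambda>i. norm (x i)) ` {..<n}))
      else (\<Sum>i<n. norm (x i) powr real_of_ereal p) powr (1 / real_of_ereal p))"

definition lp_space :: "ereal \<Rightarrow> nat \<Rightarrow> ('k::rc_field, nat \<Rightarrow> 'k) nvs" where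
  "lp_space p n = \<lparr>vcarrier = {x. \<forall>i\<ge>n. x i = 0}, vscale = (\<lambda>c x i. c * x i), vnorm = lp_norm p n\<rparr>"

text \<open>The distance between non-isomorphic spaces is \<open>\<infinity>\<close>.\<close>

definition banach_mazur ::
    "('k::rc_field, 'a::ab_group_add) nvs \<Rightarrow> ('k, 'b::ab_group_add) nvs \<Rightarrow> ereal" where
  "banach_mazur E F = Inf {ereal (opnorm E F u * opnorm F E v) | u v.
     u \<in> bounded_ops E F \<and> v \<in> bounded_ops F E \<and>
     (\<forall>x\<in>vcarrier E. v (u x) = x) \<and> (\<forall>y\<in>vcarrier F. u (v y) = y)}"

definition script_Lp_space ::
    "ereal \<Rightarrow> real \<Rightarrow> ('k::rc_field, 'a::ab_group_add) nvs \<Rightarrow> bool" where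
  "script_Lp_space p lam X \<longleftrightarrow>
     (\<forall>M. finite_dim X M \<longrightarrow>
       (\<exists>N. finite_dim X N \<and> M \<subseteq> N \<and>
         banach_mazur (X\<lparr>vcarrier := N\<rparr>)
           (lp_space p (vector_space.dim (vscale X) N)) \<le> ereal lam))"

section \<open>Grothendieck's constant\<close>

text \<open>
  The least constant in Grothendieck's inequality over the scalar field \<open>'k\<close>.  Finitely many
  vectors of a Hilbert space span a finite dimensional one, so the spaces \<open>\<ell>\<^sub>2\<^sup>d\<close> for all \<open>d\<close> stand
  for all Hilbert spaces.
\<close>

definition inner_l2 :: "nat \<Rightarrow> (nat \<Rightarrow> 'k::rc_field) \<Rightarrow> (nat \<Rightarrow> 'k) \<Rightarrow> 'k" where
  "inner_l2 d x y = (\<Sum>k<d. x k * rc_conj (y k))"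

definition grothendieck_bound :: "'k::rc_field itself \<Rightarrow> real \<Rightarrow> bool" where
  "grothendieck_bound _ K \<longleftrightarrow>
     (\<forall>m n (a :: nat \<Rightarrow> nat \<Rightarrow> 'k).
        (\<forall>s t :: nat \<Rightarrow> 'k. (\<forall>i<m. norm (s i) \<le> 1) \<and> (\<forall>j<n. norm (t j) \<le> 1) \<longrightarrow>
            norm (\<Sum>i<m. \<Sum>j<n. a i j * s i * t j) \<le> 1) \<longrightarrow>
        (\<forall>d (x :: nat \<Rightarrow> nat \<Rightarrow> 'k) (y :: nat \<Rightarrow> nat \<Rightarrow> 'k).
            (\<forall>i<m. lp_norm 2 d (x i) \<le> 1) \<and> (\<forall>j<n. lp_norm 2 d (y j) \<le> 1) \<longrightarrow>
            norm (\<Sum>i<m. \<Sum>j<n. a i j * inner_l2 d (x i) (y j)) \<le> K))"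

definition grothendieck_constant :: "'k::rc_field itself \<Rightarrow> real" where
  "grothendieck_constant k = Inf {K. grothendieck_bound k K}"

end

theory Submission
  imports Defs
begin

text \<open>
  A finite rank operator \<open>T\<close> factors as \<open>v \<circ> A\<close> with \<open>A\<close> from \<open>E\<close> to some \<open>\<ell>\<^sub>\<infinity>\<^sup>m\<close> of norm at most about
  \<open>lam * opnorm E F T\<close> and \<open>v\<close> a contraction into \<open>F\<close>.  On a finite net of the unit ball of \<open>E\<close>, which spans a
  subspace close to some \<open>\<ell>\<^sub>2\<^sup>d\<close>, the coordinates of \<open>A\<close> are inner products, so by Grothendieck's inequality
  and the bipolar theorem the matrix of values of \<open>A\<close> on the net is, up to a small error, \<open>K\<^sub>G * lam * lam' * opnorm E F T\<close>
  times an absolutely convex combination of tensors \<open>s \<otimes> t\<close> of vectors bounded by \<open>1\<close>.  This says that \<open>A\<close> maps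
  the unit ball into \<open>{\<Sum>k. \<alpha> k * w k | \<bar>\<alpha> k\<bar> \<le> 1}\<close> with control of the sum of the norms of the \<open>w k\<close>.

  An approximable operator is a sum of finite rank operators \<open>v\<^sub>n \<circ> A\<^sub>n\<close> with rapidly decreasing norms.
  Concatenating the sequences of the \<open>w\<^sub>n k\<close> with slowly growing weights bounds \<open>kappa1\<close>.  Distributing the
  weights \<open>2\<^sup>-\<^sup>n\<close>, \<open>4\<^sup>n\<close>, \<open>2\<^sup>-\<^sup>n\<close> over the blocks gives the factorization through the minimal kernel.
\<close>

section \<open>Scalars\<close>

text \<open>\<open>grothendieck_constant\<close> is an infimum of reals, so it obeys the inequality
  only if some finite bound exists; this is why Grothendieck's inequality is proved here, with the
  crude bound 128. It enters by duality: the matrices \<open>a\<close> whose bilinear form is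
  bounded by 1 form the polar of the tensors \<open>s \<otimes> t\<close>, so the inequality says
  that inner products of unit vectors, divided by the constant, lie in the bipolar of these tensors.
  The hull has to contain the image of the whole unit ball of \<open>E\<close>, while the inequality
  concerns finitely many vectors. A net bridges this gap because a uniform error \<open>e\<close> in
  \<open>\<ell>\<^sub>\<infinity>\<^sup>m\<close> costs \<open>m * e\<close>, however many points
  the net has. The price is that each \<open>x\<close> takes over the coefficients of a nearby net
  point, so they depend on \<open>x\<close> in a nonlinear way. Distances and infima need not be
  attained, hence the slack in almost every estimate. Approximation at the rate
  \<open>1 / 16 ^ n\<close> pays for the stretching by \<open>4 ^ n\<close> in the kernel
  factorization and for the factor \<open>2 ^ n\<close> that makes coefficients null, and still
  leaves a summable \<open>1 / 2 ^ n\<close>.\<close>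

lemma to_complex_zero [simp]: "to_complex (0::'k::rc_field) = 0"
  using to_complex_add[of "0::'k" 0] by simp

lemma to_complex_uminus: "to_complex (- x :: 'k::rc_field) = - to_complex x"
  using to_complex_add[of "- x" x] by (simp add: add_eq_0_iff)

lemma to_complex_diff: "to_complex (x - y :: 'k::rc_field) = to_complex x - to_complex y"
  using to_complex_add[of x "- y"] by (simp add: to_complex_uminus)

lemma to_complex_sum: "to_complex (\<Sum>i\<in>A. f i :: 'k::rc_field) = (\<Sum>i\<in>A. to_complex (f i))"
  by (induction A rule: infinite_finite_induct) (auto simp: to_complex_add)

lemma to_complex_of_real: "to_complex (of_real r :: 'k::rc_field) = of_real r"
  by (simp add: of_real_def to_complex_scaleR to_complex_one)

text \<open>An isometry is injective, so identities between scalars may be checked in the complex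
  numbers.\<close>

lemma to_complex_inject [simp]: "to_complex x = to_complex y \<longleftrightarrow> (x :: 'k::rc_field) = y"
proof -
  have "x = y" if "to_complex x = to_complex y"
  proof -
    have "norm (x - y) = 0"
      unfolding norm_to_complex[of "x - y", symmetric] using that by (simp add: to_complex_diff)
    then show ?thesis by simp
  qed
  then show ?thesis by auto
qed

lemma rc_eqI: "to_complex x = to_complex y \<Longrightarrow> (x :: 'k::rc_field) = y"
  by simp

lemmas to_complex_simps =
  to_complex_add to_complex_mult to_complex_diff to_complex_uminus to_complex_sum
  to_complex_rc_conj to_complex_of_real to_complex_one

lemma rc_conj_add: "rc_conj (x + y :: 'k::rc_field) = rc_conj x + rc_conj y"
  and rc_conj_diff: "rc_conj (x - y :: 'k::rc_field) = rc_conj x - rc_conj y"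
  and rc_conj_mult: "rc_conj (x * y :: 'k::rc_field) = rc_conj x * rc_conj y"
  and rc_conj_of_real: "rc_conj (of_real r :: 'k::rc_field) = of_real r"
  and rc_conj_rc_conj [simp]: "rc_conj (rc_conj x :: 'k::rc_field) = x"
  by (rule rc_eqI, simp add: to_complex_simps)+

lemma norm_rc_conj [simp]: "norm (rc_conj x :: 'k::rc_field) = norm x"
  by (metis complex_mod_cnj norm_to_complex to_complex_rc_conj)

lemma mult_rc_conj_self: "x * rc_conj x = (of_real ((norm x)\<^sup>2) :: 'k::rc_field)"
  by (rule rc_eqI)
    (simp add: to_complex_simps complex_norm_square norm_to_complex[of x, symmetric] del: of_real_power)

lemma complex_norm_add_squared:
  "(norm (u + v))\<^sup>2 = (norm u)\<^sup>2 + (norm v)\<^sup>2 + 2 * Re (u * cnj v)" for u v :: complex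
  by (simp add: cmod_power2) (simp add: algebra_simps power2_eq_square)

lemma rc_norm_add_squared:
  fixes u v :: "'k::rc_field"
  shows "(norm (u + v))\<^sup>2 = (norm u)\<^sup>2 + (norm v)\<^sup>2 + 2 * Re (to_complex (u * rc_conj v))"
  using complex_norm_add_squared[of "to_complex u" "to_complex v"]
  by (simp add: norm_to_complex to_complex_rc_conj to_complex_mult flip: to_complex_add)

lemma rc_norm_diff_squared:
  fixes u v :: "'k::rc_field"
  shows "(norm (u - v))\<^sup>2 = (norm u)\<^sup>2 + (norm v)\<^sup>2 - 2 * Re (to_complex (u * rc_conj v))"
  using complex_norm_add_squared[of "to_complex u" "- to_complex v"]
  by (simp add: norm_to_complex to_complex_rc_conj to_complex_mult flip: to_complex_diff)

lemma Re_to_complex_le: "Re (to_complex (x :: 'k::rc_field)) \<le> norm x"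
  by (metis complex_Re_le_cmod norm_to_complex)

text \<open>Completeness is not an axiom of \<open>rc_field\<close>. It comes from the isometry
  \<open>to_complex\<close>, whose range is the real line or the whole plane and hence
  closed.\<close>

lemma rc_Cauchy_convergent:
  fixes X :: "nat \<Rightarrow> 'k::rc_field"
  assumes "Cauchy X"
  shows "convergent X"
proof -
  have d: "dist (to_complex x) (to_complex y) = dist x y" for x y :: 'k
    by (simp add: dist_norm norm_to_complex flip: to_complex_diff)
  have "Cauchy (\<lambda>n. to_complex (X n))"
    using assms by (simp add: Cauchy_def d)
  then obtain L where L: "(\<lambda>n. to_complex (X n)) \<longlonglongrightarrow> L"
    using Cauchy_convergent convergent_def by blast
  have "closed (range (to_complex :: 'k \<Rightarrow> complex))"
    using range_to_complex[where 'a = 'k] closed_complex_Reals by auto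
  then have "L \<in> range (to_complex :: 'k \<Rightarrow> complex)"
    using L closed_sequentially[of "range to_complex" "\<lambda>n. to_complex (X n)" L] by auto
  then obtain l :: 'k where "L = to_complex l" by auto
  with L have "X \<longlonglongrightarrow> l"
    by (simp add: tendsto_iff d)
  then show ?thesis by (auto simp: convergent_def)
qed

text \<open>\<open>rc_field\<close> does not include the class \<open>banach\<close>, so the partial
  sums are shown to be Cauchy by hand and \<open>rc_Cauchy_convergent\<close> supplies the
  limit.\<close>

lemma rc_summable_comparison:
  fixes f :: "nat \<Rightarrow> 'k::rc_field"
  assumes "summable g" and le: "\<And>n. norm (f n) \<le> g n"
  shows "summable f"
proof -
  have "summable (\<lambda>n. norm (f n))"
    by (rule summable_comparison_test'[OF assms(1), of 0]) (simp add: le)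
  then have c: "Cauchy (\<lambda>n. \<Sum>i<n. norm (f i))"
    by (simp add: summable_iff_convergent convergent_Cauchy)
  have "Cauchy (\<lambda>n. \<Sum>i<n. f i)"
    unfolding Cauchy_altdef2
  proof (intro allI impI)
    fix e :: real assume "e > 0"
    then obtain M where M: "\<forall>n\<ge>M. dist (\<Sum>i<n. norm (f i)) (\<Sum>i<M. norm (f i)) < e"
      using c unfolding Cauchy_altdef2 by blast
    have "dist (\<Sum>i<n. f i) (\<Sum>i<M. f i) < e" if "n \<ge> M" for n
    proof -
      have split: "(\<Sum>i<n. h i) - (\<Sum>i<M. h i) = (\<Sum>i\<in>{M..<n}. h i)" for h :: "nat \<Rightarrow> 'c::ab_group_add"
        using that sum.atLeastLessThan_concat[of 0 M n h]
        by (simp add: lessThan_atLeast0 algebra_simps)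
      have "norm (\<Sum>i\<in>{M..<n}. f i) \<le> \<bar>\<Sum>i\<in>{M..<n}. norm (f i)\<bar>"
        by (simp add: norm_sum sum_nonneg)
      also have "\<dots> < e" using M that by (auto simp: dist_norm split)
      finally show ?thesis by (simp add: dist_norm split)
    qed
    then show "\<exists>N. \<forall>n\<ge>N. dist (\<Sum>i<n. f i) (\<Sum>i<N. f i) < e" by blast
  qed
  then show ?thesis
    by (simp add: summable_iff_convergent rc_Cauchy_convergent)
qed

section \<open>Grothendieck's inequality\<close>

lemma lp_norm_2:
  "lp_norm 2 d x = sqrt (\<Sum>i<d. (norm (x i))\<^sup>2)"
  "lp_norm (ereal 2) d x = sqrt (\<Sum>i<d. (norm (x i))\<^sup>2)"
  by (simp_all add: lp_norm_def powr_half_sqrt sum_nonneg)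

lemma lp_norm_2_le_iff:
  assumes "r \<ge> 0"
  shows "lp_norm (ereal 2) d x \<le> r \<longleftrightarrow> (\<Sum>i<d. (norm (x i))\<^sup>2) \<le> r\<^sup>2"
  using assms real_sqrt_le_iff[of _ "r\<^sup>2"] by (simp add: lp_norm_2)

lemma Cauchy_Schwarz_sum:
  fixes f g :: "'i \<Rightarrow> 'k::rc_field"
  shows "norm (\<Sum>k\<in>A. f k * rc_conj (g k))
    \<le> sqrt (\<Sum>k\<in>A. (norm (f k))\<^sup>2) * sqrt (\<Sum>k\<in>A. (norm (g k))\<^sup>2)"
proof -
  have "norm (\<Sum>k\<in>A. f k * rc_conj (g k)) \<le> (\<Sum>k\<in>A. \<bar>norm (f k)\<bar> * \<bar>norm (g k)\<bar>)"
    by (rule sum_norm_le) (simp add: norm_mult)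
  also have "\<dots> \<le> L2_set (\<lambda>k. norm (f k)) A * L2_set (\<lambda>k. norm (g k)) A"
    by (rule L2_set_mult_ineq)
  finally show ?thesis by (simp add: L2_set_def)
qed

text \<open>A sign vector is encoded by the set \<open>S\<close> of its positive places, so
  averaging over signs means summing over \<open>Pow {..<d}\<close>. The sums are not normalised;
  the factor \<open>2 ^ d\<close> appears in the moment formulas instead.\<close>

definition rademacher :: "nat \<Rightarrow> (nat \<Rightarrow> 'k::rc_field) \<Rightarrow> nat set \<Rightarrow> 'k" where
  "rademacher d x S = (\<Sum>k<d. if k \<in> S then x k else - x k)"

lemma rademacher_Suc:
  assumes "S \<in> Pow {..<d}"
  shows "rademacher (Suc d) x S = rademacher d x S - x d"
    and "rademacher (Suc d) x (insert d S) = rademacher d x S + x d"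
proof -
  have "d \<notin> S" using assms by auto
  then show "rademacher (Suc d) x S = rademacher d x S - x d"
    by (simp add: rademacher_def)
  have "(\<Sum>k<d. if k \<in> insert d S then x k else - x k) = (\<Sum>k<d. if k \<in> S then x k else - x k)"
    by (rule sum.cong) auto
  then show "rademacher (Suc d) x (insert d S) = rademacher d x S + x d"
    by (simp add: rademacher_def)
qed

lemma sum_Pow_lessThan_Suc:
  fixes f :: "nat set \<Rightarrow> 'c::comm_monoid_add"
  shows "(\<Sum>S\<in>Pow {..<Suc d}. f S) = (\<Sum>S\<in>Pow {..<d}. f S + f (insert d S))"
proof -
  have "inj_on (insert d) (Pow {..<d})"
    by (rule inj_onI) (metis Diff_insert_absorb PowD lessThan_iff less_irrefl subsetD)
  moreover have "Pow {..<d} \<inter> insert d ` Pow {..<d} = {}" by auto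
  ultimately show ?thesis
    by (simp add: lessThan_Suc Pow_insert sum.union_disjoint sum.reindex sum.distrib)
qed

text \<open>Orthonormality of the signs: adding the two values of the last sign cancels the mixed
  products and doubles the others.\<close>

lemma sum_rademacher_mult:
  "(\<Sum>S\<in>Pow {..<d}. rademacher d x S * rc_conj (rademacher d y S)) = 2 ^ d * inner_l2 d x y"
proof (induction d)
  case 0
  show ?case by (simp add: rademacher_def inner_l2_def)
next
  case (Suc d)
  have "(\<Sum>S\<in>Pow {..<Suc d}. rademacher (Suc d) x S * rc_conj (rademacher (Suc d) y S)) =
    (\<Sum>S\<in>Pow {..<d}. 2 * (rademacher d x S * rc_conj (rademacher d y S)) + 2 * (x d * rc_conj (y d)))"
    unfolding sum_Pow_lessThan_Suc
    by (rule sum.cong) (simp_all add: rademacher_Suc rc_conj_add rc_conj_diff algebra_simps)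
  also have "\<dots> = 2 ^ Suc d * inner_l2 (Suc d) x y"
    using Suc by (simp add: sum.distrib sum_distrib_left[symmetric] card_Pow inner_l2_def algebra_simps)
  finally show ?case .
qed

lemma sum_rademacher_power2:
  "(\<Sum>S\<in>Pow {..<d}. (norm (rademacher d x S))\<^sup>2) = 2 ^ d * (\<Sum>k<d. (norm (x k))\<^sup>2)"
    (is "?l = ?r")
proof -
  have "(of_real ?l :: 'a) = of_real ?r"
    using sum_rademacher_mult[of d x x] by (simp add: mult_rc_conj_self inner_l2_def)
  then show ?thesis by (simp only: of_real_eq_iff)
qed

text \<open>The two squared norms are \<open>p - q\<close> and \<open>p + q\<close>, so the terms of
  odd degree in \<open>q\<close> cancel. The constant is \<open>12 = 4 + 8\<close>, from the cross
  term of twice the square of \<open>p\<close> and from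
  \<open>\<bar>q\<bar> \<le> 2 * norm f * norm a\<close>.\<close>

lemma norm_power4_parallelogram:
  fixes f a :: "'k::rc_field"
  shows "norm (f - a) ^ 4 + norm (f + a) ^ 4
    \<le> 2 * (norm f) ^ 4 + 12 * (norm f)\<^sup>2 * (norm a)\<^sup>2 + 2 * (norm a) ^ 4"
proof -
  define p q where "p = (norm f)\<^sup>2 + (norm a)\<^sup>2" and "q = 2 * Re (to_complex (f * rc_conj a))"
  have "\<bar>Re (to_complex (f * rc_conj a))\<bar> \<le> norm (f * rc_conj a)"
    by (metis abs_Re_le_cmod norm_to_complex)
  then have "\<bar>q\<bar> \<le> \<bar>2 * (norm f * norm a)\<bar>"
    by (simp add: q_def norm_mult)
  then have "q\<^sup>2 \<le> (2 * (norm f * norm a))\<^sup>2"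
    by (simp only: abs_le_square_iff)
  moreover have "norm (f - a) ^ 4 + norm (f + a) ^ 4 = (p - q)\<^sup>2 + (p + q)\<^sup>2"
  proof -
    have "t ^ 4 = (t\<^sup>2)\<^sup>2" for t :: real by simp
    then show ?thesis
      by (simp only: rc_norm_add_squared rc_norm_diff_squared p_def q_def)
  qed
  moreover have "(p - q)\<^sup>2 + (p + q)\<^sup>2 = 2 * p\<^sup>2 + 2 * q\<^sup>2"
    by (simp add: power2_eq_square algebra_simps)
  moreover have "2 * p\<^sup>2 + 2 * (2 * (norm f * norm a))\<^sup>2
    = 2 * (norm f) ^ 4 + 12 * (norm f)\<^sup>2 * (norm a)\<^sup>2 + 2 * (norm a) ^ 4"
    by (simp add: p_def power2_eq_square power4_eq_xxxx algebra_simps)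
  ultimately show ?thesis by linarith
qed

text \<open>Khintchine's inequality for the fourth moment. The constant 3 is the least one for which
  the induction closes: the mixed term \<open>12 * s * a\<close> produced by one more sign must fit
  into that of \<open>2 * 3 * (s + a)\<^sup>2\<close>.\<close>

lemma sum_rademacher_power4:
  "(\<Sum>S\<in>Pow {..<d}. norm (rademacher d x S) ^ 4) \<le> 3 * 2 ^ d * (\<Sum>k<d. (norm (x k))\<^sup>2)\<^sup>2"
proof (induction d)
  case 0
  show ?case by (simp add: rademacher_def)
next
  case (Suc d)
  define s a where "s = (\<Sum>k<d. (norm (x k))\<^sup>2)" and "a = (norm (x d))\<^sup>2"
  have a4: "norm (x d) ^ 4 = a * a" by (simp add: a_def power2_eq_square power4_eq_xxxx)
  have "(\<Sum>S\<in>Pow {..<Suc d}. norm (rademacher (Suc d) x S) ^ 4) \<le>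
    (\<Sum>S\<in>Pow {..<d}. 2 * norm (rademacher d x S) ^ 4
       + 12 * (norm (rademacher d x S))\<^sup>2 * a + 2 * norm (x d) ^ 4)"
    unfolding sum_Pow_lessThan_Suc
    by (rule sum_mono) (simp add: rademacher_Suc a_def norm_power4_parallelogram)
  also have "\<dots> = 2 * (\<Sum>S\<in>Pow {..<d}. norm (rademacher d x S) ^ 4)
      + 12 * (2 ^ d * s) * a + 2 ^ d * (2 * norm (x d) ^ 4)"
    by (simp add: sum.distrib sum_distrib_left[symmetric] sum_distrib_right[symmetric] card_Pow
        sum_rademacher_power2 s_def)
  also have "\<dots> \<le> 2 * (3 * 2 ^ d * s\<^sup>2) + 12 * (2 ^ d * s) * a + 2 ^ d * (2 * (a * a))"
    using Suc by (simp add: s_def a4)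
  also have "\<dots> \<le> 3 * 2 ^ Suc d * (s + a)\<^sup>2"
    by (simp add: power2_eq_square algebra_simps a_def)
  finally show ?case by (simp add: s_def a_def)
qed

text \<open>The inner product of \<open>x\<close> and \<open>y\<close> is the mean of \<open>f * rc_conj g\<close> for the Rademacher sums \<open>f\<close>, \<open>g\<close> of
  \<open>x\<close>, \<open>y\<close>.  Truncated at \<open>4\<close>, these are bounded and contribute at most \<open>4\<^sup>2\<close>; by the fourth moment bound
  the remainders have \<open>L\<^sub>2\<close>-norm at most \<open>sqrt 3 / 4 \<le> 7 / 16\<close>.\<close>

lemma grothendieck_bound_step:
  fixes a :: "nat \<Rightarrow> nat \<Rightarrow> 'k::rc_field"
  assumes a: "\<And>s t :: nat \<Rightarrow> 'k. (\<forall>i<m. norm (s i) \<le> 1) \<Longrightarrow> (\<forall>j<n. norm (t j) \<le> 1) \<Longrightarrow>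
      norm (\<Sum>i<m. \<Sum>j<n. a i j * s i * t j) \<le> 1"
    and K: "\<And>d (x :: nat \<Rightarrow> nat \<Rightarrow> 'k) y. (\<forall>i<m. lp_norm 2 d (x i) \<le> 1) \<Longrightarrow>
      (\<forall>j<n. lp_norm 2 d (y j) \<le> 1) \<Longrightarrow> norm (\<Sum>i<m. \<Sum>j<n. a i j * inner_l2 d (x i) (y j)) \<le> K"
    and x: "\<forall>i<m. lp_norm 2 d (x i) \<le> 1" and y: "\<forall>j<n. lp_norm 2 d (y j) \<le> 1"
  shows "norm (\<Sum>i<m. \<Sum>j<n. a i j * inner_l2 d (x i) (y j)) \<le> 16 + 7 / 8 * K"
proof -
  define \<Omega> where "\<Omega> = Pow {..<d}"
  have fin: "finite \<Omega>" by (simp add: \<Omega>_def)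
  have card: "card \<Omega> = 2 ^ d" by (simp add: \<Omega>_def card_Pow)
  define F where "F i = rademacher d (x i)" for i
  define G where "G j = rademacher d (y j)" for j
  define tr :: "'k \<Rightarrow> 'k" where "tr z = (if norm z \<le> 4 then z else 0)" for z
  have tr: "norm (tr z) \<le> 4" and tr_le: "norm (tr z) \<le> norm z"
    and tr_diff: "(norm (z - tr z))\<^sup>2 \<le> norm z ^ 4 / 16" for z
  proof -
    show "norm (tr z) \<le> 4" "norm (tr z) \<le> norm z" by (simp_all add: tr_def)
    have "16 * (norm z)\<^sup>2 \<le> norm z ^ 4" if "norm z > 4"
    proof -
      have "4\<^sup>2 \<le> (norm z)\<^sup>2" using that by (intro power_mono) auto
      then have "4\<^sup>2 * (norm z)\<^sup>2 \<le> (norm z)\<^sup>2 * (norm z)\<^sup>2" by (rule mult_right_mono) simp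
      then show ?thesis by (simp add: power2_eq_square power4_eq_xxxx mult.assoc)
    qed
    then show "(norm (z - tr z))\<^sup>2 \<le> norm z ^ 4 / 16" by (auto simp: tr_def)
  qed
  \<comment> \<open>The \<open>f i\<close> and \<open>g j\<close> are vectors of the Hilbert space
    of functions on the set \<open>\<Omega>\<close> of sign patterns, and \<open>Q\<close> is the
    expression to be bounded, evaluated at them.\<close>
  define Q where "Q f g = (\<Sum>i<m. \<Sum>j<n. a i j * (\<Sum>\<omega>\<in>\<Omega>. f i \<omega> * rc_conj (g j \<omega>)))"
    for f g :: "nat \<Rightarrow> nat set \<Rightarrow> 'k"
  have K0: "K \<ge> 0"
    using K[of 0 "\<lambda>_ _. 0" "\<lambda>_ _. 0"] by (simp add: inner_l2_def lp_norm_2)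
  \<comment> \<open>Enumerating \<open>\<Omega>\<close> turns functions into vectors of dimension
    \<open>card \<Omega>\<close>; divided by \<open>r\<close> and \<open>s\<close> they fall under
    the assumed bound \<open>K\<close>. For this reason \<open>K\<close> is assumed for all
    dimensions at once.\<close>
  have Q_le: "norm (Q f g) \<le> r * s * K"
    if f: "\<And>i. i < m \<Longrightarrow> (\<Sum>\<omega>\<in>\<Omega>. (norm (f i \<omega>))\<^sup>2) \<le> r\<^sup>2" and r: "r > 0"
      and g: "\<And>j. j < n \<Longrightarrow> (\<Sum>\<omega>\<in>\<Omega>. (norm (g j \<omega>))\<^sup>2) \<le> s\<^sup>2" and s: "s > 0" for f g r s
  proof -
    obtain b where b: "bij_betw b {..<card \<Omega>} \<Omega>"
      using ex_bij_betw_nat_finite[OF fin] by (auto simp: lessThan_atLeast0)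
    define x' where "x' i k = of_real (1 / r) * f i (b k)" for i k
    define y' where "y' j k = of_real (1 / s) * g j (b k)" for j k
    have sum_b: "(\<Sum>k<card \<Omega>. h (b k)) = (\<Sum>\<omega>\<in>\<Omega>. h \<omega>)" for h :: "nat set \<Rightarrow> 'c::comm_monoid_add"
      by (rule sum.reindex_bij_betw[OF b])
    have "(\<Sum>k<card \<Omega>. (norm (x' i k))\<^sup>2) = (1 / r)\<^sup>2 * (\<Sum>\<omega>\<in>\<Omega>. (norm (f i \<omega>))\<^sup>2)" for i
      using sum_b[of "\<lambda>\<omega>. (norm (f i \<omega>))\<^sup>2"]
      by (simp add: x'_def norm_mult norm_divide power_mult_distrib power_divide sum_divide_distrib[symmetric])
    then have 1: "\<forall>i<m. lp_norm 2 (card \<Omega>) (x' i) \<le> 1"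
      using f r by (simp add: lp_norm_2_le_iff power_divide)
    have "(\<Sum>k<card \<Omega>. (norm (y' i k))\<^sup>2) = (1 / s)\<^sup>2 * (\<Sum>\<omega>\<in>\<Omega>. (norm (g i \<omega>))\<^sup>2)" for i
      using sum_b[of "\<lambda>\<omega>. (norm (g i \<omega>))\<^sup>2"]
      by (simp add: y'_def norm_mult norm_divide power_mult_distrib power_divide sum_divide_distrib[symmetric])
    then have 2: "\<forall>j<n. lp_norm 2 (card \<Omega>) (y' j) \<le> 1"
      using g s by (simp add: lp_norm_2_le_iff power_divide)
    have "inner_l2 (card \<Omega>) (x' i) (y' j)
        = of_real (1 / (r * s)) * (\<Sum>\<omega>\<in>\<Omega>. f i \<omega> * rc_conj (g j \<omega>))" for i j
    proof -
      have "x' i k * rc_conj (y' j k) = of_real (1 / (r * s)) * (f i (b k) * rc_conj (g j (b k)))" for k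
        unfolding x'_def y'_def rc_conj_mult rc_conj_of_real by simp
      then show ?thesis
        unfolding inner_l2_def sum_b[symmetric] sum_distrib_left by simp
    qed
    then have eq: "(\<Sum>i<m. \<Sum>j<n. a i j * inner_l2 (card \<Omega>) (x' i) (y' j)) = of_real (1 / (r * s)) * Q f g"
      by (simp only: Q_def sum_distrib_left mult.left_commute)
    have "norm (of_real (1 / (r * s)) * Q f g) \<le> K"
      unfolding eq[symmetric] by (rule K[OF 1 2])
    moreover have "norm (of_real (1 / (r * s)) * Q f g) = norm (Q f g) / (r * s)"
      using r s by (simp add: norm_mult norm_divide)
    ultimately show ?thesis
      using r s by (simp add: divide_le_eq mult.commute)
  qed
  define c where "c = sqrt (2 ^ d)"
  have c: "c > 0" "c\<^sup>2 = 2 ^ d" by (simp_all add: c_def)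
  have x2: "(\<Sum>k<d. (norm (x i k))\<^sup>2) \<le> 1" if "i < m" for i
    using x that by (simp add: lp_norm_2_le_iff)
  have y2: "(\<Sum>k<d. (norm (y i k))\<^sup>2) \<le> 1" if "i < n" for i
    using y that by (simp add: lp_norm_2_le_iff)
  have F2: "(\<Sum>\<omega>\<in>\<Omega>. (norm (F i \<omega>))\<^sup>2) \<le> c\<^sup>2" if "i < m" for i
    using x2[OF that] by (simp add: F_def \<Omega>_def sum_rademacher_power2 c)
  have G2: "(\<Sum>\<omega>\<in>\<Omega>. (norm (G i \<omega>))\<^sup>2) \<le> c\<^sup>2" if "i < n" for i
    using y2[OF that] by (simp add: G_def \<Omega>_def sum_rademacher_power2 c)
  have Ft2: "(\<Sum>\<omega>\<in>\<Omega>. (norm (tr (F i \<omega>)))\<^sup>2) \<le> c\<^sup>2" if "i < m" for i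
  proof -
    have "(\<Sum>\<omega>\<in>\<Omega>. (norm (tr (F i \<omega>)))\<^sup>2) \<le> (\<Sum>\<omega>\<in>\<Omega>. (norm (F i \<omega>))\<^sup>2)"
      by (intro sum_mono power_mono tr_le) simp
    then show ?thesis using F2[OF that] by simp
  qed
  have rest: "(\<Sum>\<omega>\<in>\<Omega>. (norm (rademacher d z \<omega> - tr (rademacher d z \<omega>)))\<^sup>2) \<le> (7 / 16 * c)\<^sup>2"
    if "(\<Sum>k<d. (norm (z k))\<^sup>2) \<le> 1" for z
  proof -
    have "(\<Sum>\<omega>\<in>\<Omega>. (norm (rademacher d z \<omega> - tr (rademacher d z \<omega>)))\<^sup>2)
      \<le> (\<Sum>\<omega>\<in>\<Omega>. norm (rademacher d z \<omega>) ^ 4 / 16)"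
      by (intro sum_mono tr_diff)
    also have "\<dots> \<le> 3 * 2 ^ d * (\<Sum>k<d. (norm (z k))\<^sup>2)\<^sup>2 / 16"
      unfolding sum_divide_distrib[symmetric] \<Omega>_def
      by (rule divide_right_mono[OF sum_rademacher_power4]) simp
    also have "\<dots> \<le> 3 * 2 ^ d * 1 / 16"
      using that by (intro divide_right_mono mult_left_mono power_le_one sum_nonneg) auto
    \<comment> \<open>Here \<open>3 / 16 = 48 / 256\<close> is at most \<open>49 / 256\<close>, the
      square of \<open>7 / 16\<close>.\<close>
    also have "\<dots> \<le> (7 / 16 * c)\<^sup>2"
      by (simp add: power_mult_distrib c power_divide)
    finally show ?thesis .
  qed
  have "2 ^ d * (\<Sum>i<m. \<Sum>j<n. a i j * inner_l2 d (x i) (y j)) = Q F G"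
    unfolding Q_def F_def G_def \<Omega>_def sum_rademacher_mult
    by (simp add: sum_distrib_left algebra_simps)
  \<comment> \<open>Besides the truncated part there are two terms with one factor replaced by its
    remainder; each contributes \<open>7 / 16 * K\<close>, which gives
    \<open>7 / 8 * K\<close>.\<close>
  also have "\<dots> = Q (\<lambda>i \<omega>. tr (F i \<omega>)) (\<lambda>j \<omega>. tr (G j \<omega>))
      + Q (\<lambda>i \<omega>. F i \<omega> - tr (F i \<omega>)) G + Q (\<lambda>i \<omega>. tr (F i \<omega>)) (\<lambda>j \<omega>. G j \<omega> - tr (G j \<omega>))"
  proof -
    have "F i \<omega> * rc_conj (G j \<omega>) = tr (F i \<omega>) * rc_conj (tr (G j \<omega>))
      + (F i \<omega> - tr (F i \<omega>)) * rc_conj (G j \<omega>) + tr (F i \<omega>) * rc_conj (G j \<omega> - tr (G j \<omega>))" for i j \<omega>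
      by (simp add: rc_conj_diff algebra_simps)
    then show ?thesis
      unfolding Q_def by (simp only: sum.distrib distrib_left)
  qed
  finally have eq: "2 ^ d * (\<Sum>i<m. \<Sum>j<n. a i j * inner_l2 d (x i) (y j)) = \<dots>" .
  \<comment> \<open>For each fixed \<open>\<omega>\<close> the truncated values divided by 4 are
    admissible scalars in the hypothesis on \<open>a\<close>; undoing the division costs
    \<open>4 * 4 = 16\<close> per sign pattern.\<close>
  have "norm (Q (\<lambda>i \<omega>. tr (F i \<omega>)) (\<lambda>j \<omega>. tr (G j \<omega>))) \<le> 16 * 2 ^ d"
  proof -
    have "Q (\<lambda>i \<omega>. tr (F i \<omega>)) (\<lambda>j \<omega>. tr (G j \<omega>))
      = (\<Sum>i<m. \<Sum>\<omega>\<in>\<Omega>. \<Sum>j<n. a i j * (tr (F i \<omega>) * rc_conj (tr (G j \<omega>))))"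
      unfolding Q_def sum_distrib_left by (intro sum.cong refl sum.swap)
    also have "\<dots> = (\<Sum>\<omega>\<in>\<Omega>. \<Sum>i<m. \<Sum>j<n. a i j * (tr (F i \<omega>) * rc_conj (tr (G j \<omega>))))"
      by (rule sum.swap)
    also have "\<dots> = (\<Sum>\<omega>\<in>\<Omega>. 16 * (\<Sum>i<m. \<Sum>j<n. a i j * (tr (F i \<omega>) / 4) * (rc_conj (tr (G j \<omega>)) / 4)))"
      by (simp add: sum_distrib_left mult.assoc)
    finally have "norm (Q (\<lambda>i \<omega>. tr (F i \<omega>)) (\<lambda>j \<omega>. tr (G j \<omega>))) \<le> (\<Sum>\<omega>\<in>\<Omega>. 16)"
    proof (elim ssubst, intro sum_norm_le)
      fix \<omega>
      have "norm (\<Sum>i<m. \<Sum>j<n. a i j * (tr (F i \<omega>) / 4) * (rc_conj (tr (G j \<omega>)) / 4)) \<le> 1"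
        by (rule a) (auto simp: norm_divide tr)
      then show "norm (16 * (\<Sum>i<m. \<Sum>j<n. a i j * (tr (F i \<omega>) / 4) * (rc_conj (tr (G j \<omega>)) / 4))) \<le> 16"
        unfolding norm_mult by simp
    qed
    then show ?thesis by (simp add: card)
  qed
  moreover have "norm (Q (\<lambda>i \<omega>. F i \<omega> - tr (F i \<omega>)) G) \<le> (7 / 16 * c) * c * K"
    by (rule Q_le) (use rest x2 G2 c in \<open>auto simp: F_def\<close>)
  moreover have "norm (Q (\<lambda>i \<omega>. tr (F i \<omega>)) (\<lambda>j \<omega>. G j \<omega> - tr (G j \<omega>))) \<le> c * (7 / 16 * c) * K"
    by (rule Q_le) (use rest y2 Ft2 c in \<open>auto simp: G_def\<close>)
  ultimately have "norm (2 ^ d * (\<Sum>i<m. \<Sum>j<n. a i j * inner_l2 d (x i) (y j)))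
     \<le> 16 * 2 ^ d + (7 / 16 * c) * c * K + c * (7 / 16 * c) * K"
    unfolding eq by (intro norm_triangle_le add_mono) auto
  also have "\<dots> = 2 ^ d * (16 + 7 / 8 * K)"
    unfolding c(2)[symmetric] by (simp add: power2_eq_square algebra_simps)
  finally show ?thesis
    by (simp add: norm_mult norm_power)
qed

text \<open>128 is the fixed point of \<open>K \<mapsto> 16 + 7 / 8 * K\<close>. The step needs some
  finite bound to start from; the sum of the \<open>norm (a i j)\<close> is one by Cauchy-Schwarz,
  and its influence dies out like \<open>(7 / 8) ^ N\<close>.\<close>

lemma grothendieck_bound_128: "grothendieck_bound TYPE('k::rc_field) 128"
  unfolding grothendieck_bound_def
proof (intro allI impI)
  fix m n :: nat and a :: "nat \<Rightarrow> nat \<Rightarrow> 'k" and d :: nat and x y :: "nat \<Rightarrow> nat \<Rightarrow> 'k"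
  assume "\<forall>s t :: nat \<Rightarrow> 'k. (\<forall>i<m. norm (s i) \<le> 1) \<and> (\<forall>j<n. norm (t j) \<le> 1) \<longrightarrow>
            norm (\<Sum>i<m. \<Sum>j<n. a i j * s i * t j) \<le> 1"
  then have a: "norm (\<Sum>i<m. \<Sum>j<n. a i j * s i * t j) \<le> 1"
    if "\<forall>i<m. norm (s i) \<le> 1" "\<forall>j<n. norm (t j) \<le> 1" for s t :: "nat \<Rightarrow> 'k"
    using that by blast
  assume xy: "(\<forall>i<m. lp_norm 2 d (x i) \<le> 1) \<and> (\<forall>j<n. lp_norm 2 d (y j) \<le> 1)"
  define c where "c = (\<Sum>i<m. \<Sum>j<n. norm (a i j))"
  have bound: "norm (\<Sum>i<m. \<Sum>j<n. a i j * inner_l2 d (x i) (y j)) \<le> 128 + (7 / 8) ^ N * c"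
    if "\<forall>i<m. lp_norm 2 d (x i) \<le> 1" "\<forall>j<n. lp_norm 2 d (y j) \<le> 1"
    for N d and x y :: "nat \<Rightarrow> nat \<Rightarrow> 'k"
    using that
  proof (induction N arbitrary: d x y)
    case 0
    have "norm (inner_l2 d (x i) (y j)) \<le> 1" if "i < m" "j < n" for i j
    proof -
      have "norm (inner_l2 d (x i) (y j)) \<le> lp_norm 2 d (x i) * lp_norm 2 d (y j)"
        unfolding inner_l2_def lp_norm_2 by (rule Cauchy_Schwarz_sum)
      also have "\<dots> \<le> 1 * 1"
        using 0 that by (intro mult_mono) (auto simp: lp_norm_2 sum_nonneg)
      finally show ?thesis by simp
    qed
    then have "norm (\<Sum>i<m. \<Sum>j<n. a i j * inner_l2 d (x i) (y j)) \<le> c"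
      unfolding c_def
      by (intro sum_norm_le) (auto simp: norm_mult intro!: mult_left_le)
    then show ?case by simp
  next
    case (Suc N)
    have "norm (\<Sum>i<m. \<Sum>j<n. a i j * inner_l2 d (x i) (y j)) \<le> 16 + 7 / 8 * (128 + (7 / 8) ^ N * c)"
      by (rule grothendieck_bound_step) (use a Suc in auto)
    then show ?case by (simp add: field_simps)
  qed
  have "(\<lambda>N. 128 + (7 / 8) ^ N * c) \<longlonglongrightarrow> 128 + 0 * c"
    by (intro tendsto_intros LIMSEQ_power_zero) simp
  then show "norm (\<Sum>i<m. \<Sum>j<n. a i j * inner_l2 d (x i) (y j)) \<le> 128"
    using bound xy by (intro LIMSEQ_le_const[of _ 128]) auto
qed

text \<open>The left-hand side is a lower bound of all admissible constants, hence at most their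
  infimum; \<open>grothendieck_bound_128\<close> ensures that the infimum is over a nonempty
  set.\<close>

lemma grothendieck_inequality:
  fixes a :: "nat \<Rightarrow> nat \<Rightarrow> 'k::rc_field"
  assumes "\<And>s t :: nat \<Rightarrow> 'k. (\<forall>i<m. norm (s i) \<le> 1) \<Longrightarrow> (\<forall>j<n. norm (t j) \<le> 1) \<Longrightarrow>
      norm (\<Sum>i<m. \<Sum>j<n. a i j * s i * t j) \<le> 1"
    and "\<forall>i<m. lp_norm 2 d (x i) \<le> 1" and "\<forall>j<n. lp_norm 2 d (y j) \<le> 1"
  shows "norm (\<Sum>i<m. \<Sum>j<n. a i j * inner_l2 d (x i) (y j)) \<le> grothendieck_constant TYPE('k)"
  unfolding grothendieck_constant_def
proof (rule cInf_greatest)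
  show "{K. grothendieck_bound TYPE('k) K} \<noteq> {}"
    using grothendieck_bound_128 by blast
  fix K assume "K \<in> {K. grothendieck_bound TYPE('k) K}"
  then show "norm (\<Sum>i<m. \<Sum>j<n. a i j * inner_l2 d (x i) (y j)) \<le> K"
    using assms unfolding grothendieck_bound_def by blast
qed

lemma grothendieck_constant_nonneg: "0 \<le> grothendieck_constant TYPE('k::rc_field)"
  using grothendieck_inequality[of 0 0 "\<lambda>_ _. 0 :: 'k" 0 "\<lambda>_ _. 0" "\<lambda>_ _. 0"] by simp

section \<open>A bipolar theorem in finite dimensions\<close>

lemma rc_unimodular_multiple:
  fixes z :: "'k::rc_field"
  obtains \<theta> where "norm \<theta> = 1" and "\<theta> * z = of_real (norm z)"
proof (cases "z = 0")
  case True
  then show ?thesis using that[of 1] by simp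
next
  case False
  define \<theta> where "\<theta> = of_real (1 / norm z) * rc_conj z"
  have "\<theta> * z = of_real (1 / norm z * (norm z)\<^sup>2)"
    unfolding of_real_mult mult_rc_conj_self[symmetric] by (simp add: \<theta>_def mult_ac)
  moreover have "1 / norm z * (norm z)\<^sup>2 = norm z"
    using False by (simp add: power2_eq_square)
  moreover have "norm \<theta> = 1"
    using False by (simp add: \<theta>_def norm_mult norm_divide)
  ultimately show ?thesis using that by metis
qed


text \<open>Instead of the nearest point of \<open>C\<close>, which need not exist, the proof uses a point \<open>c\<close> that is
  nearest up to a small error; the separating functional is then \<open>z - c\<close>.\<close>

lemma bipolar_approximation:
  fixes C :: "('i \<Rightarrow> 'k::rc_field) set" and z :: "'i \<Rightarrow> 'k"
  assumes "finite I" and ne: "C \<noteq> {}"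
    and convex: "\<And>x y t. x \<in> C \<Longrightarrow> y \<in> C \<Longrightarrow> 0 \<le> t \<Longrightarrow> t \<le> 1 \<Longrightarrow>
        (\<lambda>i. of_real (1 - t) * x i + of_real t * y i) \<in> C"
    and balanced: "\<And>x \<theta>. x \<in> C \<Longrightarrow> norm \<theta> = 1 \<Longrightarrow> (\<lambda>i. \<theta> * x i) \<in> C"
    and bounded: "\<And>x i. x \<in> C \<Longrightarrow> i \<in> I \<Longrightarrow> norm (x i) \<le> B"
    and polar: "\<And>a :: 'i \<Rightarrow> 'k. (\<And>x. x \<in> C \<Longrightarrow> norm (\<Sum>i\<in>I. a i * x i) \<le> 1) \<Longrightarrow>
        norm (\<Sum>i\<in>I. a i * z i) \<le> 1"
    and "e > 0"
  shows "\<exists>c\<in>C. \<forall>i\<in>I. norm (z i - c i) \<le> e"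
proof -
  define q where "q x = (\<Sum>i\<in>I. (norm (z i - x i))\<^sup>2)" for x
  \<comment> \<open>\<open>D\<close> bounds the squared distance on \<open>I\<close> between any two
    points of \<open>C\<close>.\<close>
  define D where "D = real (card I) * (2 * \<bar>B\<bar>)\<^sup>2"
  have q0: "q x \<ge> 0" for x by (simp add: q_def sum_nonneg)
  have D0: "D \<ge> 0" by (simp add: D_def)
  define d where "d = Inf (q ` C)"
  have bdd: "bdd_below (q ` C)" using q0 by (auto intro: bdd_belowI[of _ 0])
  have d_le: "d \<le> q x" if "x \<in> C" for x
    unfolding d_def by (rule cInf_lower) (use that bdd in auto)
  have d0: "d \<ge> 0" unfolding d_def by (rule cInf_greatest) (use ne q0 in auto)
  have near: "\<exists>c\<in>C. q c < d + r" if "r > 0" for r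
    using cInf_lessD[of "q ` C" "d + r"] ne that by (auto simp: d_def)
  have "d = 0"
  proof (rule ccontr)
    assume "d \<noteq> 0"
    with d0 have dpos: "d > 0" by simp
    \<comment> \<open>\<open>\<delta>\<close> is the length of a step along a segment in
      \<open>C\<close> and, squared, the permitted defect of \<open>c\<close>. The bound
      \<open>\<delta> * (D + 2) \<le> d\<close> makes the error \<open>\<eta>\<close> below smaller
      than \<open>d\<close>.\<close>
    define \<delta> where "\<delta> = min 1 (d / (D + 2))"
    have \<delta>: "\<delta> > 0" "\<delta> \<le> 1"
      using dpos D0 by (auto simp: \<delta>_def)
    have "\<delta> \<le> d / (D + 2)" by (simp add: \<delta>_def)
    then have \<delta>3: "\<delta> * (D + 2) \<le> d"
      using D0 by (simp add: pos_le_divide_eq)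
    obtain c where c: "c \<in> C" "q c < d + \<delta>\<^sup>2"
      using near[of "\<delta>\<^sup>2"] \<delta> by auto
    define a where "a i = rc_conj (z i - c i)" for i
    define \<eta> where "\<eta> = \<delta> * (1 + D) / 2"
    define \<phi> where "\<phi> x = (\<Sum>i\<in>I. a i * x i)" for x
    \<comment> \<open>A step from \<open>c\<close> towards \<open>x\<close> lowers the squared
      distance to \<open>z\<close> by less than the square of \<open>\<delta>\<close>. Expanding the
      square and dividing by \<open>2 * \<delta>\<close> gives the variational inequality up to
      \<open>\<eta>\<close>.\<close>
    have Re_le: "Re (to_complex (\<phi> x)) \<le> Re (to_complex (\<phi> c)) + \<eta>" if x: "x \<in> C" for x
    proof -
      define y where "y i = of_real (1 - \<delta>) * c i + of_real \<delta> * x i" for i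
      have y: "y \<in> C" unfolding y_def using convex c x \<delta> by auto
      have zy: "z i - y i = (z i - c i) - of_real \<delta> * (x i - c i)" for i
        by (simp add: y_def algebra_simps)
      have "(norm (z i - y i))\<^sup>2 = (norm (z i - c i))\<^sup>2 + \<delta>\<^sup>2 * (norm (x i - c i))\<^sup>2
          - 2 * \<delta> * Re (to_complex (a i * (x i - c i)))" for i
      proof -
        have "Re (to_complex ((z i - c i) * rc_conj (of_real \<delta> * (x i - c i))))
            = \<delta> * Re (to_complex (a i * (x i - c i)))"
          by (simp add: a_def to_complex_simps rc_conj_mult rc_conj_of_real algebra_simps)
        then show ?thesis
          unfolding zy rc_norm_diff_squared[of "z i - c i"] by (simp add: norm_mult power_mult_distrib)
      qed
      then have "q y = q c + \<delta>\<^sup>2 * (\<Sum>i\<in>I. (norm (x i - c i))\<^sup>2)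
          - 2 * \<delta> * (\<Sum>i\<in>I. Re (to_complex (a i * (x i - c i))))"
        by (simp add: q_def sum.distrib sum_subtractf sum_distrib_left)
      also have "(\<Sum>i\<in>I. Re (to_complex (a i * (x i - c i))))
          = Re (to_complex (\<phi> x)) - Re (to_complex (\<phi> c))"
        by (simp add: \<phi>_def to_complex_simps right_diff_distrib sum_subtractf)
      finally have qy: "q y = q c + \<delta>\<^sup>2 * (\<Sum>i\<in>I. (norm (x i - c i))\<^sup>2)
          - 2 * \<delta> * (Re (to_complex (\<phi> x)) - Re (to_complex (\<phi> c)))" .
      have "(\<Sum>i\<in>I. (norm (x i - c i))\<^sup>2) \<le> (\<Sum>i\<in>I. (2 * \<bar>B\<bar>)\<^sup>2)"
      proof (intro sum_mono power_mono)
        fix i assume i: "i \<in> I"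
        show "norm (x i - c i) \<le> 2 * \<bar>B\<bar>"
          using bounded[OF x i] bounded[OF c(1) i] norm_triangle_ineq4[of "x i" "c i"] by linarith
      qed simp
      then have "\<delta>\<^sup>2 * (\<Sum>i\<in>I. (norm (x i - c i))\<^sup>2) \<le> \<delta>\<^sup>2 * D"
        by (intro mult_left_mono) (simp_all add: D_def)
      then have "2 * \<delta> * (Re (to_complex (\<phi> x)) - Re (to_complex (\<phi> c))) \<le> \<delta>\<^sup>2 + \<delta>\<^sup>2 * D"
        using qy d_le[OF y] c(2) by linarith
      then have "\<delta> * (2 * (Re (to_complex (\<phi> x)) - Re (to_complex (\<phi> c)))) \<le> \<delta> * (\<delta> * (1 + D))"
        by (simp add: power2_eq_square algebra_simps)
      then show ?thesis
        using \<delta>(1) by (simp add: \<eta>_def)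
    qed
    define \<rho> where "\<rho> = Re (to_complex (\<phi> c)) + \<eta>"
    \<comment> \<open>Since \<open>C\<close> is balanced, \<open>x\<close> can be rotated until
      \<open>\<phi> x\<close> is real and nonnegative, so the bound on real parts becomes one on
      moduli.\<close>
    have norm_le: "norm (\<phi> x) \<le> \<rho>" if x: "x \<in> C" for x
    proof -
      obtain \<theta> where \<theta>: "norm \<theta> = 1" "\<theta> * \<phi> x = of_real (norm (\<phi> x))"
        by (rule rc_unimodular_multiple)
      have "\<phi> (\<lambda>i. \<theta> * x i) = \<theta> * \<phi> x" by (simp add: \<phi>_def sum_distrib_left algebra_simps)
      with Re_le[OF balanced[OF x \<theta>(1)]] \<theta>(2) show ?thesis
        by (simp add: \<rho>_def to_complex_of_real)
    qed
    have \<eta>: "\<eta> > 0" using \<delta>(1) D0 by (simp add: \<eta>_def)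
    have \<rho>0: "\<rho> \<ge> 0" using norm_le[OF c(1)] norm_ge_zero order_trans by blast
    \<comment> \<open>\<open>polar\<close> wants a functional bounded by 1 on \<open>C\<close>. At
      this point \<open>\<rho> \<ge> 0\<close> is known, so the division is by
      \<open>\<rho> + r\<close>, and \<open>r\<close> tends to 0 afterwards.\<close>
    have z_le: "norm (\<phi> z) \<le> \<rho> + r" if r: "r > 0" for r
    proof -
      define s where "s = 1 / (\<rho> + r)"
      have s: "s > 0" "s * (\<rho> + r) = 1" using \<rho>0 r by (simp_all add: s_def)
      have "norm (\<Sum>i\<in>I. of_real s * a i * x i) \<le> 1" if "x \<in> C" for x
      proof -
        have "(\<Sum>i\<in>I. of_real s * a i * x i) = of_real s * \<phi> x"
          by (simp only: \<phi>_def sum_distrib_left mult.assoc)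
        moreover have "s * norm (\<phi> x) \<le> s * (\<rho> + r)"
          using norm_le[OF that] r s(1) by (intro mult_left_mono) auto
        ultimately show ?thesis using s by (simp add: norm_mult)
      qed
      then have "norm (\<Sum>i\<in>I. of_real s * a i * z i) \<le> 1" by (rule polar)
      also have "(\<Sum>i\<in>I. of_real s * a i * z i) = of_real s * \<phi> z"
        by (simp only: \<phi>_def sum_distrib_left mult.assoc)
      finally have "s * norm (\<phi> z) \<le> s * (\<rho> + r)"
        using s by (simp add: norm_mult)
      then show ?thesis using s(1) by simp
    qed
    have "norm (\<phi> z) \<le> \<rho>"
      by (rule field_le_epsilon) (rule z_le)
    then have "Re (to_complex (\<phi> z)) \<le> Re (to_complex (\<phi> c)) + \<eta>"
      using Re_to_complex_le[of "\<phi> z"] by (simp add: \<rho>_def)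
    \<comment> \<open>The coefficients of \<open>\<phi>\<close> are the conjugates of
      \<open>z - c\<close>, so this difference is the squared distance itself. It is at least
      \<open>d\<close>, contradicting \<open>\<eta> < d\<close>.\<close>
    moreover have "Re (to_complex (\<phi> z)) - Re (to_complex (\<phi> c)) = q c"
    proof -
      have "\<phi> z - \<phi> c = (\<Sum>i\<in>I. (z i - c i) * rc_conj (z i - c i))"
        by (simp add: \<phi>_def a_def sum_subtractf[symmetric] algebra_simps)
      also have "\<dots> = of_real (q c)" by (simp add: mult_rc_conj_self q_def)
      finally have "Re (to_complex (\<phi> z - \<phi> c)) = q c" by (simp only: to_complex_of_real Re_complex_of_real)
      then show ?thesis by (simp add: to_complex_diff)
    qed
    ultimately have "d \<le> \<eta>" using d_le[OF c(1)] by linarith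
    moreover have "\<eta> < d"
      using \<delta>(1) \<delta>3 dpos by (simp add: \<eta>_def algebra_simps)
    ultimately show False by simp
  qed
  then obtain c where c: "c \<in> C" "q c < e\<^sup>2"
    using near[of "e\<^sup>2"] \<open>e > 0\<close> by auto
  have "norm (z i - c i) \<le> e" if "i \<in> I" for i
  proof -
    have "(norm (z i - c i))\<^sup>2 \<le> q c"
      unfolding q_def by (rule member_le_sum) (use that assms in auto)
    with c(2) have "(norm (z i - c i))\<^sup>2 \<le> e\<^sup>2" by linarith
    then show ?thesis
      by (rule power2_le_imp_le) (use \<open>e > 0\<close> in simp)
  qed
  with c show ?thesis by blast
qed

section \<open>Normed spaces and operators\<close>

locale normed_structure =
  fixes E :: "('k::rc_field, 'a::ab_group_add) nvs"
  assumes normed: "normed_space E"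
begin

sublocale vector_space "vscale E"
  using normed by (simp add: normed_space_def)

lemma subspace_carrier: "subspace (vcarrier E)"
  using normed by (simp add: normed_space_def)

lemma zero_mem [simp]: "0 \<in> vcarrier E"
  and add_mem: "x \<in> vcarrier E \<Longrightarrow> y \<in> vcarrier E \<Longrightarrow> x + y \<in> vcarrier E"
  and scale_mem: "x \<in> vcarrier E \<Longrightarrow> vscale E c x \<in> vcarrier E"
  and neg_mem: "x \<in> vcarrier E \<Longrightarrow> - x \<in> vcarrier E"
  and diff_mem: "x \<in> vcarrier E \<Longrightarrow> y \<in> vcarrier E \<Longrightarrow> x - y \<in> vcarrier E"
  and sum_mem: "(\<And>i. i \<in> A \<Longrightarrow> f i \<in> vcarrier E) \<Longrightarrow> sum f A \<in> vcarrier E"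
  by (simp_all add: subspace_carrier subspace_0 subspace_add subspace_scale subspace_neg subspace_diff
      subspace_sum)

lemma nonneg [simp]: "x \<in> vcarrier E \<Longrightarrow> 0 \<le> vnorm E x"
  and eq_0_iff: "x \<in> vcarrier E \<Longrightarrow> vnorm E x = 0 \<longleftrightarrow> x = 0"
  and triangle: "x \<in> vcarrier E \<Longrightarrow> y \<in> vcarrier E \<Longrightarrow> vnorm E (x + y) \<le> vnorm E x + vnorm E y"
  and norm_scale: "x \<in> vcarrier E \<Longrightarrow> vnorm E (vscale E c x) = norm c * vnorm E x"
  using normed by (simp_all add: normed_space_def)

lemma norm_0 [simp]: "vnorm E 0 = 0"
  by (simp add: eq_0_iff)

lemma norm_minus: "x \<in> vcarrier E \<Longrightarrow> vnorm E (- x) = vnorm E x"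
  using norm_scale[of x "-1"] by (simp add: scale_minus_left)

lemma norm_diff_commute:
  "x \<in> vcarrier E \<Longrightarrow> y \<in> vcarrier E \<Longrightarrow> vnorm E (x - y) = vnorm E (y - x)"
  using norm_minus[of "x - y"] by (simp add: diff_mem)

lemma triangle_diff:
  "x \<in> vcarrier E \<Longrightarrow> y \<in> vcarrier E \<Longrightarrow> vnorm E (x - y) \<le> vnorm E x + vnorm E y"
  using triangle[of x "- y"] by (simp add: norm_minus neg_mem)

lemma triangle_via:
  assumes "x \<in> vcarrier E" "y \<in> vcarrier E" "z \<in> vcarrier E"
  shows "vnorm E (x - z) \<le> vnorm E (x - y) + vnorm E (y - z)"
  using triangle[of "x - y" "y - z"] assms by (simp add: diff_mem)

lemma norm_sum_le:
  "(\<And>i. i \<in> A \<Longrightarrow> f i \<in> vcarrier E) \<Longrightarrow> vnorm E (sum f A) \<le> (\<Sum>i\<in>A. vnorm E (f i))"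
proof (induction A rule: infinite_finite_induct)
  case (insert i A)
  then have "vnorm E (f i + sum f A) \<le> vnorm E (f i) + vnorm E (sum f A)"
    by (intro triangle sum_mem) auto
  with insert show ?case by fastforce
qed auto

lemma zero_unit_ball [simp]: "0 \<in> unit_ball E"
  by (simp add: unit_ball_def)

lemma eq_scale_unit_ball:
  assumes x: "x \<in> vcarrier E"
  shows "\<exists>y\<in>unit_ball E. x = vscale E (of_real (vnorm E x)) y"
proof (cases "x = 0")
  case True
  then show ?thesis by (intro bexI[of _ 0]) auto
next
  case False
  then have pos: "vnorm E x > 0" using x by (metis eq_0_iff nonneg order_le_less)
  define y where "y = vscale E (of_real (1 / vnorm E x)) x"
  have "y \<in> unit_ball E"
    using x pos by (simp add: y_def unit_ball_def scale_mem norm_scale norm_divide)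
  moreover have "x = vscale E (of_real (vnorm E x)) y"
    using pos by (simp add: y_def scale_scale)
  ultimately show ?thesis by blast
qed

lemma limit_unique:
  assumes "converges_to E X x" "converges_to E X y" "\<And>n. X n \<in> vcarrier E"
  shows "x = y"
proof -
  have xy: "x \<in> vcarrier E" "y \<in> vcarrier E"
    using assms by (auto simp: converges_to_def)
  have lim: "(\<lambda>n. vnorm E (X n - x) + vnorm E (X n - y)) \<longlonglongrightarrow> 0 + 0"
    using assms by (intro tendsto_add) (auto simp: converges_to_def)
  have "vnorm E (x - y) \<le> vnorm E (X n - x) + vnorm E (X n - y)" for n
    using triangle_via[OF xy(1) assms(3) xy(2), of n] norm_diff_commute[OF xy(1) assms(3)] by simp
  then have "vnorm E (x - y) \<le> 0"
    using LIMSEQ_le_const[OF lim, of "vnorm E (x - y)"] by auto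
  then have "vnorm E (x - y) = 0" using nonneg[OF diff_mem[OF xy]] by linarith
  then show ?thesis using xy by (simp add: eq_0_iff diff_mem)
qed

lemma limit_norm_le:
  assumes "converges_to E X x" "\<And>n. X n \<in> vcarrier E" "\<And>n. n \<ge> N \<Longrightarrow> vnorm E (X n) \<le> C"
  shows "vnorm E x \<le> C"
proof -
  have x: "x \<in> vcarrier E" using assms by (auto simp: converges_to_def)
  have lim: "(\<lambda>n. vnorm E (X n - x) + C) \<longlonglongrightarrow> 0 + C"
    using assms by (intro tendsto_intros) (auto simp: converges_to_def)
  have "vnorm E x \<le> vnorm E (X n - x) + C" if "n \<ge> N" for n
    using triangle_diff[OF assms(2) diff_mem[OF assms(2) x], of n n] assms(3)[OF that] by simp
  then show ?thesis
    using LIMSEQ_le_const[OF lim, of "vnorm E x"] by auto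
qed

text \<open>\<open>finite_dim\<close> asks for a finite set whose span is exactly \<open>M\<close>,
  whereas \<open>B\<close> may stick out of \<open>M\<close>. A maximal independent subset of
  \<open>M\<close> does it; being independent in the span of \<open>B\<close>, it is finite.\<close>

lemma finite_dimI:
  assumes M: "subspace M" "M \<subseteq> vcarrier E" and B: "finite B" "M \<subseteq> span B"
  shows "finite_dim E M"
proof -
  obtain B' where B': "B' \<subseteq> M" "independent B'" "M \<subseteq> span B'"
    using maximal_independent_subset by blast
  have "finite B'"
    using independent_span_bound[OF B(1) B'(2)] B' B(2) by blast
  moreover have "M = span B'"
    using B' M(1) by (simp add: span_minimal subset_antisym)
  ultimately show ?thesis
    using B'(1) M(2) by (auto simp: finite_dim_def)
qed

lemma finite_dim_subspace: "finite_dim E M \<Longrightarrow> subspace M"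
  by (auto simp: finite_dim_def)

lemma finite_dim_subset_carrier: "finite_dim E M \<Longrightarrow> M \<subseteq> vcarrier E"
  by (auto simp: finite_dim_def intro: subsetD[OF span_minimal[OF _ subspace_carrier]])

lemma normed_space_restrict:
  assumes "finite_dim E M"
  shows "normed_space (E\<lparr>vcarrier := M\<rparr>)"
  using normed finite_dim_subspace[OF assms] finite_dim_subset_carrier[OF assms]
  unfolding normed_space_def by (simp add: subset_iff)

lemma opnorm_le:
  assumes "\<And>x. x \<in> unit_ball E \<Longrightarrow> vnorm F (T x) \<le> C"
  shows "opnorm E F T \<le> C"
  unfolding opnorm_def using assms zero_unit_ball by (intro cSUP_least) blast+

lemma finite_dim_span:
  assumes "finite A" "A \<subseteq> vcarrier E"
  shows "finite_dim E (span A)"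
  using assms by (auto simp: finite_dim_def)

end

lemma bounded_opsI:
  assumes "\<And>x. x \<in> vcarrier E \<Longrightarrow> T x \<in> vcarrier F"
    and "\<And>x y. x \<in> vcarrier E \<Longrightarrow> y \<in> vcarrier E \<Longrightarrow> T (x + y) = T x + T y"
    and "\<And>c x. x \<in> vcarrier E \<Longrightarrow> T (vscale E c x) = vscale F c (T x)"
    and "\<And>x. x \<in> vcarrier E \<Longrightarrow> vnorm F (T x) \<le> C * vnorm E x"
  shows "T \<in> bounded_ops E F"
  unfolding bounded_ops_def using assms by blast

locale bounded_operator = E: normed_structure E + F: normed_structure F
  for E :: "('k::rc_field, 'a::ab_group_add) nvs" and F :: "('k, 'b::ab_group_add) nvs" +
  fixes T :: "'a \<Rightarrow> 'b"
  assumes bounded_op: "T \<in> bounded_ops E F"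
begin

lemma mem: "x \<in> vcarrier E \<Longrightarrow> T x \<in> vcarrier F"
  and add: "x \<in> vcarrier E \<Longrightarrow> y \<in> vcarrier E \<Longrightarrow> T (x + y) = T x + T y"
  and scale: "x \<in> vcarrier E \<Longrightarrow> T (vscale E c x) = vscale F c (T x)"
  using bounded_op by (auto simp: bounded_ops_def)

lemma zero [simp]: "T 0 = 0"
  using add[of 0 0] by simp

lemma neg: "x \<in> vcarrier E \<Longrightarrow> T (- x) = - T x"
  using add[of x "- x"] by (simp add: E.neg_mem add_eq_0_iff)

lemma diff: "x \<in> vcarrier E \<Longrightarrow> y \<in> vcarrier E \<Longrightarrow> T (x - y) = T x - T y"
  using add[of x "- y"] by (simp add: neg E.neg_mem)

lemma sum: "(\<And>i. i \<in> A \<Longrightarrow> f i \<in> vcarrier E) \<Longrightarrow> T (sum f A) = (\<Sum>i\<in>A. T (f i))"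
proof (induction A rule: infinite_finite_induct)
  case (insert i A)
  then show ?case by (simp add: add E.sum_mem)
qed auto

text \<open>\<open>opnorm\<close> is a supremum of reals, so the set of values has to be shown
  bounded before any value can be compared with it; homogeneity then leads from the unit ball to all
  \<open>x\<close>.\<close>

lemma norm_image_le: 
  assumes "x \<in> vcarrier E"
  shows "vnorm F (T x) \<le> opnorm E F T * vnorm E x"
proof -
  obtain C where C: "\<And>x. x \<in> vcarrier E \<Longrightarrow> vnorm F (T x) \<le> C * vnorm E x"
    using bounded_op unfolding bounded_ops_def by blast
  have "vnorm F (T y) \<le> \<bar>C\<bar>" if "y \<in> unit_ball E" for y
  proof -
    have y: "y \<in> vcarrier E" "vnorm E y \<le> 1" using that by (auto simp: unit_ball_def)
    have "C * vnorm E y \<le> \<bar>C\<bar> * 1"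
      using y by (intro mult_mono) auto
    then show ?thesis using C[OF y(1)] by simp
  qed
  then have bdd: "bdd_above ((\<lambda>x. vnorm F (T x)) ` unit_ball E)"
    by (auto intro!: bdd_aboveI)
  obtain y where y: "y \<in> unit_ball E" "x = vscale E (of_real (vnorm E x)) y"
    using E.eq_scale_unit_ball[OF assms] by blast
  have yE: "y \<in> vcarrier E" using y by (simp add: unit_ball_def)
  have "vnorm F (T y) \<le> opnorm E F T"
    unfolding opnorm_def by (rule cSUP_upper[OF y(1) bdd])
  moreover have "vnorm F (T x) = vnorm E x * vnorm F (T y)"
    using assms yE by (subst y(2)) (simp add: scale F.norm_scale mem)
  ultimately show ?thesis
    using assms by (simp add: mult.commute mult_left_mono)
qed

lemma opnorm_nonneg: "0 \<le> opnorm E F T"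
proof -
  obtain C where C: "\<And>x. x \<in> unit_ball E \<Longrightarrow> vnorm F (T x) \<le> C"
  proof
    fix x assume x: "x \<in> unit_ball E"
    then have "vnorm F (T x) \<le> opnorm E F T * vnorm E x"
      by (auto simp: unit_ball_def intro: norm_image_le)
    also have "\<dots> \<le> \<bar>opnorm E F T\<bar> * 1"
      using x by (intro mult_mono) (auto simp: unit_ball_def)
    finally show "vnorm F (T x) \<le> \<bar>opnorm E F T\<bar>" by simp
  qed
  have "vnorm F (T 0) \<le> opnorm E F T"
    unfolding opnorm_def using C by (intro cSUP_upper) (auto intro!: bdd_aboveI)
  then show ?thesis by simp
qed

lemma norm_image_unit_ball_le: "x \<in> unit_ball E \<Longrightarrow> vnorm F (T x) \<le> opnorm E F T"
  using norm_image_le[of x] opnorm_nonneg mult_left_le[of "vnorm E x" "opnorm E F T"]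
  by (auto simp: unit_ball_def)

lemma subspace_image: "F.subspace (T ` vcarrier E)"
proof (rule F.subspaceI)
  show "0 \<in> T ` vcarrier E" by (metis zero E.zero_mem imageI)
qed (auto simp: add[symmetric] scale[symmetric] E.add_mem E.scale_mem)

lemma finite_rankI:
  assumes "finite B" "\<And>x. x \<in> vcarrier E \<Longrightarrow> T x \<in> F.span B"
  shows "T \<in> finite_rank_ops E F"
  using bounded_op F.finite_dimI[OF subspace_image _ assms(1)] assms(2) mem
  by (auto simp: finite_rank_ops_def)

end

section \<open>Algebra of bounded, finite rank and approximable operators\<close>

lemma bounded_operatorI:
  "normed_space E \<Longrightarrow> normed_space F \<Longrightarrow> T \<in> bounded_ops E F \<Longrightarrow> bounded_operator E F T"
  by (simp add: bounded_operator_def normed_structure_def bounded_operator_axioms_def)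

lemma finite_rank_bounded: "T \<in> finite_rank_ops E F \<Longrightarrow> T \<in> bounded_ops E F"
  by (simp add: finite_rank_ops_def)

lemma finite_rankD:
  "T \<in> finite_rank_ops E F \<Longrightarrow>
    \<exists>B. finite B \<and> B \<subseteq> vcarrier F \<and> (\<forall>x\<in>vcarrier E. T x \<in> module.span (vscale F) B)"
  by (auto simp: finite_rank_ops_def finite_dim_def)

lemma bounded_ops_compose:
  assumes "normed_space E" "normed_space F" "normed_space G"
    and T: "T \<in> bounded_ops E F" and S: "S \<in> bounded_ops F G"
  shows "(\<lambda>x. S (T x)) \<in> bounded_ops E G"
proof -
  interpret T: bounded_operator E F T using assms by (intro bounded_operatorI)
  interpret S: bounded_operator F G S using assms by (intro bounded_operatorI)
  show ?thesis
  proof (rule bounded_opsI)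
    fix x assume x: "x \<in> vcarrier E"
    have "vnorm G (S (T x)) \<le> opnorm F G S * vnorm F (T x)"
      using x by (intro S.norm_image_le T.mem)
    also have "\<dots> \<le> opnorm F G S * (opnorm E F T * vnorm E x)"
      using x by (intro mult_left_mono T.norm_image_le S.opnorm_nonneg)
    finally show "vnorm G (S (T x)) \<le> (opnorm F G S * opnorm E F T) * vnorm E x"
      by (simp add: mult.assoc)
  qed (simp_all add: T.mem S.mem T.add S.add T.scale S.scale)
qed

lemma bounded_ops_diff:
  assumes "normed_space E" "normed_space F"
    and T: "T \<in> bounded_ops E F" and S: "S \<in> bounded_ops E F"
  shows "(\<lambda>x. T x - S x) \<in> bounded_ops E F"
proof -
  interpret T: bounded_operator E F T using assms by (intro bounded_operatorI)
  interpret S: bounded_operator E F S using assms by (intro bounded_operatorI)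
  show ?thesis
  proof (rule bounded_opsI)
    fix x assume x: "x \<in> vcarrier E"
    have "vnorm F (T x - S x) \<le> vnorm F (T x) + vnorm F (S x)"
      using x by (intro T.F.triangle_diff T.mem S.mem)
    also have "\<dots> \<le> opnorm E F T * vnorm E x + opnorm E F S * vnorm E x"
      using x by (intro add_mono T.norm_image_le S.norm_image_le)
    finally show "vnorm F (T x - S x) \<le> (opnorm E F T + opnorm E F S) * vnorm E x"
      by (simp add: algebra_simps)
  qed (simp_all add: T.mem S.mem T.add S.add T.scale S.scale T.F.diff_mem T.F.scale_right_diff_distrib)
qed

lemma bounded_ops_zero:
  assumes "normed_space E" "normed_space F"
  shows "(\<lambda>_. 0) \<in> bounded_ops E F"
proof -
  interpret E: normed_structure E by standard fact
  interpret F: normed_structure F by standard fact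
  show ?thesis by (rule bounded_opsI[where C = 0]) auto
qed

lemma bounded_ops_scale:
  assumes "normed_space E" "normed_space F" "T \<in> bounded_ops E F"
  shows "(\<lambda>x. vscale F c (T x)) \<in> bounded_ops E F"
proof -
  interpret T: bounded_operator E F T using assms by (intro bounded_operatorI)
  show ?thesis
  proof (rule bounded_opsI)
    fix x assume x: "x \<in> vcarrier E"
    show "vnorm F (vscale F c (T x)) \<le> (norm c * opnorm E F T) * vnorm E x"
      using T.norm_image_le[OF x] x by (simp add: T.F.norm_scale T.mem mult_left_mono mult.assoc)
  qed (simp_all add: T.mem T.add T.scale T.F.scale_mem T.F.scale_right_distrib mult.commute)
qed

lemma finite_rank_diff:
  assumes "normed_space E" "normed_space F"
    and T: "T \<in> finite_rank_ops E F" and S: "S \<in> finite_rank_ops E F"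
  shows "(\<lambda>x. T x - S x) \<in> finite_rank_ops E F"
proof -
  interpret D: bounded_operator E F "\<lambda>x. T x - S x"
    using assms by (intro bounded_operatorI bounded_ops_diff finite_rank_bounded)
  obtain B where B: "finite B" "B \<subseteq> vcarrier F" "\<And>x. x \<in> vcarrier E \<Longrightarrow> T x \<in> D.F.span B"
    using finite_rankD[OF T] by blast
  obtain B' where B': "finite B'" "B' \<subseteq> vcarrier F" "\<And>x. x \<in> vcarrier E \<Longrightarrow> S x \<in> D.F.span B'"
    using finite_rankD[OF S] by blast
  show ?thesis
  proof (rule D.finite_rankI)
    fix x assume "x \<in> vcarrier E"
    then show "T x - S x \<in> D.F.span (B \<union> B')"
      using B(3) B'(3) D.F.span_mono[of B "B \<union> B'"] D.F.span_mono[of B' "B \<union> B'"]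
      by (intro D.F.span_diff) auto
  qed (use B B' in auto)
qed

lemma finite_rank_compose:
  assumes "normed_space D" "normed_space E" "normed_space F" "normed_space G"
    and R: "R \<in> bounded_ops D E" and T: "T \<in> finite_rank_ops E F" and S: "S \<in> bounded_ops F G"
  shows "(\<lambda>x. S (T (R x))) \<in> finite_rank_ops D G"
proof -
  interpret R: bounded_operator D E R using assms by (intro bounded_operatorI)
  interpret T: bounded_operator E F T using assms by (intro bounded_operatorI finite_rank_bounded)
  interpret S: bounded_operator F G S using assms by (intro bounded_operatorI)
  interpret C: bounded_operator D G "\<lambda>x. S (T (R x))"
    by (rule bounded_operatorI[OF assms(1,4)
          bounded_ops_compose[OF assms(1,3,4) bounded_ops_compose[OF assms(1,2,3) R finite_rank_bounded[OF T]] S]])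
  obtain B where B: "finite B" "B \<subseteq> vcarrier F" "\<And>x. x \<in> vcarrier E \<Longrightarrow> T x \<in> T.F.span B"
    using finite_rankD[OF T] by blast
  show ?thesis
  proof (rule C.finite_rankI)
    fix x assume "x \<in> vcarrier D"
    then have "T (R x) \<in> T.F.span B" by (intro B R.mem)
    then obtain u where u: "T (R x) = (\<Sum>b\<in>B. vscale F (u b) b)"
      using T.F.span_finite[OF B(1)] by auto
    have "S (T (R x)) = (\<Sum>b\<in>B. vscale G (u b) (S b))"
      unfolding u using B(2) by (subst S.sum) (auto intro!: T.F.scale_mem sum.cong S.scale)
    also have "\<dots> \<in> S.F.span (S ` B)"
      by (intro S.F.span_sum S.F.span_scale S.F.span_base) auto
    finally show "S (T (R x)) \<in> S.F.span (S ` B)" .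
  qed (use B in auto)
qed

lemma approximable_bounded: "T \<in> approximable_ops E F \<Longrightarrow> T \<in> bounded_ops E F"
  by (simp add: approximable_ops_def)

lemma approximableI:
  assumes "normed_space E" "T \<in> bounded_ops E F"
    and "\<And>e. e > 0 \<Longrightarrow> \<exists>A\<in>finite_rank_ops E F. \<forall>x\<in>unit_ball E. vnorm F (T x - A x) \<le> e"
  shows "T \<in> approximable_ops E F"
proof -
  interpret E: normed_structure E by standard fact
  have "\<exists>A\<in>finite_rank_ops E F. opnorm E F (\<lambda>x. T x - A x) < e" if e: "e > 0" for e
  proof -
    obtain A where A: "A \<in> finite_rank_ops E F" "\<forall>x\<in>unit_ball E. vnorm F (T x - A x) \<le> e / 2"
      using assms(3)[OF half_gt_zero[OF e]] by blast
    then have "opnorm E F (\<lambda>x. T x - A x) \<le> e / 2" by (intro E.opnorm_le) auto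
    with A \<open>e > 0\<close> show ?thesis by force
  qed
  with assms(2) show ?thesis by (simp add: approximable_ops_def)
qed

text \<open>If \<open>A\<close> of finite rank is close to \<open>R\<close>, then \<open>S\<close>
  after \<open>A\<close> is close to \<open>S\<close> after \<open>R\<close>. \<open>T\<close> is a
  separate function because factorizations are prescribed on the carrier and say nothing
  elsewhere.\<close>

lemma approximable_compose:
  assumes sp: "normed_space D" "normed_space E" "normed_space F"
    and R: "R \<in> approximable_ops D E" and S: "S \<in> bounded_ops E F"
    and T: "T \<in> bounded_ops D F" "\<And>x. x \<in> vcarrier D \<Longrightarrow> T x = S (R x)"
  shows "T \<in> approximable_ops D F"
proof (rule approximableI)
  interpret R: bounded_operator D E R using assms by (intro bounded_operatorI approximable_bounded)
  interpret S: bounded_operator E F S using assms by (intro bounded_operatorI)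
  fix e :: real assume "e > 0"
  define d where "d = e / (opnorm E F S + 1)"
  have d: "d > 0" "opnorm E F S * d \<le> e"
    using \<open>e > 0\<close> S.opnorm_nonneg by (auto simp: d_def field_simps)
  obtain A where A: "A \<in> finite_rank_ops D E" "opnorm D E (\<lambda>x. R x - A x) < d"
    using R d by (auto simp: approximable_ops_def)
  interpret A: bounded_operator D E A using assms A by (intro bounded_operatorI finite_rank_bounded)
  interpret Dif: bounded_operator D E "\<lambda>x. R x - A x"
    using sp R.bounded_op A.bounded_op by (intro bounded_operatorI bounded_ops_diff)
  have "(\<lambda>x. x) \<in> bounded_ops D D"
    by (rule bounded_opsI[where C = 1]) auto
  then have "(\<lambda>x. S (A x)) \<in> finite_rank_ops D F"
    using finite_rank_compose[OF sp(1,1,2,3) _ A(1) S] by simp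
  moreover have "vnorm F (T x - S (A x)) \<le> e" if x: "x \<in> unit_ball D" for x
  proof -
    have xD: "x \<in> vcarrier D" using x by (simp add: unit_ball_def)
    have "vnorm F (T x - S (A x)) = vnorm F (S (R x - A x))"
      using xD by (simp add: T(2) S.diff R.mem A.mem)
    also have "\<dots> \<le> opnorm E F S * vnorm E (R x - A x)"
      using xD by (intro S.norm_image_le Dif.mem)
    also have "\<dots> \<le> opnorm E F S * d"
      using Dif.norm_image_unit_ball_le[OF x] A(2) S.opnorm_nonneg by (intro mult_left_mono) auto
    finally show ?thesis using d by simp
  qed
  ultimately show "\<exists>A\<in>finite_rank_ops D F. \<forall>x\<in>unit_ball D. vnorm F (T x - A x) \<le> e"
    by (intro bexI[of _ "\<lambda>x. S (A x)"]) auto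
qed (use assms in auto)

text \<open>The easy inclusion: \<open>R\<close> is approximable, and \<open>S\<close> after
  \<open>T0\<close> is a bounded operator following it.\<close>

lemma minimal_kernel_via_approximable:
  assumes "normed_space E" "normed_space F" "normed_space X" "normed_space Y"
  shows "minimal_kernel_via E F X Y \<subseteq> approximable_ops E F"
proof
  fix T assume "T \<in> minimal_kernel_via E F X Y"
  then obtain R T0 S where *: "T \<in> bounded_ops E F" "R \<in> approximable_ops E X" "T0 \<in> bounded_ops X Y"
    "S \<in> bounded_ops Y F" "\<And>x. x \<in> vcarrier E \<Longrightarrow> T x = S (T0 (R x))"
    by (auto simp: minimal_kernel_via_def one_compact_ops_def dest: approximable_bounded)
  show "T \<in> approximable_ops E F"
    by (rule approximable_compose[OF assms(1,3,2) *(2) bounded_ops_compose[OF assms(3,4,2) *(3,4)] *(1,5)])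
qed

section \<open>The spaces \<open>\<ell>\<^sub>2\<^sup>n\<close> and \<open>\<ell>\<^sub>\<infinity>\<^sup>n\<close>\<close>

lemma vector_space_pointwise: "vector_space (\<lambda>(c::'k::field) (x::'i \<Rightarrow> 'k) i. c * x i)"
  by unfold_locales (auto simp: fun_eq_iff algebra_simps)

lemma subspace_pointwise:
  "module.subspace (\<lambda>(c::'k::field) (x::'i \<Rightarrow> 'k) i. c * x i) S \<longleftrightarrow>
    0 \<in> S \<and> (\<forall>x\<in>S. \<forall>y\<in>S. x + y \<in> S) \<and> (\<forall>c. \<forall>x\<in>S. (\<lambda>i. c * x i) \<in> S)"
  using vector_space_pointwise by (subst module.subspace_def) (auto simp: module_iff_vector_space)

lemma lp_space_simps [simp]:
  "x \<in> vcarrier (lp_space p n) \<longleftrightarrow> (\<forall>i\<ge>n. x i = 0)"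
  "vscale (lp_space p n) = (\<lambda>c x i. c * x i)"
  "vnorm (lp_space p n) = lp_norm p n"
  by (simp_all add: lp_space_def)

lemma lp_norm_infinity_le_iff: "lp_norm \<infinity> n x \<le> r \<longleftrightarrow> 0 \<le> r \<and> (\<forall>i<n. norm (x i) \<le> r)"
  by (auto simp: lp_norm_def)

lemma norm_le_lp_norm_infinity: "i < n \<Longrightarrow> norm (x i) \<le> lp_norm \<infinity> n x"
  using lp_norm_infinity_le_iff[of n x "lp_norm \<infinity> n x"] by simp

lemma lp_norm_infinity_nonneg: "0 \<le> lp_norm \<infinity> n x"
  using lp_norm_infinity_le_iff[of n x "lp_norm \<infinity> n x"] by simp

lemma lp_norm_infinity_scale: "lp_norm \<infinity> n (\<lambda>i. c * x i) = norm c * lp_norm \<infinity> n x"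
proof (rule antisym)
  show "lp_norm \<infinity> n (\<lambda>i. c * x i) \<le> norm c * lp_norm \<infinity> n x"
    by (simp add: lp_norm_infinity_le_iff norm_mult lp_norm_infinity_nonneg norm_le_lp_norm_infinity
        mult_left_mono)
  show "norm c * lp_norm \<infinity> n x \<le> lp_norm \<infinity> n (\<lambda>i. c * x i)"
  proof (cases "c = 0")
    case False
    then have "norm (x i) \<le> lp_norm \<infinity> n (\<lambda>i. c * x i) / norm c" if "i < n" for i
      using norm_le_lp_norm_infinity[OF that, of "\<lambda>i. c * x i"]
      by (simp add: norm_mult pos_le_divide_eq mult.commute)
    then have "lp_norm \<infinity> n x \<le> lp_norm \<infinity> n (\<lambda>i. c * x i) / norm c"
      by (simp add: lp_norm_infinity_le_iff lp_norm_infinity_nonneg)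
    then show ?thesis using False by (simp add: pos_le_divide_eq mult.commute)
  qed (simp add: lp_norm_infinity_nonneg)
qed

lemma normed_space_lp_infinity: "normed_space (lp_space \<infinity> n :: ('k::rc_field, nat \<Rightarrow> 'k) nvs)"
proof -
  have "lp_norm \<infinity> n x = 0 \<longleftrightarrow> x = 0" if "\<forall>i\<ge>n. x i = 0" for x :: "nat \<Rightarrow> 'k"
  proof
    assume "lp_norm \<infinity> n x = 0"
    then have "x i = 0" if "i < n" for i
      using norm_le_lp_norm_infinity[OF that, of x] by simp
    with that show "x = 0" by (metis ext leI zero_fun_apply)
  next
    assume "x = 0"
    then show "lp_norm \<infinity> n x = 0"
      using lp_norm_infinity_nonneg[of n x] lp_norm_infinity_le_iff[of n x 0] by simp
  qed
  moreover have "lp_norm \<infinity> n (x + y) \<le> lp_norm \<infinity> n x + lp_norm \<infinity> n y" for x y :: "nat \<Rightarrow> 'k"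
    by (auto simp: lp_norm_infinity_le_iff lp_norm_infinity_nonneg
        intro!: norm_triangle_le add_mono norm_le_lp_norm_infinity)
  ultimately show ?thesis
    by (auto simp: normed_space_def vector_space_pointwise subspace_pointwise lp_norm_infinity_nonneg
        lp_norm_infinity_scale)
qed

lemma normed_space_lp_2: "normed_space (lp_space (ereal 2) n :: ('k::rc_field, nat \<Rightarrow> 'k) nvs)"
proof -
  have L: "lp_norm (ereal 2) n x = L2_set (\<lambda>i. norm (x i)) {..<n}" for x :: "nat \<Rightarrow> 'k"
    by (simp add: lp_norm_2 L2_set_def)
  have "L2_set (\<lambda>i. norm (x i)) {..<n} = 0 \<longleftrightarrow> x = 0" if "\<forall>i\<ge>n. x i = 0" for x :: "nat \<Rightarrow> 'k"
    using that by (auto simp: L2_set_eq_0_iff fun_eq_iff) (metis leI lessThan_iff)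
  moreover have "L2_set (\<lambda>i. norm ((x + y) i)) {..<n}
     \<le> L2_set (\<lambda>i. norm (x i)) {..<n} + L2_set (\<lambda>i. norm (y i)) {..<n}" for x y :: "nat \<Rightarrow> 'k"
  proof -
    have "L2_set (\<lambda>i. norm ((x + y) i)) {..<n} \<le> L2_set (\<lambda>i. norm (x i) + norm (y i)) {..<n}"
      by (rule L2_set_mono) (auto simp: norm_triangle_ineq)
    also have "\<dots> \<le> L2_set (\<lambda>i. norm (x i)) {..<n} + L2_set (\<lambda>i. norm (y i)) {..<n}"
      by (rule L2_set_triangle_ineq)
    finally show ?thesis .
  qed
  moreover have "L2_set (\<lambda>i. norm (c * x i)) {..<n} = norm c * L2_set (\<lambda>i. norm (x i)) {..<n}"
    for c and x :: "nat \<Rightarrow> 'k"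
    by (simp add: norm_mult L2_set_left_distrib[symmetric] L2_set_right_distrib)
  ultimately show ?thesis
    by (auto simp: normed_space_def vector_space_pointwise subspace_pointwise L)
qed

definition unit_vector :: "nat \<Rightarrow> nat \<Rightarrow> 'k::zero_neq_one" where
  "unit_vector i = (\<lambda>j. if j = i then 1 else 0)"

lemma sum_pointwise: "(\<Sum>i\<in>A. f i) x = (\<Sum>i\<in>A. f i x :: 'c::comm_monoid_add)"
  by (induction A rule: infinite_finite_induct) auto

lemma unit_vector_expansion:
  fixes y :: "nat \<Rightarrow> 'k::rc_field"
  assumes "finite I" "\<And>i. i \<notin> I \<Longrightarrow> y i = 0"
  shows "y = (\<Sum>i\<in>I. (\<lambda>j. y i * unit_vector i j))"
proof
  fix j
  have "(\<Sum>i\<in>I. y i * unit_vector i j) = (\<Sum>i\<in>I. if i = j then y j else 0)"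
    by (rule sum.cong) (auto simp: unit_vector_def)
  also have "\<dots> = y j" using assms by simp
  finally show "y j = (\<Sum>i\<in>I. (\<lambda>j. y i * unit_vector i j)) j" by (simp add: sum_pointwise)
qed

lemma finite_rank_lp_domain:
  fixes F :: "('k::rc_field, 'b::ab_group_add) nvs" and T :: "(nat \<Rightarrow> 'k) \<Rightarrow> 'b"
  assumes "normed_space F" "T \<in> bounded_ops (lp_space \<infinity> n) F"
  shows "T \<in> finite_rank_ops (lp_space \<infinity> n) F"
proof -
  interpret T: bounded_operator "lp_space \<infinity> n" F T
    using assms normed_space_lp_infinity by (intro bounded_operatorI)
  show ?thesis
  proof (rule T.finite_rankI)
    fix y :: "nat \<Rightarrow> 'k" assume y: "y \<in> vcarrier (lp_space \<infinity> n)"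
    have "T y = T (\<Sum>i<n. vscale (lp_space \<infinity> n) (y i) (unit_vector i))"
      using unit_vector_expansion[of "{..<n}" y] y by simp
    also have "\<dots> = (\<Sum>i<n. vscale F (y i) (T (unit_vector i)))"
      by (subst T.sum) (auto simp: unit_vector_def T.scale[simplified])
    also have "\<dots> \<in> T.F.span ((\<lambda>i. T (unit_vector i)) ` {..<n})"
      by (intro T.F.span_sum T.F.span_scale T.F.span_base) auto
    finally show "T y \<in> T.F.span ((\<lambda>i. T (unit_vector i)) ` {..<n})" .
  qed auto
qed

text \<open>Rescaling makes \<open>v\<close> a contraction; the summand \<open>t\<close> below covers the case \<open>v = 0\<close>.\<close>

lemma banach_mazur_isomorphism:
  assumes sp: "normed_space E" "normed_space F" and "banach_mazur E F \<le> ereal L" "e > 0"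
  obtains u v where "u \<in> bounded_ops E F" "v \<in> bounded_ops F E"
    "\<And>x. x \<in> vcarrier E \<Longrightarrow> v (u x) = x"
    "\<And>x. x \<in> vcarrier E \<Longrightarrow> vnorm F (u x) \<le> (L + e) * vnorm E x"
    "\<And>y. y \<in> vcarrier F \<Longrightarrow> vnorm E (v y) \<le> vnorm F y"
proof -
  have "banach_mazur E F < ereal (L + e / 2)"
    using assms(3,4) by (simp add: le_less_trans)
  then obtain u v where uv: "opnorm E F u * opnorm F E v < L + e / 2"
    "u \<in> bounded_ops E F" "v \<in> bounded_ops F E"
    "\<forall>x\<in>vcarrier E. v (u x) = x"
    unfolding banach_mazur_def by (auto simp: Inf_less_iff)
  interpret u: bounded_operator E F u using sp uv by (intro bounded_operatorI)
  interpret v: bounded_operator F E v using sp uv by (intro bounded_operatorI)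
  \<comment> \<open>One half of \<open>e\<close> was spent on not attaining the infimum;
    \<open>t\<close> is chosen so that enlarging the norm of \<open>v\<close> by it costs at most
    the other half.\<close>
  define t where "t = e / (2 * (opnorm E F u + 1))"
  define a where "a = opnorm F E v + t"
  have t: "t > 0" "opnorm E F u * t \<le> e / 2"
    using u.opnorm_nonneg \<open>e > 0\<close> by (auto simp: t_def field_simps)
  then have a: "a > 0" using v.opnorm_nonneg by (simp add: a_def)
  have ua: "opnorm E F u * a \<le> L + e"
    using t uv(1) by (simp add: a_def algebra_simps)
  define u' where "u' x = vscale F (of_real a) (u x)" for x
  define v' where "v' y = vscale E (of_real (1 / a)) (v y)" for y
  show ?thesis
  proof
    show "u' \<in> bounded_ops E F" "v' \<in> bounded_ops F E"
      unfolding u'_def v'_def using sp uv by (intro bounded_ops_scale; simp)+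
    fix x assume x: "x \<in> vcarrier E"
    show "v' (u' x) = x"
      using x a uv(4) by (simp add: u'_def v'_def v.scale u.mem)
    have "vnorm F (u' x) = a * vnorm F (u x)"
      using x a by (simp add: u'_def u.F.norm_scale u.mem)
    also have "\<dots> \<le> a * (opnorm E F u * vnorm E x)"
      using a x by (intro mult_left_mono u.norm_image_le) auto
    also have "\<dots> = (opnorm E F u * a) * vnorm E x" by simp
    also have "\<dots> \<le> (L + e) * vnorm E x"
      using ua x by (intro mult_right_mono) auto
    finally show "vnorm F (u' x) \<le> (L + e) * vnorm E x" .
  next
    fix y assume y: "y \<in> vcarrier F"
    have "vnorm E (v' y) = vnorm E (v y) / a"
      using y a by (simp add: v'_def u.E.norm_scale v.mem norm_divide)
    also have "\<dots> \<le> opnorm F E v * vnorm F y / a"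
      using a y by (intro divide_right_mono v.norm_image_le) auto
    also have "\<dots> \<le> a * vnorm F y / a"
      using a y t by (intro divide_right_mono mult_right_mono) (auto simp: a_def)
    finally show "vnorm E (v' y) \<le> vnorm F y" using a by simp
  qed
qed

section \<open>Finite hulls in \<open>\<ell>\<^sub>\<infinity>\<^sup>m\<close>\<close>

text \<open>The vectors \<open>f j\<close>, truncated to \<open>\<ell>\<^sub>\<infinity>\<^sup>m\<close>, lie in \<open>{\<Sum>k<p. \<alpha> k * w k | \<bar>\<alpha> k\<bar> \<le> 1}\<close>, and
  the norms of the \<open>w k\<close> sum up to at most \<open>r\<close>.\<close>

definition hull_data ::
    "nat \<Rightarrow> 'j set \<Rightarrow> real \<Rightarrow> ('j \<Rightarrow> nat \<Rightarrow> 'k::rc_field) \<Rightarrow> nat \<Rightarrow> (nat \<Rightarrow> nat \<Rightarrow> 'k) \<Rightarrow> (nat \<Rightarrow> 'j \<Rightarrow> 'k) \<Rightarrow> bool" where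
  "hull_data m J r f p w \<tau> \<longleftrightarrow> (\<forall>k. \<forall>i\<ge>m. w k i = 0) \<and> (\<forall>k. \<forall>j\<in>J. norm (\<tau> k j) \<le> 1) \<and>
     (\<Sum>k<p. lp_norm \<infinity> m (w k)) \<le> r \<and> (\<forall>j\<in>J. \<forall>i<m. f j i = (\<Sum>k<p. \<tau> k j * w k i))"

text \<open>The identity \<open>f = (\<Sum>k. \<tau> k \<otimes> w k)\<close> behind this is a
  tensor representation over the bounded functions on \<open>J\<close> and
  \<open>\<ell>\<^sub>\<infinity>\<^sup>m\<close>, witnessing a projective norm of at most
  \<open>r\<close>.\<close>

definition hull_rep :: "nat \<Rightarrow> 'j set \<Rightarrow> real \<Rightarrow> ('j \<Rightarrow> nat \<Rightarrow> 'k::rc_field) \<Rightarrow> bool" where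
  "hull_rep m J r f \<longleftrightarrow> (\<exists>p w \<tau>. hull_data m J r f p w \<tau>)"

lemma hull_dataD:
  assumes "hull_data m J r f p w \<tau>"
  shows "i \<ge> m \<Longrightarrow> w k i = 0" and "j \<in> J \<Longrightarrow> norm (\<tau> k j) \<le> 1"
    and "(\<Sum>k<p. lp_norm \<infinity> m (w k)) \<le> r"
    and "j \<in> J \<Longrightarrow> i < m \<Longrightarrow> f j i = (\<Sum>k<p. \<tau> k j * w k i)"
  using assms by (simp_all add: hull_data_def)

lemma hull_repI:
  fixes p :: nat and w :: "nat \<Rightarrow> nat \<Rightarrow> 'k::rc_field"
  assumes "\<And>k i. i \<ge> m \<Longrightarrow> w k i = 0" "\<And>k j. j \<in> J \<Longrightarrow> norm (\<tau> k j) \<le> 1"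
    "(\<Sum>k<p. lp_norm \<infinity> m (w k)) \<le> r"
    "\<And>j i. j \<in> J \<Longrightarrow> i < m \<Longrightarrow> f j i = (\<Sum>k<p. \<tau> k j * w k i)"
  shows "hull_rep m J r f"
proof -
  have "hull_data m J r f p w \<tau>"
    using assms by (simp add: hull_data_def)
  then show ?thesis unfolding hull_rep_def by blast
qed

lemma hull_rep_cong:
  assumes "hull_rep m J r f" "\<And>j i. j \<in> J \<Longrightarrow> i < m \<Longrightarrow> g j i = f j i"
  shows "hull_rep m J r g"
proof -
  have "hull_data m J r f = hull_data m J r g"
    using assms(2) by (intro ext) (simp add: hull_data_def)
  with assms(1) show ?thesis by (simp add: hull_rep_def)
qed

lemma hull_rep_mono:
  assumes "hull_rep m J r f" "r \<le> s"
  shows "hull_rep m J s f"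
proof -
  obtain p w \<tau> where "hull_data m J r f p w \<tau>"
    using assms(1) unfolding hull_rep_def by blast
  then have "hull_data m J s f p w \<tau>"
    using assms(2) by (simp add: hull_data_def)
  then show ?thesis unfolding hull_rep_def by blast
qed

lemma hull_rep_reindex:
  assumes "hull_rep m J r f" "\<And>j. j \<in> J' \<Longrightarrow> \<phi> j \<in> J"
  shows "hull_rep m J' r (\<lambda>j. f (\<phi> j))"
proof -
  obtain p w \<tau> where "hull_data m J r f p w \<tau>"
    using assms(1) unfolding hull_rep_def by blast
  note 3 = hull_dataD[OF this]
  show ?thesis
    by (rule hull_repI[of m w J' "\<lambda>k j. \<tau> k (\<phi> j)" p]) (use 3 assms(2) in auto)
qed

lemma sum_lessThan_add: "(\<Sum>k<p + q. f k) = (\<Sum>k<p. f k) + (\<Sum>k<q. f (p + k) :: 'c::comm_monoid_add)"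
  for p q :: nat
  by (induction q) (simp_all add: add.assoc)

lemma hull_rep_add:
  assumes "hull_rep m J r f" "hull_rep m J s g"
  shows "hull_rep m J (r + s) (\<lambda>j i. f j i + g j i)"
proof -
  obtain p w \<tau> where "hull_data m J r f p w \<tau>"
    using assms(1) unfolding hull_rep_def by blast
  note 1 = hull_dataD[OF this]
  obtain p' w' \<tau>' where "hull_data m J s g p' w' \<tau>'"
    using assms(2) unfolding hull_rep_def by blast
  note 2 = hull_dataD[OF this]
  define W where "W k = (if k < p then w k else w' (k - p))" for k
  define S where "S k = (if k < p then \<tau> k else \<tau>' (k - p))" for k
  show ?thesis
    by (rule hull_repI[of m W J S "p + p'"])
      (use 1 2 in \<open>auto simp: W_def S_def sum_lessThan_add intro: add_mono\<close>)
qed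

lemma hull_rep_scale:
  assumes "hull_rep m J r f"
  shows "hull_rep m J (norm c * r) (\<lambda>j i. c * f j i)"
proof -
  obtain p w \<tau> where "hull_data m J r f p w \<tau>"
    using assms(1) unfolding hull_rep_def by blast
  note 1 = hull_dataD[OF this]
  show ?thesis
    by (rule hull_repI[of m "\<lambda>k i. c * w k i" J \<tau> p])
      (use 1 in \<open>auto simp: lp_norm_infinity_scale sum_distrib_left[symmetric] mult_left_mono
        mult.left_commute\<close>)
qed

lemma hull_rep_tensor:
  assumes "\<And>j. j \<in> J \<Longrightarrow> norm (s j) \<le> 1" "\<And>i. i < m \<Longrightarrow> norm (t i) \<le> r" "r \<ge> 0"
  shows "hull_rep m J r (\<lambda>j i. s j * t i)"
  by (rule hull_repI[of m "\<lambda>_ i. if i < m then t i else 0" J "\<lambda>_. s" "Suc 0"])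
    (use assms in \<open>auto simp: lp_norm_infinity_le_iff\<close>)

lemma hull_rep_bound:
  assumes "hull_rep m J r f" "j \<in> J" "i < m"
  shows "norm (f j i) \<le> r"
proof -
  obtain p w \<tau> where "hull_data m J r f p w \<tau>"
    using assms(1) unfolding hull_rep_def by blast
  note 1 = hull_dataD[OF this]
  have "norm (f j i) \<le> (\<Sum>k<p. lp_norm \<infinity> m (w k))"
    unfolding 1(4)[OF assms(2,3)]
  proof (rule sum_norm_le)
    fix k
    have "norm (\<tau> k j) * norm (w k i) \<le> 1 * lp_norm \<infinity> m (w k)"
      using 1(2)[OF assms(2)] norm_le_lp_norm_infinity[OF assms(3)] by (intro mult_mono) auto
    then show "norm (\<tau> k j * w k i) \<le> lp_norm \<infinity> m (w k)" by (simp add: norm_mult)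
  qed
  with 1(3) show ?thesis by linarith
qed

text \<open>Take the \<open>m\<close> multiples of unit vectors by \<open>e\<close> as the
  \<open>w k\<close> and the rescaled coordinates of \<open>f\<close> as coefficients. The cost does
  not depend on \<open>J\<close>, which will be an infinite unit ball; this absorbs the errors of
  the bipolar theorem and of the net.\<close>

lemma hull_rep_small:
  fixes f :: "'j \<Rightarrow> nat \<Rightarrow> 'k::rc_field"
  assumes "\<And>j i. j \<in> J \<Longrightarrow> i < m \<Longrightarrow> norm (f j i) \<le> e" "e > 0"
  shows "hull_rep m J (real m * e) f"
proof (rule hull_repI[of m "\<lambda>k i. if i = k \<and> k < m then of_real e else 0" J
      "\<lambda>k j. if k < m then f j k / of_real e else 0" m])
  show "norm (if k < m then f j k / of_real e else 0) \<le> 1" if "j \<in> J" for k j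
    using assms that by (auto simp: norm_divide)
  have "(\<Sum>k<m. lp_norm \<infinity> m (\<lambda>i. if i = k \<and> k < m then of_real e else 0 :: 'k)) \<le> (\<Sum>k<m. e)"
    by (intro sum_mono) (use assms in \<open>auto simp: lp_norm_infinity_le_iff\<close>)
  then show "(\<Sum>k<m. lp_norm \<infinity> m (\<lambda>i. if i = k \<and> k < m then of_real e else 0 :: 'k)) \<le> real m * e"
    by simp
  show "f j i = (\<Sum>k<m. (if k < m then f j k / of_real e else 0) * (if i = k \<and> k < m then of_real e else 0))"
    if "j \<in> J" "i < m" for j i
  proof -
    have "(\<Sum>k<m. (if k < m then f j k / of_real e else 0) * (if i = k \<and> k < m then of_real e else 0))
      = (\<Sum>k<m. if i = k then f j k else 0)"
      by (rule sum.cong) (use assms in auto)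
    also have "\<dots> = f j i" using that by simp
    finally show ?thesis by simp
  qed
qed auto

text \<open>\<open>C\<close> is the set of matrices of cost at most 1. Grothendieck's inequality
  puts the matrix of inner products, divided by \<open>K\<close>, into the bipolar of
  \<open>C\<close>; the approximation error returns through \<open>hull_rep_small\<close>, and
  \<open>\<epsilon>\<close> is chosen to make that cost at most \<open>e\<close>. A positive
  majorant \<open>K\<close> of the constant allows the division.\<close>

lemma inner_l2_hull_rep:
  fixes x h :: "nat \<Rightarrow> nat \<Rightarrow> 'k::rc_field"
  assumes x: "\<forall>j<n. lp_norm 2 d (x j) \<le> 1" and h: "\<forall>i<m. lp_norm 2 d (h i) \<le> 1"
    and K: "grothendieck_constant TYPE('k) \<le> K" "K > 0" and "e > 0"
  shows "hull_rep m {..<n} (K + e) (\<lambda>j i. inner_l2 d (x j) (h i))"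
proof -
  define C :: "(nat \<times> nat \<Rightarrow> 'k) set" where "C = {z. hull_rep m {..<n} 1 (\<lambda>j i. z (j, i))}"
  define z where "z = (\<lambda>(j, i). of_real (1 / K) * inner_l2 d (x j) (h i))"
  define \<epsilon> where "\<epsilon> = e / (K * (real m + 1))"
  have \<epsilon>: "\<epsilon> > 0" "real m * (K * \<epsilon>) \<le> e"
  proof -
    have pos: "K * (real m + 1) > 0" using K by simp
    then show "\<epsilon> > 0" using \<open>e > 0\<close> unfolding \<epsilon>_def by (rule divide_pos_pos[rotated])
    have "K * (real m + 1) * \<epsilon> = e" using K unfolding \<epsilon>_def by simp
    moreover have "K * (real m + 1) * \<epsilon> = real m * (K * \<epsilon>) + K * \<epsilon>" by (simp add: algebra_simps)
    moreover have "K * \<epsilon> > 0" using K \<open>\<epsilon> > 0\<close> by simp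
    ultimately show "real m * (K * \<epsilon>) \<le> e" by linarith
  qed
  have "\<exists>c\<in>C. \<forall>p\<in>{..<n} \<times> {..<m}. norm (z p - c p) \<le> \<epsilon>"
  proof (rule bipolar_approximation[where B = 1])
    have "(\<lambda>_. 0) \<in> C"
      using hull_rep_tensor[of "{..<n}" "\<lambda>_. 0 :: 'k" m "\<lambda>_. 0" 1] by (simp add: C_def)
    then show "C \<noteq> {}" by blast
  next
    fix y y' and t :: real assume y: "y \<in> C" "y' \<in> C" and t: "0 \<le> t" "t \<le> 1"
    have "hull_rep m {..<n} (norm (of_real (1 - t) :: 'k) * 1) (\<lambda>j i. of_real (1 - t) * y (j, i))"
      "hull_rep m {..<n} (norm (of_real t :: 'k) * 1) (\<lambda>j i. of_real t * y' (j, i))"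
      using y by (intro hull_rep_scale; simp add: C_def)+
    from hull_rep_add[OF this] show "(\<lambda>p. of_real (1 - t) * y p + of_real t * y' p) \<in> C"
      using t by (simp add: C_def del: of_real_diff)
  next
    fix y and \<theta> :: 'k assume y: "y \<in> C" "norm \<theta> = 1"
    then have "hull_rep m {..<n} 1 (\<lambda>j i. y (j, i))" by (simp add: C_def)
    from hull_rep_scale[OF this, of \<theta>] y show "(\<lambda>p. \<theta> * y p) \<in> C" by (simp add: C_def)
  next
    fix y p assume "y \<in> C" "p \<in> {..<n} \<times> {..<m}"
    then show "norm (y p) \<le> 1"
      using hull_rep_bound[of m "{..<n}" 1 "\<lambda>j i. y (j, i)" "fst p" "snd p"] by (auto simp: C_def)
  next
    \<comment> \<open>An \<open>a\<close> in the polar of \<open>C\<close> is tested on the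
      elementary tensors in \<open>C\<close>; this is precisely the premise of Grothendieck's
      inequality.\<close>
    fix a :: "nat \<times> nat \<Rightarrow> 'k"
    assume a: "norm (\<Sum>p\<in>{..<n} \<times> {..<m}. a p * y p) \<le> 1" if "y \<in> C" for y
    have "norm (\<Sum>j<n. \<Sum>i<m. a (j, i) * inner_l2 d (x j) (h i)) \<le> grothendieck_constant TYPE('k)"
    proof (rule grothendieck_inequality[OF _ x h])
      fix s t :: "nat \<Rightarrow> 'k" assume st: "\<forall>i<n. norm (s i) \<le> 1" "\<forall>j<m. norm (t j) \<le> 1"
      then have "(\<lambda>(j, i). s j * t i) \<in> C"
        using hull_rep_tensor[of "{..<n}" s m t 1] by (simp add: C_def)
      from a[OF this] show "norm (\<Sum>i<n. \<Sum>j<m. a (i, j) * s i * t j) \<le> 1"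
        by (simp add: sum.cartesian_product case_prod_unfold mult.assoc)
    qed
    then have "norm (\<Sum>j<n. \<Sum>i<m. a (j, i) * inner_l2 d (x j) (h i)) \<le> K"
      using K by simp
    moreover have "(\<Sum>p\<in>{..<n} \<times> {..<m}. a p * z p)
        = of_real (1 / K) * (\<Sum>j<n. \<Sum>i<m. a (j, i) * inner_l2 d (x j) (h i))"
      by (simp add: z_def sum.cartesian_product sum_distrib_left case_prod_unfold)
    ultimately show "norm (\<Sum>p\<in>{..<n} \<times> {..<m}. a p * z p) \<le> 1"
      using K by (simp add: norm_mult norm_divide)
  qed (use \<epsilon> in auto)
  then obtain c where c: "hull_rep m {..<n} 1 (\<lambda>j i. c (j, i))"
    "\<And>j i. j < n \<Longrightarrow> i < m \<Longrightarrow> norm (z (j, i) - c (j, i)) \<le> \<epsilon>"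
    by (auto simp: C_def)
  have "hull_rep m {..<n} (real m * (K * \<epsilon>)) (\<lambda>j i. of_real K * (z (j, i) - c (j, i)))"
  proof (rule hull_rep_small)
    fix j i assume "j \<in> {..<n}" "i < m"
    then show "norm (of_real K * (z (j, i) - c (j, i))) \<le> K * \<epsilon>"
      using c(2)[of j i] K by (simp add: norm_mult)
  qed (use K \<epsilon> in simp)
  from hull_rep_add[OF hull_rep_scale[OF c(1), of "of_real K"] this]
  have "hull_rep m {..<n} (K + real m * (K * \<epsilon>)) (\<lambda>j i. of_real K * z (j, i))"
    using K(2) by (simp add: algebra_simps)
  then have "hull_rep m {..<n} (K + e) (\<lambda>j i. of_real K * z (j, i))"
    by (rule hull_rep_mono) (use \<epsilon> in simp)
  then show ?thesis
    by (rule hull_rep_cong) (use K in \<open>simp add: z_def\<close>)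
qed

text \<open>A disc of radius \<open>r\<close> is covered by finitely many balls of radius
  \<open>e / 2\<close>. Each \<open>x\<close> is coded by the centres chosen for its
  \<open>m\<close> coordinates; finitely many codes occur, and one point of \<open>S\<close> is kept
  for each.\<close>

lemma finite_net:
  fixes f :: "'j \<Rightarrow> nat \<Rightarrow> 'k::rc_field"
  assumes "\<And>x i. x \<in> S \<Longrightarrow> i < m \<Longrightarrow> norm (f x i) \<le> r" and "e > 0"
  shows "\<exists>N\<subseteq>S. finite N \<and> (\<forall>x\<in>S. \<exists>y\<in>N. \<forall>i<m. norm (f x i - f y i) \<le> e)"
proof -
  obtain P where P: "finite P" "cball 0 r \<subseteq> (\<Union>p\<in>P. ball (p::complex) (e / 2))"
    using compactE_image[OF compact_cball[of "0::complex" r], of "cball 0 r" "\<lambda>p. ball p (e / 2)"] \<open>e > 0\<close>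
    by (metis UN_upper centre_in_ball half_gt_zero open_ball subsetI UN_I)
  define code where "code x = restrict (\<lambda>i. SOME p. p \<in> P \<and> dist p (to_complex (f x i)) < e / 2) {..<m}" for x
  have code: "code x i \<in> P \<and> dist (code x i) (to_complex (f x i)) < e / 2" if "x \<in> S" "i < m" for x i
  proof -
    have "to_complex (f x i) \<in> cball 0 r"
      using assms(1)[OF that] by (simp add: norm_to_complex)
    then have "\<exists>p. p \<in> P \<and> dist p (to_complex (f x i)) < e / 2" using P(2) by force
    from someI_ex[OF this] show ?thesis using that by (simp add: code_def)
  qed
  have "code ` S \<subseteq> (\<Pi>\<^sub>E i\<in>{..<m}. P)" using code by (auto simp: code_def PiE_def extensional_def)
  then have "finite (code ` S)"
    by (rule finite_subset) (simp add: finite_PiE P(1))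
  then obtain N where N: "N \<subseteq> S" "finite N" "code ` S = code ` N"
    using finite_subset_image[of "code ` S" code S] by auto
  have "\<exists>y\<in>N. \<forall>i<m. norm (f x i - f y i) \<le> e" if x: "x \<in> S" for x
  proof -
    obtain y where y: "y \<in> N" "code x = code y" using N(3) x by blast
    have "norm (f x i - f y i) \<le> e" if i: "i < m" for i
    proof -
      have "y \<in> S" using y(1) N(1) by blast
      then have "dist (code x i) (to_complex (f y i)) < e / 2"
        using code[of y i] y(2) i by simp
      then have "dist (to_complex (f x i)) (to_complex (f y i)) < e"
        using code[OF x i] dist_triangle3[of "to_complex (f x i)" "to_complex (f y i)" "code x i"] by linarith
      moreover have "dist (to_complex (f x i)) (to_complex (f y i)) = norm (f x i - f y i)"
        by (simp only: dist_norm to_complex_diff[symmetric] norm_to_complex)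
      ultimately show ?thesis by simp
    qed
    with y show ?thesis by blast
  qed
  with N show ?thesis by blast
qed

text \<open>The Riesz representation in coordinates: evaluating \<open>B\<close> at the conjugate of
  its own coefficient vector gives \<open>s \<le> C * sqrt s\<close>, where \<open>s\<close> is the
  squared norm.\<close>

lemma hilbert_functional_norm:
  fixes B :: "(nat \<Rightarrow> 'k::rc_field) \<Rightarrow> 'k"
  assumes B: "\<And>z. (\<forall>k\<ge>d. z k = 0) \<Longrightarrow> B z = (\<Sum>k<d. z k * g k)"
    and C: "0 \<le> C" and le: "\<And>z. (\<forall>k\<ge>d. z k = 0) \<Longrightarrow> norm (B z) \<le> C * lp_norm 2 d z"
  shows "lp_norm 2 d (\<lambda>k. rc_conj (g k)) \<le> C"
proof -
  define z where "z k = (if k < d then rc_conj (g k) else 0)" for k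
  define s where "s = (\<Sum>k<d. (norm (g k))\<^sup>2)"
  have s0: "s \<ge> 0" by (simp add: s_def sum_nonneg)
  have "B z = of_real s"
    by (subst B) (auto simp: z_def s_def mult_rc_conj_self mult.commute intro!: sum.cong)
  moreover have "lp_norm 2 d z = sqrt s" by (simp add: lp_norm_2 z_def s_def)
  ultimately have "s \<le> C * sqrt s" using le[of z] s0 by (simp add: z_def)
  show ?thesis
  proof (cases "s = 0")
    case True
    with C show ?thesis by (simp add: lp_norm_2 s_def)
  next
    case False
    with s0 have "sqrt s > 0" by simp
    moreover have "sqrt s * sqrt s \<le> C * sqrt s"
      using \<open>s \<le> C * sqrt s\<close> s0 real_sqrt_mult_self[of s] by simp
    ultimately have "sqrt s \<le> C" by (simp only: mult_le_cancel_right_pos)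
    then show ?thesis by (simp add: lp_norm_2 s_def)
  qed
qed

section \<open>Finite rank operators\<close>

lemma bounded_ops_extend_codomain:
  assumes "T \<in> bounded_ops E (F\<lparr>vcarrier := N\<rparr>)" "N \<subseteq> vcarrier F"
  shows "T \<in> bounded_ops E F"
  using assms unfolding bounded_ops_def by (auto simp: subset_iff)

text \<open>The net is fine for the coordinates of \<open>A\<close>, not for the norm of
  \<open>E\<close>, whose unit ball need not be totally bounded. It is finite, so the hypothesis on
  \<open>E\<close> applies to its span, and neither its size nor the dimension \<open>d\<close>
  enters the bound.\<close>

lemma hilbert_hull_rep:
  fixes E :: "('k::rc_field, 'a::ab_group_add) nvs"
  assumes "normed_space E" and Lp: "script_Lp_space 2 lam E" and lam: "1 \<le> lam" "lam < L"
    and A: "A \<in> bounded_ops E (lp_space \<infinity> m)" and C: "opnorm E (lp_space \<infinity> m) A \<le> C" "C > 0"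
    and K: "grothendieck_constant TYPE('k) \<le> K" "K > 0" and "e > 0"
  shows "hull_rep m (unit_ball E) (K * L * C + e) A"
proof -
  interpret A: bounded_operator E "lp_space \<infinity> m" A
    using assms normed_space_lp_infinity by (intro bounded_operatorI)
  have A_norm: "norm (A x i) \<le> C * vnorm E x" if "x \<in> vcarrier E" "i < m" for x i
  proof -
    have "norm (A x i) \<le> lp_norm \<infinity> m (A x)" by (rule norm_le_lp_norm_infinity) fact
    also have "\<dots> \<le> opnorm E (lp_space \<infinity> m) A * vnorm E x"
      using A.norm_image_le[OF that(1)] by simp
    also have "\<dots> \<le> C * vnorm E x" using C that by (intro mult_right_mono) auto
    finally show ?thesis .
  qed
  have A_unit: "norm (A x i) \<le> C" if "x \<in> unit_ball E" "i < m" for x i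
  proof -
    have "norm (A x i) \<le> C * vnorm E x" using that by (intro A_norm) (auto simp: unit_ball_def)
    also have "\<dots> \<le> C * 1" using that C by (intro mult_left_mono) (auto simp: unit_ball_def)
    finally show ?thesis by simp
  qed
  \<comment> \<open>The budget \<open>e\<close> is split: \<open>e / 2\<close> for the net and
    \<open>e / 4\<close> for \<open>inner_l2_hull_rep\<close>.\<close>
  define \<epsilon> where "\<epsilon> = e / (2 * (real m + 1))"
  have \<epsilon>: "\<epsilon> > 0" "real m * \<epsilon> \<le> e / 2"
    using \<open>e > 0\<close> by (simp_all add: \<epsilon>_def field_simps)
  obtain N0 where N0: "N0 \<subseteq> unit_ball E" "finite N0"
    "\<forall>x\<in>unit_ball E. \<exists>y\<in>N0. \<forall>i<m. norm (A x i - A y i) \<le> \<epsilon>"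
    using finite_net[of "unit_ball E" m A C \<epsilon>] A_unit \<epsilon>(1) by blast
  have "finite_dim E (A.E.span N0)"
    using N0 by (intro A.E.finite_dim_span) (auto simp: unit_ball_def)
  then obtain N where N: "finite_dim E N" "A.E.span N0 \<subseteq> N"
    "banach_mazur (E\<lparr>vcarrier := N\<rparr>) (lp_space 2 (vector_space.dim (vscale E) N)) \<le> ereal lam"
    using Lp unfolding script_Lp_space_def by blast
  define d where "d = A.E.dim N"
  have NE: "N \<subseteq> vcarrier E" by (rule A.E.finite_dim_subset_carrier) fact
  have spN: "normed_space (E\<lparr>vcarrier := N\<rparr>)" by (rule A.E.normed_space_restrict) fact
  have sp2: "normed_space (lp_space 2 d :: ('k, nat \<Rightarrow> 'k) nvs)"
    using normed_space_lp_2[of d] by simp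
  obtain u v where u: "u \<in> bounded_ops (E\<lparr>vcarrier := N\<rparr>) (lp_space 2 d)"
    and v: "v \<in> bounded_ops (lp_space 2 d) (E\<lparr>vcarrier := N\<rparr>)"
    and vu: "\<And>x. x \<in> N \<Longrightarrow> v (u x) = x"
    and u_le: "\<And>x. x \<in> N \<Longrightarrow> lp_norm 2 d (u x) \<le> L * vnorm E x"
    and v_le: "\<And>y. y \<in> vcarrier (lp_space 2 d) \<Longrightarrow> vnorm E (v y) \<le> lp_norm 2 d y"
    using banach_mazur_isomorphism[OF spN sp2 N(3)[folded d_def], of "L - lam"] lam by auto
  have v': "v \<in> bounded_ops (lp_space 2 d) E"
    using v NE by (rule bounded_ops_extend_codomain)
  interpret v: bounded_operator "lp_space 2 d" E v
    using sp2 v' assms(1) by (intro bounded_operatorI)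
  interpret B: bounded_operator "lp_space 2 d" "lp_space \<infinity> m" "\<lambda>z. A (v z)"
    by (rule bounded_operatorI[OF sp2 normed_space_lp_infinity
          bounded_ops_compose[OF sp2 assms(1) normed_space_lp_infinity v' A]])
  \<comment> \<open>The coordinates of \<open>A\<close> after \<open>v\<close> are functionals on
    \<open>\<ell>\<^sub>2\<^sup>d\<close> with these coefficients; conjugated, they become the
    vectors \<open>h i\<close> with which inner products are taken.\<close>
  define g where "g i k = A (v (unit_vector k)) i" for i k
  have B_eq: "A (v z) i = (\<Sum>k<d. z k * g i k)" if z: "\<forall>k\<ge>d. z k = 0" for z i
  proof -
    have "A (v z) = A (v (\<Sum>k<d. vscale (lp_space 2 d) (z k) (unit_vector k)))"
      using unit_vector_expansion[of "{..<d}" z] z by simp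
    also have "\<dots> = (\<Sum>k<d. A (v (vscale (lp_space 2 d) (z k) (unit_vector k))))"
      by (rule B.sum) (auto simp: unit_vector_def)
    also have "\<dots> = (\<Sum>k<d. (\<lambda>i. z k * A (v (unit_vector k)) i))"
      by (rule sum.cong[OF refl], subst B.scale) (auto simp: unit_vector_def)
    finally show ?thesis by (simp add: sum_pointwise g_def)
  qed
  define h where "h i k = rc_conj (g i k)" for i k
  have h: "lp_norm 2 d (h i) \<le> C" if i: "i < m" for i
    unfolding h_def
  proof (rule hilbert_functional_norm[of d "\<lambda>z. A (v z) i"])
    fix z :: "nat \<Rightarrow> 'k" assume z: "\<forall>k\<ge>d. z k = 0"
    show "A (v z) i = (\<Sum>k<d. z k * g i k)" by (rule B_eq) fact
    have "norm (A (v z) i) \<le> C * vnorm E (v z)"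
      using z i by (intro A_norm v.mem) auto
    also have "\<dots> \<le> C * lp_norm 2 d z" using C v_le[of z] z by (intro mult_left_mono) auto
    finally show "norm (A (v z) i) \<le> C * lp_norm 2 d z" .
  qed (use C in simp)
  obtain n and xs :: "nat \<Rightarrow> 'a" where xs: "N0 = xs ` {..<n}"
    using finite_imp_nat_seg_image_inj_on[OF N0(2)] by (auto simp: lessThan_def)
  have xsN: "xs j \<in> N" "xs j \<in> unit_ball E" if "j < n" for j
    using that N(2) A.E.span_superset[of N0] N0(1) by (auto simp: xs)
  \<comment> \<open>On the net \<open>u\<close> has norm at most \<open>L\<close>, and each
    \<open>h i\<close> has norm at most \<open>C\<close>. Dividing by these gives unit vectors;
    \<open>hull_rep_scale\<close> restores the factor \<open>L * C\<close>.\<close>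
  define y' where "y' j k = of_real (1 / L) * u (xs j) k" for j k
  define h' where "h' i k = of_real (1 / C) * h i k" for i k
  have lp_scale: "lp_norm 2 d (\<lambda>k. of_real r * z k :: 'k) = \<bar>r\<bar> * lp_norm 2 d z" for r z
    unfolding lp_norm_2 norm_mult norm_of_real
    by (simp add: power_mult_distrib sum_distrib_left[symmetric] real_sqrt_mult)
  have L: "L > 0" using lam by simp
  have "lp_norm 2 d (y' j) \<le> 1" if "j < n" for j
  proof -
    have "lp_norm 2 d (u (xs j)) \<le> L * vnorm E (xs j)" using that by (intro u_le xsN)
    also have "\<dots> \<le> L * 1" using xsN(2)[OF that] L by (intro mult_left_mono) (auto simp: unit_ball_def)
    finally show ?thesis using L unfolding y'_def lp_scale by (simp add: field_simps)
  qed
  moreover have "lp_norm 2 d (h' i) \<le> 1" if "i < m" for i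
    using h[OF that] C unfolding h'_def lp_scale by (simp add: field_simps)
  moreover have "e / (4 * (L * C)) > 0" using L C \<open>e > 0\<close> by simp
  ultimately have "hull_rep m {..<n} (K + e / (4 * (L * C))) (\<lambda>j i. inner_l2 d (y' j) (h' i))"
    using K by (intro inner_l2_hull_rep) auto
  from hull_rep_scale[OF this, of "of_real (L * C)"]
  have "hull_rep m {..<n} ((L * C) * (K + e / (4 * (L * C)))) (\<lambda>j i. of_real (L * C) * inner_l2 d (y' j) (h' i))"
    using L C by (simp add: norm_mult)
  moreover have "(L * C) * (K + e / (4 * (L * C))) = K * L * C + e / 4"
    using L C by (simp add: distrib_left)
  moreover have "A (xs j) i = of_real (L * C) * inner_l2 d (y' j) (h' i)" if "j < n" "i < m" for j i
  proof -
    have uy: "\<forall>k\<ge>d. u (xs j) k = 0"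
      using u xsN(1)[OF that(1)] unfolding bounded_ops_def by auto
    have "of_real (L * C) * (y' j k * rc_conj (h' i k)) = u (xs j) k * g i k" for k
      using L C by (simp add: y'_def h'_def h_def rc_conj_mult rc_conj_of_real del: of_real_divide)
        (simp add: field_simps)
    then have "of_real (L * C) * inner_l2 d (y' j) (h' i) = (\<Sum>k<d. u (xs j) k * g i k)"
      unfolding inner_l2_def sum_distrib_left by simp
    also have "\<dots> = A (v (u (xs j))) i" using B_eq[OF uy] by simp
    finally show ?thesis using vu xsN(1)[OF that(1)] by simp
  qed
  ultimately have "hull_rep m {..<n} (K * L * C + e / 4) (\<lambda>j. A (xs j))"
    by (auto intro: hull_rep_cong)
  \<comment> \<open>The coefficients of \<open>x\<close> will be those of the net point with index
    \<open>\<phi> x\<close>, an arbitrary choice without any linearity.\<close>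
  moreover have "\<forall>x\<in>unit_ball E. \<exists>j<n. \<forall>i<m. norm (A x i - A (xs j) i) \<le> \<epsilon>"
    using N0(3) unfolding xs by auto
  then obtain \<phi> where \<phi>: "\<And>x. x \<in> unit_ball E \<Longrightarrow> \<phi> x < n \<and> (\<forall>i<m. norm (A x i - A (xs (\<phi> x)) i) \<le> \<epsilon>)"
    by metis
  ultimately have 1: "hull_rep m (unit_ball E) (K * L * C + e / 4) (\<lambda>x. A (xs (\<phi> x)))"
    using hull_rep_reindex[of m "{..<n}" _ "\<lambda>j. A (xs j)" "unit_ball E" \<phi>] by auto
  have 2: "hull_rep m (unit_ball E) (real m * \<epsilon>) (\<lambda>x i. A x i - A (xs (\<phi> x)) i)"
    by (rule hull_rep_small) (use \<phi> \<epsilon> in auto)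
  from hull_rep_add[OF 1 2] have "hull_rep m (unit_ball E) (K * L * C + e / 4 + real m * \<epsilon>) A"
    by simp
  then show ?thesis by (rule hull_rep_mono) (use \<epsilon> \<open>e > 0\<close> in simp)
qed

lemma finite_rank_factorization:
  fixes E :: "('k::rc_field, 'a::ab_group_add) nvs" and F :: "('k, 'b::ab_group_add) nvs"
  assumes sp: "normed_space E" "normed_space F" and lam: "1 \<le> lam" "1 \<le> lam'"
    and LE: "script_Lp_space 2 lam' E" and LF: "script_Lp_space \<infinity> lam F"
    and T: "T \<in> finite_rank_ops E F" and "e > 0"
  shows "\<exists>m A v. A \<in> bounded_ops E (lp_space \<infinity> m) \<and> v \<in> bounded_ops (lp_space \<infinity> m) F \<and>
    (\<forall>y\<in>vcarrier (lp_space \<infinity> m). vnorm F (v y) \<le> lp_norm \<infinity> m y) \<and>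
    (\<forall>x\<in>vcarrier E. T x = v (A x)) \<and>
    hull_rep m (unit_ball E) (grothendieck_constant TYPE('k) * lam * lam' * opnorm E F T + e) A"
proof -
  interpret T: bounded_operator E F T
    using sp T by (intro bounded_operatorI finite_rank_bounded)
  define k t where "k = grothendieck_constant TYPE('k)" and "t = opnorm E F T"
  have kt: "k \<ge> 0" "t \<ge> 0" by (simp_all add: k_def t_def grothendieck_constant_nonneg T.opnorm_nonneg)
  \<comment> \<open>All four factors are enlarged by the same \<open>\<delta>\<close>: the
    Banach-Mazur distances need not be attained, and \<open>hilbert_hull_rep\<close> wants strictly
    positive constants. Continuity at 0 keeps the product within \<open>e\<close>.\<close>
  have "((\<lambda>\<delta>. (k + \<delta>) * (lam' + \<delta>) * ((lam + \<delta>) * (t + \<delta>)) + \<delta>) \<longlongrightarrow>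
      (k + 0) * (lam' + 0) * ((lam + 0) * (t + 0)) + 0) (at_right 0)"
    by (intro tendsto_intros)
  then have "\<forall>\<^sub>F \<delta> in at_right 0. (k + \<delta>) * (lam' + \<delta>) * ((lam + \<delta>) * (t + \<delta>)) + \<delta>
      < (k + 0) * (lam' + 0) * ((lam + 0) * (t + 0)) + 0 + e"
    by (rule order_tendstoD) (use \<open>e > 0\<close> in simp)
  moreover have "\<forall>\<^sub>F \<delta> in at_right 0. (0::real) < \<delta>"
    by (simp add: eventually_at_right_less)
  ultimately have "\<forall>\<^sub>F \<delta> in at_right 0. 0 < \<delta> \<and> (k + \<delta>) * (lam' + \<delta>) * ((lam + \<delta>) * (t + \<delta>)) + \<delta>
      < k * lam * lam' * t + e"
    by eventually_elim (simp add: mult_ac)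
  then obtain \<delta> where \<delta>: "\<delta> > 0"
    "(k + \<delta>) * (lam' + \<delta>) * ((lam + \<delta>) * (t + \<delta>)) + \<delta> < k * lam * lam' * t + e"
    by (auto dest!: eventually_happens)
  have "finite_dim F (T ` vcarrier E)" using T by (simp add: finite_rank_ops_def)
  then obtain N where N: "finite_dim F N" "T ` vcarrier E \<subseteq> N"
    "banach_mazur (F\<lparr>vcarrier := N\<rparr>) (lp_space \<infinity> (vector_space.dim (vscale F) N)) \<le> ereal lam"
    using LF unfolding script_Lp_space_def by blast
  define m where "m = T.F.dim N"
  have NF: "N \<subseteq> vcarrier F" by (rule T.F.finite_dim_subset_carrier) fact
  have spN: "normed_space (F\<lparr>vcarrier := N\<rparr>)" by (rule T.F.normed_space_restrict) fact
  have spm: "normed_space (lp_space \<infinity> m :: ('k, nat \<Rightarrow> 'k) nvs)" by (rule normed_space_lp_infinity)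
  obtain u v where u: "u \<in> bounded_ops (F\<lparr>vcarrier := N\<rparr>) (lp_space \<infinity> m)"
    and v: "v \<in> bounded_ops (lp_space \<infinity> m) (F\<lparr>vcarrier := N\<rparr>)"
    and vu: "\<And>x. x \<in> N \<Longrightarrow> v (u x) = x"
    and u_le: "\<And>x. x \<in> N \<Longrightarrow> lp_norm \<infinity> m (u x) \<le> (lam + \<delta>) * vnorm F x"
    and v_le: "\<And>y. y \<in> vcarrier (lp_space \<infinity> m) \<Longrightarrow> vnorm F (v y) \<le> lp_norm \<infinity> m y"
    using banach_mazur_isomorphism[OF spN spm N(3)[folded m_def] \<delta>(1)] by auto
  define A where "A x = u (T x)" for x
  have T': "T \<in> bounded_ops E (F\<lparr>vcarrier := N\<rparr>)"
    using T.bounded_op N(2) unfolding bounded_ops_def by auto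
  have A: "A \<in> bounded_ops E (lp_space \<infinity> m)"
    unfolding A_def by (rule bounded_ops_compose[OF sp(1) spN spm T' u])
  have "opnorm E (lp_space \<infinity> m) A \<le> (lam + \<delta>) * t"
  proof (rule T.E.opnorm_le)
    fix x assume x: "x \<in> unit_ball E"
    then have "T x \<in> N" using N(2) by (auto simp: unit_ball_def)
    then have "lp_norm \<infinity> m (A x) \<le> (lam + \<delta>) * vnorm F (T x)" unfolding A_def by (rule u_le)
    also have "\<dots> \<le> (lam + \<delta>) * t"
      unfolding t_def using lam \<delta> x by (intro mult_left_mono T.norm_image_unit_ball_le) auto
    finally show "vnorm (lp_space \<infinity> m) (A x) \<le> (lam + \<delta>) * t" by simp
  qed
  also have "\<dots> \<le> (lam + \<delta>) * (t + \<delta>)"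
    using lam \<delta> by (intro mult_left_mono) auto
  finally have "hull_rep m (unit_ball E) ((k + \<delta>) * (lam' + \<delta>) * ((lam + \<delta>) * (t + \<delta>)) + \<delta>) A"
    using lam \<delta>(1) kt by (intro hilbert_hull_rep[OF sp(1) LE lam(2) _ A]) (auto simp: k_def)
  then have "hull_rep m (unit_ball E) (k * lam * lam' * t + e) A"
    by (rule hull_rep_mono) (use \<delta> in simp)
  moreover have "v \<in> bounded_ops (lp_space \<infinity> m) F"
    using v NF by (rule bounded_ops_extend_codomain)
  moreover have "T x = v (A x)" if "x \<in> vcarrier E" for x
    using that vu[of "T x"] N(2) by (auto simp: A_def)
  ultimately show ?thesis
    using A v_le unfolding k_def t_def by blast
qed

section \<open>Series of finite blocks\<close>

lemma prod_encode_cases: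
  obtains n k where "j = prod_encode (n, k)"
  by (metis prod_decode_inverse surj_pair)

lemma sum_prod_encode_Sigma:
  "(\<Sum>j\<in>prod_encode ` (SIGMA n:{..<M}. {..<p n}). h j) = (\<Sum>n<M. \<Sum>k<p n. h (prod_encode (n, k)))"
  by (subst sum.reindex) (auto simp: inj_prod_encode sum.Sigma case_prod_unfold)

text \<open>The pairing satisfies \<open>n \<le> prod_encode (n, k)\<close>, so an index below
  \<open>N\<close> belongs to a block below \<open>N\<close>. Blocks are padded by zeros from
  position \<open>p n\<close> on.\<close>

lemma zero_outside_prod_encode_Sigma:
  assumes zero: "\<And>n k. p n \<le> k \<Longrightarrow> h (prod_encode (n, k)) = 0"
    and j: "j \<in> {..<N} - {..<N} \<inter> prod_encode ` (SIGMA n:{..<M}. {..<p n})" and "N \<le> M"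
  shows "h j = 0"
proof -
  obtain n k where nk: "j = prod_encode (n, k)" by (rule prod_encode_cases)
  have "n < M" using le_prod_encode_1[of n k] \<open>N \<le> M\<close> j nk by auto
  then have "p n \<le> k" using j nk by (auto simp: not_less[symmetric])
  with zero nk show ?thesis by simp
qed

lemma summable_blocks:
  fixes f :: "nat \<Rightarrow> real"
  assumes nonneg: "\<And>j. 0 \<le> f j" and zero: "\<And>n k. p n \<le> k \<Longrightarrow> f (prod_encode (n, k)) = 0"
    and le: "\<And>n. (\<Sum>k<p n. f (prod_encode (n, k))) \<le> c n" and "summable c"
  shows "summable f" and "suminf f \<le> suminf c"
proof -
  have c0: "0 \<le> c n" for n
    using le[of n] sum_nonneg[of "{..<p n}" "\<lambda>k. f (prod_encode (n, k))"] nonneg by fastforce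
  have bound: "(\<Sum>j<N. f j) \<le> suminf c" for N
  proof -
    define I where "I = prod_encode ` (SIGMA n:{..<N}. {..<p n})"
    have "finite I" by (auto simp: I_def)
    have "(\<Sum>j<N. f j) = sum f ({..<N} \<inter> I)"
    proof (rule sum.mono_neutral_right)
      show "\<forall>j\<in>{..<N} - {..<N} \<inter> I. f j = 0"
        using zero_outside_prod_encode_Sigma[of p f _ N N] zero unfolding I_def by blast
    qed auto
    also have "\<dots> \<le> sum f I"
      using \<open>finite I\<close> nonneg by (intro sum_mono2) auto
    also have "\<dots> \<le> (\<Sum>n<N. c n)"
      unfolding I_def sum_prod_encode_Sigma by (intro sum_mono le)
    also have "\<dots> \<le> suminf c" using \<open>summable c\<close> c0 by (intro sum_le_suminf) auto
    finally show ?thesis .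
  qed
  show "summable f" by (rule summableI_nonneg_bounded[OF nonneg bound])
  then show "suminf f \<le> suminf c" using bound by (intro suminf_le_const) 
qed

text \<open>The blocks before \<open>n0\<close> contain finitely many nonzero entries, and all later
  entries are below \<open>e\<close>.\<close>

lemma tendsto_zero_blocks:
  fixes a :: "nat \<Rightarrow> 'c::real_normed_vector"
  assumes zero: "\<And>n k. p n \<le> k \<Longrightarrow> a (prod_encode (n, k)) = 0"
    and le: "\<And>n k. norm (a (prod_encode (n, k))) \<le> b n" and b: "b \<longlonglongrightarrow> 0"
  shows "a \<longlonglongrightarrow> 0"
proof (rule LIMSEQ_I)
  fix e :: real assume "e > 0"
  then obtain n0 where n0: "\<And>n. n \<ge> n0 \<Longrightarrow> norm (b n) < e"
    using LIMSEQ_D[OF b] by auto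
  have "finite (prod_encode ` (SIGMA n:{..<n0}. {..<p n}))" by auto
  then obtain J where J: "\<And>j. j \<in> prod_encode ` (SIGMA n:{..<n0}. {..<p n}) \<Longrightarrow> j < J"
    by (metis finite_nat_set_iff_bounded)
  have "norm (a j - 0) < e" if "j \<ge> J" for j
  proof -
    obtain n k where j: "j = prod_encode (n, k)" by (rule prod_encode_cases)
    have "j \<notin> prod_encode ` (SIGMA n:{..<n0}. {..<p n})" using J that by force
    then have "n \<ge> n0 \<or> k \<ge> p n" using j by (auto simp: not_less[symmetric])
    then show ?thesis
      using n0[of n] le[of n k] zero[of n k] \<open>e > 0\<close> by (auto simp: j)
  qed
  then show "\<exists>J. \<forall>j\<ge>J. norm (a j - 0) < e" by blast
qed

context normed_structure
begin

text \<open>The pairing order cuts through the blocks, while the given limit is along whole blocks.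
  The first \<open>N\<close> terms differ from the first \<open>M \<ge> N\<close> blocks by at most
  the tail \<open>t N\<close> of the norms; letting \<open>M\<close> tend to infinity compares them
  with the limit.\<close>

lemma converges_to_blocks:
  assumes g: "\<And>j. g j \<in> vcarrier E" and sm: "summable (\<lambda>j. vnorm E (g j))"
    and zero: "\<And>n k. p n \<le> k \<Longrightarrow> g (prod_encode (n, k)) = 0"
    and conv: "converges_to E (\<lambda>N. \<Sum>n<N. \<Sum>k<p n. g (prod_encode (n, k))) x"
  shows "converges_to E (\<lambda>N. \<Sum>j<N. g j) x"
proof -
  have x: "x \<in> vcarrier E" using conv by (simp add: converges_to_def)
  define I where "I M = prod_encode ` (SIGMA n:{..<M}. {..<p n})" for M
  define t where "t N = (\<Sum>j. vnorm E (g j)) - (\<Sum>j<N. vnorm E (g j))" for N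
  have le_t: "vnorm E (sum g (I M) - (\<Sum>j<N. g j)) \<le> t N" if "N \<le> M" for M N
  proof -
    have finI: "finite (I M)" by (auto simp: I_def)
    have "(\<Sum>j<N. g j) = sum g ({..<N} \<inter> I M)"
    proof (rule sum.mono_neutral_right)
      show "\<forall>j\<in>{..<N} - {..<N} \<inter> I M. g j = 0"
        using zero_outside_prod_encode_Sigma[of p g _ N M] zero that unfolding I_def by blast
    qed auto
    moreover have "sum g (I M) = sum g (I M - {..<N}) + sum g ({..<N} \<inter> I M)"
      using finI by (subst sum.Int_Diff[of _ _ "{..<N}"]) (auto simp: Int_commute add.commute)
    ultimately have "vnorm E (sum g (I M) - (\<Sum>j<N. g j)) = vnorm E (sum g (I M - {..<N}))"
      by simp
    also have "\<dots> \<le> (\<Sum>j\<in>I M - {..<N}. vnorm E (g j))" by (rule norm_sum_le) (rule g)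
    also have "\<dots> = (\<Sum>j\<in>(I M - {..<N}) \<union> {..<N}. vnorm E (g j)) - (\<Sum>j<N. vnorm E (g j))"
      using finI by (subst sum.union_disjoint) auto
    also have "\<dots> \<le> t N"
      unfolding t_def using finI g by (intro diff_right_mono sum_le_suminf sm) auto
    finally show ?thesis .
  qed
  have upper: "\<forall>N. vnorm E ((\<Sum>j<N. g j) - x) \<le> t N"
  proof
    fix N
    have mem: "sum g (I M) - (\<Sum>j<N. g j) \<in> vcarrier E" for M
      using g by (intro diff_mem sum_mem)
    have gx: "(\<Sum>j<N. g j) \<in> vcarrier E" using g by (intro sum_mem)
    have "converges_to E (\<lambda>M. sum g (I M) - (\<Sum>j<N. g j)) (x - (\<Sum>j<N. g j))"
      using conv unfolding converges_to_def I_def sum_prod_encode_Sigma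
      by (simp add: diff_mem x gx)
    from limit_norm_le[OF this mem le_t] have "vnorm E (x - (\<Sum>j<N. g j)) \<le> t N" .
    then show "vnorm E ((\<Sum>j<N. g j) - x) \<le> t N" using norm_diff_commute[OF x gx] by simp
  qed
  have t0: "t \<longlonglongrightarrow> 0"
  proof -
    have "t \<longlonglongrightarrow> (\<Sum>j. vnorm E (g j)) - (\<Sum>j. vnorm E (g j))"
      unfolding t_def by (intro tendsto_intros summable_LIMSEQ sm)
    then show ?thesis by simp
  qed
  have lower: "\<forall>N. 0 \<le> vnorm E ((\<Sum>j<N. g j) - x)"
    using g x by (intro allI nonneg diff_mem sum_mem)
  have "(\<lambda>N. vnorm E ((\<Sum>j<N. g j) - x)) \<longlonglongrightarrow> 0"
    by (rule tendsto_sandwich[OF always_eventually[OF lower] always_eventually[OF upper] tendsto_const t0])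
  with x show ?thesis by (simp add: converges_to_def)
qed

text \<open>The weights \<open>2 ^ n\<close> are absorbed by the coefficients of the \<open>n\<close>-th block, which makes them null.\<close>

definition block_seq :: "(nat \<Rightarrow> nat) \<Rightarrow> (nat \<Rightarrow> nat \<Rightarrow> 'a) \<Rightarrow> nat \<Rightarrow> 'a" where
  "block_seq p b j = (case prod_decode j of (n, k) \<Rightarrow>
     if k < p n then vscale E (of_real (2 ^ n)) (b n k) else 0)"

lemma block_seq_mem:
  assumes "\<And>n k. b n k \<in> vcarrier E"
  shows "block_seq p b j \<in> vcarrier E"
  using assms by (auto simp: block_seq_def scale_mem split: prod.split)

lemma summable_block_seq:
  assumes b: "\<And>n k. b n k \<in> vcarrier E"
    and c: "\<And>n. (\<Sum>k<p n. vnorm E (b n k)) \<le> c n" "summable (\<lambda>n. 2 ^ n * c n)"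
  shows "summable (\<lambda>j. vnorm E (block_seq p b j))"
    and "(\<Sum>j. vnorm E (block_seq p b j)) \<le> (\<Sum>n. 2 ^ n * c n)"
proof -
  have *: "(\<Sum>k<p n. vnorm E (block_seq p b (prod_encode (n, k)))) \<le> 2 ^ n * c n" for n
  proof -
    have "(\<Sum>k<p n. vnorm E (block_seq p b (prod_encode (n, k)))) = (\<Sum>k<p n. 2 ^ n * vnorm E (b n k))"
      using b by (intro sum.cong) (auto simp: block_seq_def norm_scale norm_power)
    then show ?thesis using c(1)[of n] by (simp add: sum_distrib_left[symmetric])
  qed
  show "summable (\<lambda>j. vnorm E (block_seq p b j))"
    by (rule summable_blocks(1)[of _ p, OF _ _ * c(2)]) (auto simp: block_seq_mem b, auto simp: block_seq_def)
  show "(\<Sum>j. vnorm E (block_seq p b j)) \<le> (\<Sum>n. 2 ^ n * c n)"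
    by (rule summable_blocks(2)[of _ p, OF _ _ * c(2)]) (auto simp: block_seq_mem b, auto simp: block_seq_def)
qed

lemma c0_hull_block_seq:
  assumes b: "\<And>n k. b n k \<in> vcarrier E"
    and c: "\<And>n. (\<Sum>k<p n. vnorm E (b n k)) \<le> c n" "summable (\<lambda>n. 2 ^ n * c n)"
    and \<tau>: "\<And>n k. norm (\<tau> n k) \<le> 1"
    and conv: "converges_to E (\<lambda>N. \<Sum>n<N. \<Sum>k<p n. vscale E (\<tau> n k) (b n k)) x"
  shows "x \<in> c0_hull E (block_seq p b)"
proof -
  define a :: "nat \<Rightarrow> 'k" where
    "a j = (case prod_decode j of (n, k) \<Rightarrow> if k < p n then of_real ((1 / 2) ^ n) * \<tau> n k else 0)" for j
  have norm_a: "norm (a (prod_encode (n, k))) \<le> (1 / 2) ^ n" for n k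
    using \<tau>[of n k] by (auto simp: a_def norm_mult norm_power norm_divide intro: mult_left_le)
  have "a \<longlonglongrightarrow> 0"
  proof (rule tendsto_zero_blocks[where p = p and b = "\<lambda>n. (1 / 2) ^ n"])
    show "norm (a (prod_encode (n, k))) \<le> (1 / 2) ^ n" for n k by (rule norm_a)
  qed (auto simp: a_def LIMSEQ_power_zero)
  have a1: "norm (a j) \<le> 1" for j
  proof -
    obtain n k where j: "j = prod_encode (n, k)" by (rule prod_encode_cases)
    have "norm (a j) \<le> (1 / 2) ^ n" unfolding j by (rule norm_a)
    also have "\<dots> \<le> 1" by (rule power_le_one) auto
    finally show ?thesis .
  qed
  define g where "g j = vscale E (a j) (block_seq p b j)" for j
  have gm: "g j \<in> vcarrier E" for j by (simp add: g_def scale_mem block_seq_mem b)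
  have g_eq: "g (prod_encode (n, k)) = (if k < p n then vscale E (\<tau> n k) (b n k) else 0)" for n k
  proof -
    have "of_real ((1 / 2) ^ n) * \<tau> n k * of_real (2 ^ n) = \<tau> n k * of_real ((1 / 2) ^ n * 2 ^ n)"
      by (simp only: of_real_mult mult_ac)
    also have "(1 / 2) ^ n * (2::real) ^ n = 1" by (simp flip: power_mult_distrib)
    finally show ?thesis by (simp add: g_def a_def block_seq_def del: of_real_power)
  qed
  have "summable (\<lambda>j. vnorm E (g j))"
  proof (rule summable_comparison_test'[OF summable_block_seq(1)[of b p c, OF b c], of 0])
    fix j
    have "vnorm E (g j) = norm (a j) * vnorm E (block_seq p b j)"
      by (simp add: g_def norm_scale block_seq_mem b)
    also have "\<dots> \<le> 1 * vnorm E (block_seq p b j)"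
      by (intro mult_right_mono a1 nonneg block_seq_mem b)
    finally show "norm (vnorm E (g j)) \<le> vnorm E (block_seq p b j)" using gm by simp
  qed
  then have "converges_to E (\<lambda>N. \<Sum>j<N. g j) x"
    using converges_to_blocks[of g p x] gm conv by (simp add: g_eq)
  then show ?thesis
    unfolding c0_hull_def g_def using \<open>a \<longlonglongrightarrow> 0\<close> a1 by blast
qed

end

lemma kappa1_le:
  assumes "normed_space F" "x \<in> compact_witnesses E F T"
  shows "kappa1 E F T \<le> (\<Sum>n. vnorm F (x n))"
  unfolding kappa1_def
proof (rule cINF_lower[OF bdd_belowI2 assms(2)])
  interpret F: normed_structure F by standard fact
  fix x assume "x \<in> compact_witnesses E F T"
  then show "0 \<le> (\<Sum>n. vnorm F (x n))"
    by (intro suminf_nonneg F.nonneg) (auto simp: compact_witnesses_def)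
qed

section \<open>Approximable operators as block series\<close>

text \<open>Telescoping finite rank approximations with error below \<open>\<eta> / 16 ^ n\<close>.
  The initial term has nearly the norm of \<open>T\<close>, which is what keeps the final constant
  sharp; a later one is at most \<open>\<eta> / 16 ^ n + \<eta> / 16 ^ Suc n\<close>.\<close>

lemma approximable_series:
  assumes sp: "normed_space E" "normed_space F" and T: "T \<in> approximable_ops E F" and "\<eta> > 0"
  shows "\<exists>S. (\<forall>n. S n \<in> finite_rank_ops E F) \<and> opnorm E F (S 0) \<le> opnorm E F T + \<eta> \<and>
    (\<forall>n. opnorm E F (S (Suc n)) \<le> 2 * \<eta> / 16 ^ n) \<and>
    (\<forall>x\<in>vcarrier E. converges_to F (\<lambda>N. \<Sum>n<N. S n x) (T x))"
proof -
  interpret T: bounded_operator E F T using sp T by (intro bounded_operatorI approximable_bounded)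
  have "\<exists>B\<in>finite_rank_ops E F. opnorm E F (\<lambda>x. T x - B x) < \<eta> / 16 ^ n" for n
    using T \<open>\<eta> > 0\<close> by (simp add: approximable_ops_def)
  then obtain B where B: "\<And>n. B n \<in> finite_rank_ops E F"
    "\<And>n. opnorm E F (\<lambda>x. T x - B n x) < \<eta> / 16 ^ n"
    by metis
  have bo: "bounded_operator E F (B n)" "bounded_operator E F (\<lambda>x. T x - B n x)" for n
    using bounded_operatorI[OF sp finite_rank_bounded[OF B(1)]]
      bounded_operatorI[OF sp bounded_ops_diff[OF sp T.bounded_op finite_rank_bounded[OF B(1)]]] by auto
  have B_mem: "B n x \<in> vcarrier F" if "x \<in> vcarrier E" for n x
    by (rule bounded_operator.mem[OF bo(1) that])
  have diff_le: "vnorm F (T x - B n x) \<le> \<eta> / 16 ^ n * vnorm E x" if x: "x \<in> vcarrier E" for n x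
  proof -
    have "vnorm F (T x - B n x) \<le> opnorm E F (\<lambda>x. T x - B n x) * vnorm E x"
      by (rule bounded_operator.norm_image_le[OF bo(2) x])
    also have "\<dots> \<le> \<eta> / 16 ^ n * vnorm E x"
      using B(2)[of n] x by (intro mult_right_mono) auto
    finally show ?thesis .
  qed
  have diff_ball: "vnorm F (T x - B n x) \<le> \<eta> / 16 ^ n" if x: "x \<in> unit_ball E" for n x
    using bounded_operator.norm_image_unit_ball_le[OF bo(2) x, of n] B(2)[of n] by linarith
  define S where "S n = (case n of 0 \<Rightarrow> B 0 | Suc k \<Rightarrow> (\<lambda>x. B (Suc k) x - B k x))" for n
  have S_sum: "(\<Sum>n<Suc N. S n x) = B N x" for N x
    by (induction N) (auto simp: S_def)
  have "S n \<in> finite_rank_ops E F" for n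
    using finite_rank_diff[OF sp B(1) B(1)] B(1) by (auto simp: S_def split: nat.split)
  moreover have "opnorm E F (S 0) \<le> opnorm E F T + \<eta>"
  proof (rule T.E.opnorm_le)
    fix x assume x: "x \<in> unit_ball E"
    then have xE: "x \<in> vcarrier E" by (simp add: unit_ball_def)
    have "vnorm F (B 0 x) \<le> vnorm F (T x) + vnorm F (T x - B 0 x)"
      using T.F.triangle_diff[of "T x" "T x - B 0 x"] by (simp add: T.mem xE B_mem T.F.diff_mem)
    then show "vnorm F (S 0 x) \<le> opnorm E F T + \<eta>"
      using diff_ball[OF x, of 0] T.norm_image_unit_ball_le[OF x] by (simp add: S_def)
  qed
  moreover have "opnorm E F (S (Suc n)) \<le> 2 * \<eta> / 16 ^ n" for n
  proof (rule T.E.opnorm_le)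
    fix x assume x: "x \<in> unit_ball E"
    then have xE: "x \<in> vcarrier E" by (simp add: unit_ball_def)
    have "vnorm F (S (Suc n) x) \<le> vnorm F (T x - B n x) + vnorm F (T x - B (Suc n) x)"
      using T.F.triangle_diff[of "T x - B n x" "T x - B (Suc n) x"]
      by (simp add: S_def T.mem xE B_mem T.F.diff_mem)
    also have "\<dots> \<le> \<eta> / 16 ^ n + \<eta> / 16 ^ Suc n" by (intro add_mono diff_ball x)
    also have "\<dots> \<le> 2 * \<eta> / 16 ^ n" using \<open>\<eta> > 0\<close> by (simp add: field_simps)
    finally show "vnorm F (S (Suc n) x) \<le> 2 * \<eta> / 16 ^ n" .
  qed
  moreover have "converges_to F (\<lambda>N. \<Sum>n<N. S n x) (T x)" if x: "x \<in> vcarrier E" for x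
  proof -
    have "(\<lambda>n. vnorm F (B n x - T x)) \<longlonglongrightarrow> 0"
    proof (rule tendsto_sandwich[of "\<lambda>_. 0" _ _ "\<lambda>n. \<eta> * vnorm E x * (1 / 16) ^ n"])
      show "\<forall>\<^sub>F n in sequentially. vnorm F (B n x - T x) \<le> \<eta> * vnorm E x * (1 / 16) ^ n"
        using diff_le[OF x] T.F.norm_diff_commute[OF T.mem[OF x] B_mem[OF x]]
        by (simp add: power_one_over field_simps)
      have "(\<lambda>n. \<eta> * vnorm E x * (1 / 16) ^ n) \<longlonglongrightarrow> \<eta> * vnorm E x * 0"
        by (intro tendsto_intros LIMSEQ_power_zero) simp
      then show "(\<lambda>n. \<eta> * vnorm E x * (1 / 16) ^ n) \<longlonglongrightarrow> 0" by simp
    qed (use x in \<open>auto simp: T.F.diff_mem T.mem B_mem\<close>)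
    then have "(\<lambda>N. vnorm F ((\<Sum>n<Suc N. S n x) - T x)) \<longlonglongrightarrow> 0" by (simp only: S_sum)
    then have "(\<lambda>N. vnorm F ((\<Sum>n<N. S n x) - T x)) \<longlonglongrightarrow> 0" by (rule LIMSEQ_imp_Suc)
    then show ?thesis using T.mem[OF x] by (simp add: converges_to_def)
  qed
  ultimately show ?thesis by (intro exI[of _ S]) blast
qed

text \<open>The data common to both conclusions: \<open>T\<close> as a series of operators through
  \<open>\<ell>\<^sub>\<infinity>\<^sup>m\<close>, with a hull of cost \<open>c n\<close> for each
  block. \<open>A_eq\<close> covers all \<open>i\<close>, since both sides vanish from
  \<open>m n\<close> on. Estimate and factorization are derived under decay conditions on
  \<open>c\<close>.\<close>

locale block_series =
  fixes E :: "('k::rc_field, 'a::ab_group_add) nvs" and F :: "('k, 'b::ab_group_add) nvs"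
    and T :: "'a \<Rightarrow> 'b" and m p :: "nat \<Rightarrow> nat" and A :: "nat \<Rightarrow> 'a \<Rightarrow> nat \<Rightarrow> 'k"
    and v :: "nat \<Rightarrow> (nat \<Rightarrow> 'k) \<Rightarrow> 'b" and w :: "nat \<Rightarrow> nat \<Rightarrow> nat \<Rightarrow> 'k"
    and \<tau> :: "nat \<Rightarrow> nat \<Rightarrow> 'a \<Rightarrow> 'k" and c :: "nat \<Rightarrow> real"
  assumes normed_E: "normed_space E" and normed_F: "normed_space F" and T: "T \<in> bounded_ops E F"
    and A: "A n \<in> bounded_ops E (lp_space \<infinity> (m n))"
    and v: "v n \<in> bounded_ops (lp_space \<infinity> (m n)) F"
    and v_le: "y \<in> vcarrier (lp_space \<infinity> (m n)) \<Longrightarrow> vnorm F (v n y) \<le> lp_norm \<infinity> (m n) y"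
    and series: "x \<in> vcarrier E \<Longrightarrow> converges_to F (\<lambda>N. \<Sum>n<N. v n (A n x)) (T x)"
    and w_zero: "i \<ge> m n \<Longrightarrow> w n k i = 0"
    and \<tau>_le: "x \<in> unit_ball E \<Longrightarrow> norm (\<tau> n k x) \<le> 1"
    and cost: "(\<Sum>k<p n. lp_norm \<infinity> (m n) (w n k)) \<le> c n"
    and A_eq: "x \<in> unit_ball E \<Longrightarrow> A n x i = (\<Sum>k<p n. \<tau> n k x * w n k i)"
begin

sublocale E: normed_structure E by standard (rule normed_E)
sublocale F: normed_structure F by standard (rule normed_F)
sublocale T: bounded_operator E F T by (intro bounded_operatorI normed_E normed_F T)

lemma bounded_v: "bounded_operator (lp_space \<infinity> (m n)) F (v n)"
  by (intro bounded_operatorI normed_space_lp_infinity normed_F v)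

lemma w_mem: "w n k \<in> vcarrier (lp_space \<infinity> (m n))"
  using w_zero by simp

lemma v_w_mem: "v n (w n k) \<in> vcarrier F"
  by (rule bounded_operator.mem[OF bounded_v w_mem])

lemma v_cost: "(\<Sum>k<p n. vnorm F (v n (w n k))) \<le> c n"
proof -
  have "(\<Sum>k<p n. vnorm F (v n (w n k))) \<le> (\<Sum>k<p n. lp_norm \<infinity> (m n) (w n k))"
    by (intro sum_mono v_le w_mem)
  with cost[of n] show ?thesis by linarith
qed

lemma v_A_eq:
  assumes "x \<in> unit_ball E"
  shows "v n (A n x) = (\<Sum>k<p n. vscale F (\<tau> n k x) (v n (w n k)))"
proof -
  interpret v: bounded_operator "lp_space \<infinity> (m n)" F "v n" by (rule bounded_v)
  have "A n x = (\<Sum>k<p n. vscale (lp_space \<infinity> (m n)) (\<tau> n k x) (w n k))"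
    by (rule ext) (simp add: A_eq[OF assms] sum_pointwise)
  then have "v n (A n x) = v n (\<Sum>k<p n. vscale (lp_space \<infinity> (m n)) (\<tau> n k x) (w n k))"
    by (rule arg_cong)
  also have "\<dots> = (\<Sum>k<p n. v n (vscale (lp_space \<infinity> (m n)) (\<tau> n k x) (w n k)))"
    by (rule v.sum) (rule v.E.scale_mem[OF w_mem])
  finally show ?thesis by (simp only: v.scale[OF w_mem])
qed

text \<open>Pushing the \<open>w n k\<close> forward by the contraction \<open>v n\<close> does not
  raise the cost. The factor \<open>2 ^ n\<close> pays for null coefficients and equals 1 in block
  0, where the main term sits.\<close>

lemma compact_witness:
  assumes "summable (\<lambda>n. 2 ^ n * c n)"
  shows "F.block_seq p (\<lambda>n k. v n (w n k)) \<in> compact_witnesses E F T"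
    and "kappa1 E F T \<le> (\<Sum>n. 2 ^ n * c n)"
proof -
  have "T x \<in> c0_hull F (F.block_seq p (\<lambda>n k. v n (w n k)))" if x: "x \<in> unit_ball E" for x
  proof (rule F.c0_hull_block_seq[OF v_w_mem v_cost assms])
    show "norm (\<tau> n k x) \<le> 1" for n k by (rule \<tau>_le[OF x])
    show "converges_to F (\<lambda>N. \<Sum>n<N. \<Sum>k<p n. vscale F (\<tau> n k x) (v n (w n k))) (T x)"
      using series[of x] x by (simp add: v_A_eq[OF x] unit_ball_def)
  qed
  then show *: "F.block_seq p (\<lambda>n k. v n (w n k)) \<in> compact_witnesses E F T"
    using F.summable_block_seq(1)[OF v_w_mem v_cost assms]
    by (auto simp: compact_witnesses_def F.block_seq_mem[OF v_w_mem])
  show "kappa1 E F T \<le> (\<Sum>n. 2 ^ n * c n)"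
    using kappa1_le[OF normed_F *] F.summable_block_seq(2)[OF v_w_mem v_cost assms] by linarith
qed

end

lemma approximable_block_series:
  fixes E :: "('k::rc_field, 'a::ab_group_add) nvs" and F :: "('k, 'b::ab_group_add) nvs"
  assumes sp: "normed_space E" "normed_space F" and lam: "1 \<le> lam" "1 \<le> lam'"
    and LE: "script_Lp_space 2 lam' E" and LF: "script_Lp_space \<infinity> lam F"
    and T: "T \<in> approximable_ops E F" and "e > 0"
  defines "G \<equiv> grothendieck_constant TYPE('k) * lam * lam'"
  shows "\<exists>m p A v w \<tau>. block_series E F T m p A v w \<tau>
    (\<lambda>n. e / 16 ^ n + (if n = 0 then G * opnorm E F T else 0))"
proof -
  have G: "G \<ge> 0" using lam by (simp add: G_def grothendieck_constant_nonneg)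
  \<comment> \<open>With 64 in the denominator, \<open>2 * G * \<eta> / 16 ^ k\<close> is at most
    half of \<open>e / 16 ^ Suc k\<close>; the other half is left for
    \<open>finite_rank_factorization\<close>.\<close>
  define \<eta> where "\<eta> = e / (64 * (G + 1))"
  have "64 * (G + 1) * \<eta> = e" using G by (simp add: \<eta>_def)
  moreover have "64 * (G + 1) * \<eta> = 64 * (G * \<eta>) + 64 * \<eta>" by (simp add: algebra_simps)
  moreover have "\<eta> > 0" unfolding \<eta>_def using G \<open>e > 0\<close> by (intro divide_pos_pos) auto
  ultimately have \<eta>: "\<eta> > 0" "G * \<eta> \<le> e / 64"
    using G \<open>e > 0\<close> by linarith+
  obtain S where S: "\<And>n. S n \<in> finite_rank_ops E F" "opnorm E F (S 0) \<le> opnorm E F T + \<eta>"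
    "\<And>n. opnorm E F (S (Suc n)) \<le> 2 * \<eta> / 16 ^ n"
    "\<And>x. x \<in> vcarrier E \<Longrightarrow> converges_to F (\<lambda>N. \<Sum>n<N. S n x) (T x)"
    using approximable_series[OF sp T \<eta>(1)] by blast
  define c where "c n = e / 16 ^ n + (if n = 0 then G * opnorm E F T else 0)" for n
  have c: "G * opnorm E F (S n) + e / 16 ^ n / 2 \<le> c n" for n
  proof (cases n)
    case 0
    have "G * opnorm E F (S 0) \<le> G * (opnorm E F T + \<eta>)" using S(2) G by (rule mult_left_mono)
    then show ?thesis using \<eta>(2) \<open>e > 0\<close> 0 by (simp add: c_def distrib_left)
  next
    case (Suc k)
    have "G * opnorm E F (S (Suc k)) \<le> G * (2 * \<eta> / 16 ^ k)" using S(3) G by (rule mult_left_mono)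
    also have "\<dots> = 2 * (G * \<eta>) / 16 ^ k" by simp
    also have "\<dots> \<le> 2 * (e / 64) / 16 ^ k" using \<eta>(2) by (intro divide_right_mono) auto
    finally show ?thesis using \<open>e > 0\<close> by (simp add: c_def Suc field_simps)
  qed
  have "\<exists>m A v. A \<in> bounded_ops E (lp_space \<infinity> m) \<and> v \<in> bounded_ops (lp_space \<infinity> m) F \<and>
    (\<forall>y\<in>vcarrier (lp_space \<infinity> m). vnorm F (v y) \<le> lp_norm \<infinity> m y) \<and>
    (\<forall>x\<in>vcarrier E. S n x = v (A x)) \<and> hull_rep m (unit_ball E) (c n) A" for n
  proof -
    have "e / 16 ^ n / 2 > 0" using \<open>e > 0\<close> by simp
    from finite_rank_factorization[OF sp lam LE LF S(1)[of n] this, folded G_def] hull_rep_mono[OF _ c[of n]]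
    show ?thesis by blast
  qed
  then obtain m A v where mAv: "\<And>n. A n \<in> bounded_ops E (lp_space \<infinity> (m n))"
    "\<And>n. v n \<in> bounded_ops (lp_space \<infinity> (m n)) F"
    "\<And>n. \<forall>y\<in>vcarrier (lp_space \<infinity> (m n)). vnorm F (v n y) \<le> lp_norm \<infinity> (m n) y"
    "\<And>n. \<forall>x\<in>vcarrier E. S n x = v n (A n x)" "\<And>n. hull_rep (m n) (unit_ball E) (c n) (A n)"
    by metis
  then obtain p w \<tau> where "\<And>n. hull_data (m n) (unit_ball E) (c n) (A n) (p n) (w n) (\<tau> n)"
    unfolding hull_rep_def by metis
  note h = hull_dataD[OF this]
  have "block_series E F T m p A v w \<tau> c"
  proof
    show "A n x i = (\<Sum>k<p n. \<tau> n k x * w n k i)" if x: "x \<in> unit_ball E" for n x i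
    proof (cases "i < m n")
      case False
      have "A n x \<in> vcarrier (lp_space \<infinity> (m n))"
        using mAv(1)[of n] x by (auto simp: bounded_ops_def unit_ball_def)
      then show ?thesis using False h(1) by simp
    qed (use h(4) x in simp)
    show "converges_to F (\<lambda>N. \<Sum>n<N. v n (A n x)) (T x)" if x: "x \<in> vcarrier E" for x
      using S(4)[OF x] mAv(4) x by simp
  qed (use sp T mAv h in \<open>auto intro: approximable_bounded\<close>)
  then show ?thesis unfolding c_def by blast
qed

section \<open>Quotients of \<open>\<ell>\<^sub>\<infinity>\<close>\<close>

text \<open>An infinite matrix whose rows are meant to be finitely supported, so that it acts on all
  bounded sequences without any question of convergence. For an infinite \<open>J i\<close> the sum
  is 0 by convention.\<close>

definition seq_map ::
    "(nat \<Rightarrow> nat \<Rightarrow> 'k::rc_field) \<Rightarrow> (nat \<Rightarrow> nat set) \<Rightarrow> (nat \<Rightarrow> 'k) \<Rightarrow> nat \<Rightarrow> 'k" where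
  "seq_map q J \<alpha> i = (\<Sum>j\<in>J i. q i j * \<alpha> j)"

text \<open>This is \<open>\<ell>\<^sub>\<infinity>\<close> modulo the kernel of
  \<open>seq_map q J\<close> with the quotient norm. It is realised as the range of the map because
  the spaces in \<open>minimal_kernel\<close> have to consist of scalar sequences.\<close>

definition seq_quotient ::
    "(nat \<Rightarrow> nat \<Rightarrow> 'k::rc_field) \<Rightarrow> (nat \<Rightarrow> nat set) \<Rightarrow> ('k, nat \<Rightarrow> 'k) nvs" where
  "seq_quotient q J = \<lparr>vcarrier = {seq_map q J \<alpha> | \<alpha> r. \<forall>j. norm (\<alpha> j) \<le> r},
     vscale = (\<lambda>c x i. c * x i),
     vnorm = (\<lambda>z. Inf {r. \<exists>\<alpha>. (\<forall>j. norm (\<alpha> j) \<le> r) \<and> seq_map q J \<alpha> = z})\<rparr>"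

lemma seq_map_add: "seq_map q J (\<lambda>j. \<alpha> j + \<beta> j) = seq_map q J \<alpha> + seq_map q J \<beta>"
  by (rule ext) (simp add: seq_map_def sum.distrib distrib_left)

lemma seq_map_scale: "seq_map q J (\<lambda>j. c * \<alpha> j) = (\<lambda>i. c * seq_map q J \<alpha> i)"
  by (rule ext) (simp add: seq_map_def sum_distrib_left mult.left_commute)

lemma seq_map_zero: "seq_map q J (\<lambda>_. 0) = 0"
  by (rule ext) (simp add: seq_map_def)

lemma vscale_seq_quotient [simp]: "vscale (seq_quotient q J) = (\<lambda>c x i. c * x i)"
  by (simp add: seq_quotient_def)

lemma seq_quotient_memI: "\<forall>j. norm (\<alpha> j) \<le> r \<Longrightarrow> seq_map q J \<alpha> = z \<Longrightarrow> z \<in> vcarrier (seq_quotient q J)"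
  unfolding seq_quotient_def by auto

lemma seq_quotient_norm_le:
  assumes "\<forall>j. norm (\<alpha> j) \<le> r" "seq_map q J \<alpha> = z"
  shows "vnorm (seq_quotient q J) z \<le> r"
proof -
  have "bdd_below {r. \<exists>\<alpha>. (\<forall>j. norm (\<alpha> j) \<le> r) \<and> seq_map q J \<alpha> = z}"
    by (rule bdd_belowI[of _ 0]) (auto intro: order_trans[OF norm_ge_zero])
  then show ?thesis
    unfolding seq_quotient_def using assms by (auto intro!: cInf_lower)
qed

lemma seq_quotient_lift:
  assumes "z \<in> vcarrier (seq_quotient q J)" "vnorm (seq_quotient q J) z < r"
  shows "\<exists>\<alpha>. (\<forall>j. norm (\<alpha> j) \<le> r) \<and> seq_map q J \<alpha> = z"
proof -
  let ?R = "{r. \<exists>\<alpha>. (\<forall>j. norm (\<alpha> j) \<le> r) \<and> seq_map q J \<alpha> = z}"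
  have ne: "?R \<noteq> {}" using assms(1) by (auto simp: seq_quotient_def)
  have lt: "Inf ?R < r" using assms(2) by (simp add: seq_quotient_def)
  obtain r' where r': "r' \<in> ?R" "r' < r" using cInf_lessD[OF ne lt] by (elim bexE)
  then obtain \<alpha> where "\<forall>j. norm (\<alpha> j) \<le> r'" "seq_map q J \<alpha> = z" by auto
  with r'(2) have "(\<forall>j. norm (\<alpha> j) \<le> r) \<and> seq_map q J \<alpha> = z"
    by (meson less_imp_le order_trans)
  then show ?thesis by (intro exI[of _ \<alpha>])
qed

lemma seq_quotient_nonneg:
  assumes "z \<in> vcarrier (seq_quotient q J)"
  shows "0 \<le> vnorm (seq_quotient q J) z"
proof (rule ccontr)
  assume "\<not> ?thesis"
  then obtain \<alpha> :: "nat \<Rightarrow> 'a" where "\<forall>j. norm (\<alpha> j) \<le> vnorm (seq_quotient q J) z / 2"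
    using seq_quotient_lift[OF assms, of "vnorm (seq_quotient q J) z / 2"] by auto
  then have "0 \<le> vnorm (seq_quotient q J) z / 2"
    using norm_ge_zero order_trans by blast
  with \<open>\<not> ?thesis\<close> show False by linarith
qed

lemma norm_seq_map_le:
  assumes "\<forall>j. norm (\<alpha> j) \<le> r"
  shows "norm (seq_map q J \<alpha> i) \<le> (\<Sum>j\<in>J i. norm (q i j)) * r"
  unfolding seq_map_def sum_distrib_right
  by (rule sum_norm_le) (use assms in \<open>auto simp: norm_mult intro: mult_left_mono\<close>)

lemma le_mult_of_greater:
  fixes x y C :: real
  assumes "\<And>r. r > y \<Longrightarrow> x \<le> C * r" "C \<ge> 0"
  shows "x \<le> C * y"
proof (rule field_le_epsilon)
  fix e :: real assume "e > 0"
  have "x \<le> C * (y + e / (C + 1))"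
    using assms \<open>e > 0\<close> by (intro assms(1)) simp
  also have "\<dots> \<le> C * y + e"
    using \<open>C \<ge> 0\<close> \<open>e > 0\<close> by (simp add: field_simps)
  finally show "x \<le> C * y + e" .
qed

text \<open>Coordinates are bounded functionals on \<open>\<ell>\<^sub>\<infinity>\<close> that
  factor through the quotient. They make the quotient norm definite and later identify limits
  coordinate by coordinate.\<close>

lemma seq_quotient_coordinate_le:
  assumes "z \<in> vcarrier (seq_quotient q J)"
  shows "norm (z i) \<le> (\<Sum>j\<in>J i. norm (q i j)) * vnorm (seq_quotient q J) z"
proof (rule le_mult_of_greater)
  fix r assume "r > vnorm (seq_quotient q J) z"
  from seq_quotient_lift[OF assms this] norm_seq_map_le[of _ r q J i]
  show "norm (z i) \<le> (\<Sum>j\<in>J i. norm (q i j)) * r" by auto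
qed (simp add: sum_nonneg)

lemma normed_space_seq_quotient: "normed_space (seq_quotient q J :: ('k::rc_field, nat \<Rightarrow> 'k) nvs)"
proof -
  let ?X = "seq_quotient q J"
  have zero: "(0 :: nat \<Rightarrow> 'k) \<in> vcarrier ?X" "vnorm ?X (0 :: nat \<Rightarrow> 'k) = 0"
  proof -
    have 0: "\<forall>j::nat. norm (0::'k) \<le> 0" by simp
    show z: "(0 :: nat \<Rightarrow> 'k) \<in> vcarrier ?X" by (rule seq_quotient_memI[OF 0 seq_map_zero])
    show "vnorm ?X (0 :: nat \<Rightarrow> 'k) = 0"
      using seq_quotient_norm_le[OF 0 seq_map_zero, of q J] seq_quotient_nonneg[OF z] by simp
  qed
  have add: "x + y \<in> vcarrier ?X \<and> vnorm ?X (x + y) \<le> vnorm ?X x + vnorm ?X y"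
    if x: "x \<in> vcarrier ?X" and y: "y \<in> vcarrier ?X" for x y :: "nat \<Rightarrow> 'k"
  proof -
    have *: "x + y \<in> vcarrier ?X \<and> vnorm ?X (x + y) \<le> r + s"
      if rs: "r > vnorm ?X x" "s > vnorm ?X y" for r s
    proof -
      obtain \<alpha> where \<alpha>: "\<forall>j. norm (\<alpha> j) \<le> r" "seq_map q J \<alpha> = x"
        using seq_quotient_lift[OF x rs(1)] by blast
      obtain \<beta> where \<beta>: "\<forall>j. norm (\<beta> j) \<le> s" "seq_map q J \<beta> = y"
        using seq_quotient_lift[OF y rs(2)] by blast
      have 1: "\<forall>j. norm (\<alpha> j + \<beta> j) \<le> r + s"
        using \<alpha>(1) \<beta>(1) by (auto intro: norm_triangle_le add_mono)
      have 2: "seq_map q J (\<lambda>j. \<alpha> j + \<beta> j) = x + y" by (simp add: seq_map_add \<alpha> \<beta>)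
      show ?thesis using seq_quotient_memI[OF 1 2] seq_quotient_norm_le[OF 1 2] by simp
    qed
    have "vnorm ?X (x + y) \<le> vnorm ?X x + vnorm ?X y + e" if "e > 0" for e
      using *[of "vnorm ?X x + e / 2" "vnorm ?X y + e / 2"] that by simp
    then have "vnorm ?X (x + y) \<le> vnorm ?X x + vnorm ?X y" by (rule field_le_epsilon)
    with *[of "vnorm ?X x + 1" "vnorm ?X y + 1"] show ?thesis by simp
  qed
  have scale_le: "(\<lambda>i. c * x i) \<in> vcarrier ?X \<and> vnorm ?X (\<lambda>i. c * x i) \<le> norm c * vnorm ?X x"
    if x: "x \<in> vcarrier ?X" for c and x :: "nat \<Rightarrow> 'k"
  proof -
    have *: "(\<lambda>i. c * x i) \<in> vcarrier ?X \<and> vnorm ?X (\<lambda>i. c * x i) \<le> norm c * r"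
      if r: "r > vnorm ?X x" for r
    proof -
      obtain \<alpha> where \<alpha>: "\<forall>j. norm (\<alpha> j) \<le> r" "seq_map q J \<alpha> = x"
        using seq_quotient_lift[OF x r] by blast
      have 1: "\<forall>j. norm (c * \<alpha> j) \<le> norm c * r"
        using \<alpha>(1) by (simp add: norm_mult mult_left_mono)
      have 2: "seq_map q J (\<lambda>j. c * \<alpha> j) = (\<lambda>i. c * x i)" by (simp add: seq_map_scale \<alpha>)
      show ?thesis using seq_quotient_memI[OF 1 2] seq_quotient_norm_le[OF 1 2] by simp
    qed
    have "vnorm ?X (\<lambda>i. c * x i) \<le> norm c * vnorm ?X x"
      by (rule le_mult_of_greater) (use * in auto)
    with *[of "vnorm ?X x + 1"] show ?thesis by simp
  qed
  have scale: "vnorm ?X (\<lambda>i. c * x i) = norm c * vnorm ?X x"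
    if x: "x \<in> vcarrier ?X" for c and x :: "nat \<Rightarrow> 'k"
  proof (cases "c = 0")
    case True
    then show ?thesis using zero(2) by (simp add: zero_fun_def)
  next
    case False
    have "(\<lambda>i. inverse c * (c * x i)) = x" using False by (simp add: mult.assoc[symmetric])
    then have "vnorm ?X x \<le> norm (inverse c) * vnorm ?X (\<lambda>i. c * x i)"
      using scale_le[of "\<lambda>i. c * x i" "inverse c"] scale_le[OF x, of c] by simp
    then have "norm c * vnorm ?X x \<le> vnorm ?X (\<lambda>i. c * x i)"
      using False by (simp add: norm_divide field_simps)
    with scale_le[OF x, of c] show ?thesis by simp
  qed
  have eq_0: "x = 0" if "x \<in> vcarrier ?X" "vnorm ?X x = 0" for x :: "nat \<Rightarrow> 'k"
  proof
    fix i
    show "x i = 0 i" using seq_quotient_coordinate_le[OF that(1), of i] that(2) by simp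
  qed
  show ?thesis
    unfolding normed_space_def vscale_seq_quotient
  proof (intro conjI ballI allI)
    show "module.subspace (\<lambda>c x i. c * x i) (vcarrier ?X)"
      unfolding subspace_pointwise using zero(1) add scale_le by simp
    show "vnorm ?X x = 0 \<longleftrightarrow> x = 0" if "x \<in> vcarrier ?X" for x
      using eq_0[OF that] zero(2) by blast
  qed (simp_all add: vector_space_pointwise seq_quotient_nonneg add scale)
qed

text \<open>Along suitable indices a Cauchy sequence has increments below
  \<open>(1 / 2) ^ n\<close>; once the values along these indices converge, so does the
  sequence.\<close>

lemma (in normed_structure) banach_spaceI:
  assumes "\<And>d. (\<And>n. d n \<in> vcarrier E \<and> vnorm E (d n) < (1 / 2) ^ n) \<Longrightarrow>
    \<exists>s. converges_to E (\<lambda>N. \<Sum>n<N. d n) s"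
  shows "banach_space E"
  unfolding banach_space_def
proof (intro conjI allI impI normed)
  fix X :: "nat \<Rightarrow> 'a"
  assume X: "range X \<subseteq> vcarrier E \<and> (\<forall>e>0. \<exists>M. \<forall>m\<ge>M. \<forall>n\<ge>M. vnorm E (X m - X n) < e)"
  then have mem: "X n \<in> vcarrier E" for n by auto
  have "\<exists>M. \<forall>m\<ge>M. \<forall>n\<ge>M. vnorm E (X m - X n) < (1 / 2) ^ k" for k :: nat
    using X by simp
  then obtain M where M: "\<And>k m n. m \<ge> M k \<Longrightarrow> n \<ge> M k \<Longrightarrow> vnorm E (X m - X n) < (1 / 2) ^ k"
    by metis
  \<comment> \<open>Summing \<open>M\<close> gives a monotone majorant, so \<open>\<rho> k\<close>
    and \<open>\<rho> (Suc k)\<close> both lie beyond \<open>M k\<close>.\<close>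
  define \<rho> where "\<rho> k = (\<Sum>i\<le>k. M i)" for k
  have \<rho>_ge: "M k \<le> \<rho> l" if "k \<le> l" for k l
    unfolding \<rho>_def by (rule member_le_sum) (use that in auto)
  define d where "d k = X (\<rho> (Suc k)) - X (\<rho> k)" for k
  have "d n \<in> vcarrier E \<and> vnorm E (d n) < (1 / 2) ^ n" for n
    unfolding d_def using \<rho>_ge[of n n] \<rho>_ge[of n "Suc n"] by (auto intro: M diff_mem mem)
  from assms[OF this] obtain s where s: "converges_to E (\<lambda>N. \<Sum>n<N. d n) s" by blast
  have d_sum: "(\<Sum>n<N. d n) = X (\<rho> N) - X (\<rho> 0)" for N
    by (induction N) (simp_all add: d_def)
  define x where "x = s + X (\<rho> 0)"
  have x: "x \<in> vcarrier E" using s mem by (simp add: x_def converges_to_def add_mem)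
  have "(\<lambda>N. vnorm E (X (\<rho> N) - x)) \<longlonglongrightarrow> 0"
    using s unfolding converges_to_def d_sum x_def by (simp add: algebra_simps)
  have "(\<lambda>n. vnorm E (X n - x)) \<longlonglongrightarrow> 0"
  proof (rule LIMSEQ_I)
    fix e :: real assume "e > 0"
    then obtain k where k: "(1 / 2) ^ k < e / 2"
      using real_arch_pow_inv[of "e / 2" "1 / 2"] by auto
    have "e / 2 > 0" using \<open>e > 0\<close> by simp
    from LIMSEQ_D[OF \<open>(\<lambda>N. vnorm E (X (\<rho> N) - x)) \<longlonglongrightarrow> 0\<close> this]
    obtain N0 where N0': "\<forall>N\<ge>N0. norm (vnorm E (X (\<rho> N) - x) - 0) < e / 2" by (elim exE)
    have N0: "vnorm E (X (\<rho> N) - x) < e / 2" if "N \<ge> N0" for N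
    proof -
      have "norm (vnorm E (X (\<rho> N) - x) - 0) < e / 2" using N0' that by simp
      then show ?thesis by (simp add: abs_less_iff)
    qed
    have "norm (vnorm E (X n - x) - 0) < e" if "n \<ge> M k" for n
    proof -
      define N where "N = max k N0"
      have "vnorm E (X n - x) \<le> vnorm E (X n - X (\<rho> N)) + vnorm E (X (\<rho> N) - x)"
        by (rule triangle_via) (rule mem mem x)+
      also have "\<dots> < (1 / 2) ^ k + e / 2"
        by (intro add_strict_mono M N0 that \<rho>_ge) (auto simp: N_def)
      finally show ?thesis using k nonneg[OF diff_mem[OF mem x]] by simp
    qed
    then show "\<exists>n0. \<forall>n\<ge>n0. norm (vnorm E (X n - x) - 0) < e" by blast
  qed
  with x show "\<exists>x. converges_to E X x" by (auto simp: converges_to_def)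
qed

lemma sum_half_powers_le: "(\<Sum>n\<in>{N..<M}. (1 / 2) ^ n) \<le> 2 * (1 / 2 :: real) ^ N"
proof (cases "N \<le> M")
  case True
  then have "(\<Sum>n\<in>{N..<M}. (1 / 2 :: real) ^ n) = 2 * (1 / 2) ^ N - 2 * (1 / 2) ^ M"
    by (induction M rule: dec_induct) auto
  then show ?thesis by simp
qed simp

lemma sum_diff_lessThan: "N \<le> M \<Longrightarrow> (\<Sum>n<M. f n) - (\<Sum>n<N. f n) = (\<Sum>n\<in>{N..<M}. f n :: 'c::ab_group_add)"
  for N M :: nat
  using sum.atLeastLessThan_concat[of 0 N M f] by (simp add: lessThan_atLeast0 algebra_simps)

text \<open>The terms are lifted with bounds \<open>(1 / 2) ^ n\<close>, the lifts are summed
  coordinatewise by completeness of the scalars, and the uniform tail bound descends through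
  \<open>seq_map\<close>.\<close>

lemma banach_space_seq_quotient: "banach_space (seq_quotient q J :: ('k::rc_field, nat \<Rightarrow> 'k) nvs)"
proof -
  interpret normed_structure "seq_quotient q J :: ('k, nat \<Rightarrow> 'k) nvs"
    by standard (rule normed_space_seq_quotient)
  show ?thesis
  proof (rule banach_spaceI)
    fix d :: "nat \<Rightarrow> nat \<Rightarrow> 'k"
    assume d: "\<And>n. d n \<in> vcarrier (seq_quotient q J) \<and> vnorm (seq_quotient q J) (d n) < (1 / 2) ^ n"
    have "\<exists>\<alpha>. (\<forall>j. norm (\<alpha> j) \<le> (1 / 2) ^ n) \<and> seq_map q J \<alpha> = d n" for n
      using d[of n] by (intro seq_quotient_lift) auto
    then obtain \<alpha> where \<alpha>: "\<And>n j. norm (\<alpha> n j) \<le> (1 / 2) ^ n" "\<And>n. seq_map q J (\<alpha> n) = d n"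
      by metis
    define \<beta> where "\<beta> j = (\<Sum>n. \<alpha> n j)" for j
    have lim: "(\<lambda>N. \<Sum>n<N. \<alpha> n j) \<longlonglongrightarrow> \<beta> j" for j
      unfolding \<beta>_def by (intro summable_LIMSEQ rc_summable_comparison[OF _ \<alpha>(1)]) simp
    have tail: "norm (\<beta> j - (\<Sum>n<N. \<alpha> n j)) \<le> 2 * (1 / 2) ^ N" for j N
    proof (rule LIMSEQ_le_const2)
      show "(\<lambda>M. norm ((\<Sum>n<M. \<alpha> n j) - (\<Sum>n<N. \<alpha> n j))) \<longlonglongrightarrow> norm (\<beta> j - (\<Sum>n<N. \<alpha> n j))"
        by (intro tendsto_intros lim)
      have "norm ((\<Sum>n<M. \<alpha> n j) - (\<Sum>n<N. \<alpha> n j)) \<le> 2 * (1 / 2) ^ N" if "M \<ge> N" for M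
      proof -
        have "norm (\<Sum>n\<in>{N..<M}. \<alpha> n j) \<le> (\<Sum>n\<in>{N..<M}. (1 / 2) ^ n)"
          by (rule sum_norm_le) (rule \<alpha>)
        also have "\<dots> \<le> 2 * (1 / 2) ^ N" by (rule sum_half_powers_le)
        finally show ?thesis using that by (simp add: sum_diff_lessThan)
      qed
      then show "\<exists>M0. \<forall>M\<ge>M0. norm ((\<Sum>n<M. \<alpha> n j) - (\<Sum>n<N. \<alpha> n j)) \<le> 2 * (1 / 2) ^ N" by blast
    qed
    define s where "s = seq_map q J \<beta>"
    have s: "s \<in> vcarrier (seq_quotient q J)"
      by (rule seq_quotient_memI[of \<beta> 2]) (use tail[of _ 0] in \<open>auto simp: s_def\<close>)
    have upper: "\<forall>N. vnorm (seq_quotient q J) ((\<Sum>n<N. d n) - s) \<le> 2 * (1 / 2) ^ N"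
    proof
      fix N
      have "seq_map q J (\<lambda>j. \<beta> j - (\<Sum>n<N. \<alpha> n j)) = s - (\<Sum>n<N. d n)"
      proof
        fix i
        have "(\<Sum>j\<in>J i. q i j * (\<Sum>n<N. \<alpha> n j)) = (\<Sum>n<N. \<Sum>j\<in>J i. q i j * \<alpha> n j)"
          unfolding sum_distrib_left by (rule sum.swap)
        also have "\<dots> = (\<Sum>n<N. d n) i"
          by (simp add: sum_pointwise seq_map_def flip: \<alpha>(2))
        finally show "seq_map q J (\<lambda>j. \<beta> j - (\<Sum>n<N. \<alpha> n j)) i = (s - (\<Sum>n<N. d n)) i"
          by (simp add: seq_map_def s_def right_diff_distrib sum_subtractf)
      qed
      then have "vnorm (seq_quotient q J) (s - (\<Sum>n<N. d n)) \<le> 2 * (1 / 2) ^ N"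
        using tail by (intro seq_quotient_norm_le) auto
      then show "vnorm (seq_quotient q J) ((\<Sum>n<N. d n) - s) \<le> 2 * (1 / 2) ^ N"
        using norm_diff_commute[OF s sum_mem[of "{..<N}" d]] d by simp
    qed
    have lower: "\<forall>N. 0 \<le> vnorm (seq_quotient q J) ((\<Sum>n<N. d n) - s)"
      using d s by (intro allI nonneg diff_mem sum_mem) auto
    have "(\<lambda>N. 2 * (1 / 2) ^ N) \<longlonglongrightarrow> 2 * (0::real)"
      by (intro tendsto_intros LIMSEQ_power_zero) simp
    then have z: "(\<lambda>N. 2 * (1 / 2) ^ N) \<longlonglongrightarrow> (0::real)" by simp
    have "(\<lambda>N. vnorm (seq_quotient q J) ((\<Sum>n<N. d n) - s)) \<longlonglongrightarrow> 0"
      by (rule tendsto_sandwich[OF always_eventually[OF lower] always_eventually[OF upper] tendsto_const z])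
    with s show "\<exists>s. converges_to (seq_quotient q J) (\<lambda>N. \<Sum>n<N. d n) s"
      by (auto simp: converges_to_def)
  qed
qed

text \<open>The identity matrix has trivial kernel, so this is
  \<open>\<ell>\<^sub>\<infinity>\<close> itself, with completeness inherited from the general
  construction.\<close>

definition seq_linf :: "('k::rc_field, nat \<Rightarrow> 'k) nvs" where
  "seq_linf = seq_quotient (\<lambda>_ _. 1) (\<lambda>i. {i})"

lemma seq_map_id: "seq_map (\<lambda>_ _. 1) (\<lambda>i. {i}) \<alpha> = \<alpha>"
  by (rule ext) (simp add: seq_map_def)

lemma banach_space_linf: "banach_space (seq_linf :: ('k::rc_field, nat \<Rightarrow> 'k) nvs)"
  unfolding seq_linf_def by (rule banach_space_seq_quotient)

lemma normed_space_linf: "normed_space (seq_linf :: ('k::rc_field, nat \<Rightarrow> 'k) nvs)"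
  unfolding seq_linf_def by (rule normed_space_seq_quotient)

lemma vscale_linf [simp]: "vscale seq_linf = (\<lambda>c x i. c * x i)"
  by (simp add: seq_linf_def)

lemma linf_norm_le:
  assumes "\<And>j. norm (y j) \<le> r"
  shows "y \<in> vcarrier seq_linf" and "vnorm seq_linf y \<le> r"
  unfolding seq_linf_def using assms
  by (auto intro: seq_quotient_memI[OF _ seq_map_id] seq_quotient_norm_le[OF _ seq_map_id])

lemma linf_coordinate_le: "y \<in> vcarrier seq_linf \<Longrightarrow> norm (y j) \<le> vnorm seq_linf y"
  unfolding seq_linf_def using seq_quotient_coordinate_le[of y "\<lambda>_ _. 1" "\<lambda>i. {i}" j] by simp

section \<open>Series of operators\<close>

context normed_structure
begin

lemma converges_to_add:
  assumes "converges_to E X x" "converges_to E Y y" "\<And>n. X n \<in> vcarrier E" "\<And>n. Y n \<in> vcarrier E"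
  shows "converges_to E (\<lambda>n. X n + Y n) (x + y)"
proof -
  have xy: "x \<in> vcarrier E" "y \<in> vcarrier E" using assms by (auto simp: converges_to_def)
  have upper: "\<forall>n. vnorm E (X n + Y n - (x + y)) \<le> vnorm E (X n - x) + vnorm E (Y n - y)"
    using triangle[OF diff_mem[OF assms(3) xy(1)] diff_mem[OF assms(4) xy(2)]]
    by (simp add: algebra_simps)
  have lower: "\<forall>n. 0 \<le> vnorm E (X n + Y n - (x + y))"
    using assms(3,4) xy by (intro allI nonneg diff_mem add_mem)
  have "(\<lambda>n. vnorm E (X n - x) + vnorm E (Y n - y)) \<longlonglongrightarrow> 0 + 0"
    using assms by (intro tendsto_add) (auto simp: converges_to_def)
  then have z: "(\<lambda>n. vnorm E (X n - x) + vnorm E (Y n - y)) \<longlonglongrightarrow> 0" by simp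
  have "(\<lambda>n. vnorm E (X n + Y n - (x + y))) \<longlonglongrightarrow> 0"
    by (rule tendsto_sandwich[OF always_eventually[OF lower] always_eventually[OF upper] tendsto_const z])
  with xy show ?thesis by (simp add: converges_to_def add_mem)
qed

lemma converges_to_scale:
  assumes "converges_to E X x" "\<And>n. X n \<in> vcarrier E"
  shows "converges_to E (\<lambda>n. vscale E c (X n)) (vscale E c x)"
proof -
  have x: "x \<in> vcarrier E" using assms by (auto simp: converges_to_def)
  have "vnorm E (vscale E c (X n) - vscale E c x) = norm c * vnorm E (X n - x)" for n
    using norm_scale[OF diff_mem[OF assms(2) x]] by (simp add: scale_right_diff_distrib)
  moreover have "(\<lambda>n. norm c * vnorm E (X n - x)) \<longlonglongrightarrow> norm c * 0"
    using assms by (intro tendsto_intros) (auto simp: converges_to_def)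
  ultimately show ?thesis using x by (simp add: converges_to_def scale_mem)
qed

end

text \<open>Linearity of the pointwise sum comes from uniqueness of limits. The explicit tail,
  uniform on the unit ball, is what later yields approximability.\<close>

lemma series_operator:
  assumes "normed_space E" "banach_space F" and B: "\<And>n. B n \<in> bounded_ops E F"
    and le: "\<And>n x. x \<in> vcarrier E \<Longrightarrow> vnorm F (B n x) \<le> (1 / 2) ^ n * vnorm E x"
  shows "\<exists>S\<in>bounded_ops E F. \<forall>x\<in>vcarrier E. converges_to F (\<lambda>N. \<Sum>n<N. B n x) (S x) \<and>
    (\<forall>N. vnorm F (S x - (\<Sum>n<N. B n x)) \<le> 2 * (1 / 2) ^ N * vnorm E x)"
proof -
  have "normed_space F" using assms by (simp add: banach_space_def)
  have bo: "bounded_operator E F (B n)" for n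
    using assms \<open>normed_space F\<close> by (intro bounded_operatorI)
  interpret E: normed_structure E by standard fact
  interpret F: normed_structure F by standard fact
  have mem: "(\<Sum>n<N. B n x) \<in> vcarrier F" if "x \<in> vcarrier E" for x N
    using that bounded_operator.mem[OF bo] by (intro F.sum_mem)
  have tail: "vnorm F ((\<Sum>n<M. B n x) - (\<Sum>n<N. B n x)) \<le> 2 * (1 / 2) ^ N * vnorm E x"
    if x: "x \<in> vcarrier E" and "N \<le> M" for x M N
  proof -
    have "vnorm F (\<Sum>n\<in>{N..<M}. B n x) \<le> (\<Sum>n\<in>{N..<M}. vnorm F (B n x))"
      using bounded_operator.mem[OF bo x] by (intro F.norm_sum_le)
    also have "\<dots> \<le> (\<Sum>n\<in>{N..<M}. (1 / 2) ^ n * vnorm E x)" by (intro sum_mono le x)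
    also have "\<dots> \<le> 2 * (1 / 2) ^ N * vnorm E x"
      unfolding sum_distrib_right[symmetric] using x by (intro mult_right_mono sum_half_powers_le) auto
    finally show ?thesis using that by (simp add: sum_diff_lessThan)
  qed
  have "\<exists>y. converges_to F (\<lambda>N. \<Sum>n<N. B n x) y" if x: "x \<in> vcarrier E" for x
  proof -
    have "\<exists>K. \<forall>m\<ge>K. \<forall>n\<ge>K. vnorm F ((\<Sum>i<m. B i x) - (\<Sum>i<n. B i x)) < e" if "e > 0" for e
    proof -
      obtain K where K: "(1 / 2) ^ K < e / (4 * (vnorm E x + 1))"
        using real_arch_pow_inv[of "e / (4 * (vnorm E x + 1))" "1 / 2"] \<open>e > 0\<close> x
        by (auto simp: add_nonneg_pos)
      have pos: "vnorm E x + 1 > 0" using E.nonneg[OF x] by simp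
      have small: "2 * (2 * (1 / 2) ^ K * vnorm E x) < e"
      proof -
        have "4 * (vnorm E x + 1) * (1 / 2) ^ K < e" using K pos by (simp add: field_simps)
        moreover have "(1 / 2 :: real) ^ K > 0" by simp
        moreover have "4 * (vnorm E x + 1) * (1 / 2) ^ K
            = 2 * (2 * (1 / 2) ^ K * vnorm E x) + 4 * (1 / 2) ^ K"
          by (simp add: algebra_simps)
        ultimately show ?thesis by linarith
      qed
      have "vnorm F ((\<Sum>i<m. B i x) - (\<Sum>i<n. B i x)) < e" if "m \<ge> K" "n \<ge> K" for m n
        using F.triangle_via[OF mem[OF x] mem[OF x] mem[OF x], of m n K]
          F.norm_diff_commute[OF mem[OF x] mem[OF x], of n K] tail[OF x that(1)] tail[OF x that(2)] small
        by linarith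
      then show ?thesis by blast
    qed
    then show ?thesis
      using assms(2) mem[OF x] unfolding banach_space_def by (auto simp: image_subset_iff)
  qed
  then obtain S where S: "\<And>x. x \<in> vcarrier E \<Longrightarrow> converges_to F (\<lambda>N. \<Sum>n<N. B n x) (S x)"
    by metis
  have Sm: "S x \<in> vcarrier F" if "x \<in> vcarrier E" for x
    using S[OF that] by (simp add: converges_to_def)
  have S_tail: "vnorm F (S x - (\<Sum>n<N. B n x)) \<le> 2 * (1 / 2) ^ N * vnorm E x"
    if x: "x \<in> vcarrier E" for x N
  proof (rule F.limit_norm_le)
    show "converges_to F (\<lambda>M. (\<Sum>n<M. B n x) - (\<Sum>n<N. B n x)) (S x - (\<Sum>n<N. B n x))"
      using S[OF x] Sm[OF x] mem[OF x] by (simp add: converges_to_def F.diff_mem)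
    show "(\<Sum>n<M. B n x) - (\<Sum>n<N. B n x) \<in> vcarrier F" for M by (intro F.diff_mem mem x)
  qed (rule tail[OF x])
  have "S \<in> bounded_ops E F"
  proof (rule bounded_opsI[where C = 2])
    fix x y assume x: "x \<in> vcarrier E" and y: "y \<in> vcarrier E"
    have "(\<Sum>n<N. B n (x + y)) = (\<Sum>n<N. B n x) + (\<Sum>n<N. B n y)" for N
      using bounded_operator.add[OF bo x y] by (simp add: sum.distrib)
    then have "converges_to F (\<lambda>N. \<Sum>n<N. B n (x + y)) (S x + S y)"
      using F.converges_to_add[OF S[OF x] S[OF y] mem[OF x] mem[OF y]] by simp
    then show "S (x + y) = S x + S y"
      using F.limit_unique[OF S[OF E.add_mem[OF x y]] _ mem[OF E.add_mem[OF x y]]] by blast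
  next
    fix a x assume x: "x \<in> vcarrier E"
    have "(\<Sum>n<N. B n (vscale E a x)) = vscale F a (\<Sum>n<N. B n x)" for N
      using bounded_operator.scale[OF bo x] by (simp add: F.scale_sum_right)
    then have "converges_to F (\<lambda>N. \<Sum>n<N. B n (vscale E a x)) (vscale F a (S x))"
      using F.converges_to_scale[OF S[OF x] mem[OF x]] by simp
    then show "S (vscale E a x) = vscale F a (S x)"
      using F.limit_unique[OF S[OF E.scale_mem[OF x]] _ mem[OF E.scale_mem[OF x]]] by blast
  next
    fix x assume x: "x \<in> vcarrier E"
    show "vnorm F (S x) \<le> 2 * vnorm E x" using S_tail[OF x, of 0] by simp
  qed (rule Sm)
  with S S_tail show ?thesis by blast
qed

lemma finite_rank_zero:
  assumes "normed_space E" "normed_space F"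
  shows "(\<lambda>_. 0) \<in> finite_rank_ops E F"
proof -
  interpret E: normed_structure E by standard fact
  interpret F: normed_structure F by standard fact
  have "(\<lambda>_. 0) ` vcarrier E = F.span {}"
    using E.zero_mem by (simp only: F.span_empty) blast
  then have "finite_dim F ((\<lambda>_. 0) ` vcarrier E)"
    unfolding finite_dim_def by (intro exI[of _ "{}"]) simp
  then show ?thesis
    using bounded_ops_zero[OF assms] by (simp add: finite_rank_ops_def)
qed

lemma finite_rank_sum:
  fixes N :: nat
  assumes sp: "normed_space E" "normed_space F" and T: "\<And>n. n < N \<Longrightarrow> T n \<in> finite_rank_ops E F"
  shows "(\<lambda>x. \<Sum>n<N. T n x) \<in> finite_rank_ops E F"
  using T
proof (induction N)
  case 0
  then show ?case using finite_rank_zero[OF sp] by simp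
next
  case (Suc N)
  have "(\<lambda>x. 0 - T N x) \<in> finite_rank_ops E F"
    by (rule finite_rank_diff[OF sp finite_rank_zero[OF sp]]) (simp add: Suc.prems)
  from finite_rank_diff[OF sp Suc.IH this] Suc.prems show ?case by simp
qed

lemma series_operator_approximable:
  assumes "normed_space E" "banach_space F" and B: "\<And>n. B n \<in> finite_rank_ops E F"
    and le: "\<And>n x. x \<in> vcarrier E \<Longrightarrow> vnorm F (B n x) \<le> (1 / 2) ^ n * vnorm E x"
  shows "\<exists>S\<in>approximable_ops E F. \<forall>x\<in>vcarrier E. converges_to F (\<lambda>N. \<Sum>n<N. B n x) (S x)"
proof -
  have F: "normed_space F" using assms by (simp add: banach_space_def)
  obtain S where S: "S \<in> bounded_ops E F" "\<And>x. x \<in> vcarrier E \<Longrightarrow> converges_to F (\<lambda>N. \<Sum>n<N. B n x) (S x)"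
    "\<And>x N. x \<in> vcarrier E \<Longrightarrow> vnorm F (S x - (\<Sum>n<N. B n x)) \<le> 2 * (1 / 2) ^ N * vnorm E x"
    using series_operator[OF assms(1,2) finite_rank_bounded[OF B] le] by blast
  have "S \<in> approximable_ops E F"
  proof (rule approximableI[OF assms(1) S(1)])
    fix e :: real assume "e > 0"
    then obtain N where N: "(1 / 2) ^ N < e / 2"
      using real_arch_pow_inv[of "e / 2" "1 / 2"] by auto
    have "vnorm F (S x - (\<Sum>n<N. B n x)) \<le> e" if x: "x \<in> unit_ball E" for x
    proof -
      have "vnorm F (S x - (\<Sum>n<N. B n x)) \<le> 2 * (1 / 2) ^ N * vnorm E x"
        using x by (intro S(3)) (simp add: unit_ball_def)
      also have "\<dots> \<le> 2 * (1 / 2) ^ N * 1"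
        using x by (intro mult_left_mono) (auto simp: unit_ball_def)
      finally show ?thesis using N by simp
    qed
    then show "\<exists>A\<in>finite_rank_ops E F. \<forall>x\<in>unit_ball E. vnorm F (S x - A x) \<le> e"
      by (intro bexI[OF _ finite_rank_sum[OF assms(1) F B]]) auto
  qed
  with S(2) show ?thesis by blast
qed

section \<open>Factorization through the minimal kernel\<close>

definition at_block :: "nat \<Rightarrow> (nat \<Rightarrow> 'k::zero) \<Rightarrow> nat \<Rightarrow> 'k" where
  "at_block n y l = (case prod_decode l of (n', i) \<Rightarrow> if n' = n then y i else 0)"

lemma at_block_prod_encode [simp]: "at_block n y (prod_encode (n', i)) = (if n' = n then y i else 0)"
  by (simp add: at_block_def)

lemma ext_prod_encode: "(\<And>n i. f (prod_encode (n, i)) = g (prod_encode (n, i))) \<Longrightarrow> f = g"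
  by (metis ext prod_decode_inverse surj_pair)

context block_series
begin

text \<open>The coefficients \<open>\<tau> n k x\<close> need not depend linearly on \<open>x\<close>, only their class modulo the kernel of
  the map \<open>\<alpha> \<mapsto> (\<Sum>k<p n. \<alpha> k * w n k)\<close> does.  This is why the first operator of the
  factorization takes values in a quotient of \<open>\<ell>\<^sub>\<infinity>\<close>.\<close>

definition block_matrix :: "nat \<Rightarrow> nat \<Rightarrow> 'k" where
  "block_matrix l j = w (fst (prod_decode l)) (snd (prod_decode j)) (snd (prod_decode l))"

text \<open>Confining row \<open>(n, i)\<close> to these columns makes the matrix block diagonal;
  \<open>block_matrix\<close> itself does not compare the block numbers of row and column.\<close>

definition block_index :: "nat \<Rightarrow> nat set" where
  "block_index l = (\<lambda>k. prod_encode (fst (prod_decode l), k)) ` {..<p (fst (prod_decode l))}"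

definition block_quotient :: "('k, nat \<Rightarrow> 'k) nvs" where
  "block_quotient = seq_quotient block_matrix block_index"

lemma seq_map_block:
  "seq_map block_matrix block_index \<alpha> (prod_encode (n, i)) = (\<Sum>k<p n. w n k i * \<alpha> (prod_encode (n, k)))"
proof -
  have "inj_on (\<lambda>k. prod_encode (n, k)) {..<p n}" by (auto simp: inj_on_def)
  then show ?thesis
    by (simp add: seq_map_def block_matrix_def block_index_def sum.reindex)
qed

lemma banach_space_block_quotient: "banach_space block_quotient"
  unfolding block_quotient_def by (rule banach_space_seq_quotient)

lemma normed_space_block_quotient: "normed_space block_quotient"
  unfolding block_quotient_def by (rule normed_space_seq_quotient)

lemma norm_w_le: "norm (w n k i) \<le> lp_norm \<infinity> (m n) (w n k)"
  using norm_le_lp_norm_infinity[of i "m n" "w n k"] w_zero[of n i k] lp_norm_infinity_nonneg[of "m n" "w n k"]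
  by (cases "i < m n") auto

lemma norm_w_sum_le: "(\<Sum>k<p n. norm (w n k i)) \<le> c n"
proof -
  have "(\<Sum>k<p n. norm (w n k i)) \<le> (\<Sum>k<p n. lp_norm \<infinity> (m n) (w n k))"
    by (intro sum_mono norm_w_le)
  with cost[of n] show ?thesis by linarith
qed

lemma c_nonneg: "0 \<le> c n"
  using norm_w_sum_le[of n 0] sum_nonneg[of "{..<p n}" "\<lambda>k. norm (w n k 0)"] by simp

text \<open>Row \<open>(n, i)\<close> has absolute sum at most \<open>c n\<close>, so decay of the
  costs becomes decay of the coordinates.\<close>

lemma block_quotient_coordinate_le:
  assumes "z \<in> vcarrier block_quotient"
  shows "norm (z (prod_encode (n, i))) \<le> c n * vnorm block_quotient z"
proof -
  have "inj_on (\<lambda>k. prod_encode (n, k)) {..<p n}" by (auto simp: inj_on_def)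
  then have "(\<Sum>j\<in>block_index (prod_encode (n, i)). norm (block_matrix (prod_encode (n, i)) j))
      = (\<Sum>k<p n. norm (w n k i))"
    by (simp add: block_matrix_def block_index_def sum.reindex)
  then have "norm (z (prod_encode (n, i))) \<le> (\<Sum>k<p n. norm (w n k i)) * vnorm block_quotient z"
    using seq_quotient_coordinate_le[of z block_matrix block_index "prod_encode (n, i)"] assms
    by (simp add: block_quotient_def)
  also have "\<dots> \<le> c n * vnorm block_quotient z"
    using assms normed_structure.nonneg[OF normed_structure.intro[OF normed_space_block_quotient]]
    by (intro mult_right_mono norm_w_sum_le)
  finally show ?thesis .
qed

section \<open>The approximable first factor\<close>

definition into_block :: "nat \<Rightarrow> 'a \<Rightarrow> nat \<Rightarrow> 'k" where
  "into_block n x = at_block n (\<lambda>i. of_real ((1 / 2) ^ n) * A n x i)"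

text \<open>With \<open>y\<close> the normalised \<open>x\<close>, the sequence of the
  \<open>(1 / 2) ^ n * vnorm E x * \<tau> n k y\<close> is a preimage of
  \<open>into_block n x\<close>. Its nonlinearity is harmless, because the quotient norm needs just
  some preimage.\<close>

lemma into_block_bound:
  assumes x: "x \<in> vcarrier E"
  shows "into_block n x \<in> vcarrier block_quotient"
    and "vnorm block_quotient (into_block n x) \<le> (1 / 2) ^ n * vnorm E x"
proof -
  obtain y where y: "y \<in> unit_ball E" "x = vscale E (of_real (vnorm E x)) y"
    using E.eq_scale_unit_ball[OF x] by blast
  define r where "r = vnorm E x"
  have r0: "0 \<le> r" using x by (simp add: r_def)
  interpret A: bounded_operator E "lp_space \<infinity> (m n)" "A n"
    by (intro bounded_operatorI normed_E normed_space_lp_infinity A)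
  have "A n (vscale E (of_real r) y) = (\<lambda>i. of_real r * A n y i)"
    using y(1) A.scale[of y "of_real r"] by (simp add: unit_ball_def)
  then have "A n x = (\<lambda>i. of_real r * A n y i)"
    using y(2) by (simp add: r_def)
  then have Ax: "A n x i = (\<Sum>k<p n. w n k i * (of_real r * \<tau> n k y))" for i
    by (simp add: A_eq[OF y(1)] sum_distrib_left mult_ac)
  define \<alpha> where "\<alpha> = at_block n (\<lambda>k. of_real ((1 / 2) ^ n) * (of_real r * \<tau> n k y))"
  have \<alpha>_le: "\<forall>j. norm (\<alpha> j) \<le> (1 / 2) ^ n * vnorm E x"
  proof
    fix j
    obtain n' k where j: "j = prod_encode (n', k)" by (rule prod_encode_cases)
    have "r * norm (\<tau> n k y) \<le> r" using \<tau>_le[OF y(1)] r0 by (rule mult_left_le)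
    then show "norm (\<alpha> j) \<le> (1 / 2) ^ n * vnorm E x"
      using r0 by (auto simp: j \<alpha>_def norm_mult norm_power norm_divide r_def[symmetric] intro!: mult_left_mono)
  qed
  have "seq_map block_matrix block_index \<alpha> = into_block n x"
    by (rule ext_prod_encode)
      (simp add: seq_map_block \<alpha>_def into_block_def Ax sum_distrib_left mult_ac)
  from seq_quotient_memI[OF \<alpha>_le this] seq_quotient_norm_le[OF \<alpha>_le this]
  show "into_block n x \<in> vcarrier block_quotient"
    "vnorm block_quotient (into_block n x) \<le> (1 / 2) ^ n * vnorm E x"
    by (simp_all add: block_quotient_def)
qed

lemma vscale_block_quotient: "vscale block_quotient = (\<lambda>c x i. c * x i)"
  by (simp add: block_quotient_def)

lemma into_block_finite_rank: "into_block n \<in> finite_rank_ops E block_quotient"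
proof -
  interpret A: bounded_operator E "lp_space \<infinity> (m n)" "A n"
    by (intro bounded_operatorI normed_E normed_space_lp_infinity A)
  have "into_block n \<in> bounded_ops E block_quotient"
  proof (rule bounded_opsI)
    fix x y and a :: 'k assume x: "x \<in> vcarrier E" and y: "y \<in> vcarrier E"
    show "into_block n (x + y) = into_block n x + into_block n y"
      by (rule ext_prod_encode) (simp add: into_block_def A.add x y distrib_left)
    show "into_block n (vscale E a x) = vscale block_quotient a (into_block n x)"
      by (rule ext_prod_encode) (simp add: into_block_def A.scale x vscale_block_quotient mult.left_commute)
  qed (rule into_block_bound; assumption)+
  then interpret I: bounded_operator E block_quotient "into_block n"
    by (intro bounded_operatorI normed_E normed_space_block_quotient)
  define J where "J = (\<lambda>i. prod_encode (n, i)) ` {..<m n}"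
  show ?thesis
  proof (rule I.finite_rankI)
    \<comment> \<open>These unit vectors may lie outside \<open>block_quotient\<close>;
      \<open>finite_rankI\<close> accepts a spanning set from the ambient sequence space.\<close>
    show "finite (unit_vector ` J :: (nat \<Rightarrow> 'k) set)" by (simp add: J_def)
    fix x assume x: "x \<in> vcarrier E"
    have zero: "into_block n x l = 0" if "l \<notin> J" for l
    proof -
      obtain n' i where l: "l = prod_encode (n', i)" by (rule prod_encode_cases)
      have "n' = n \<Longrightarrow> i \<ge> m n" using that l by (auto simp: J_def)
      then show ?thesis using A.mem[OF x] by (simp add: l into_block_def)
    qed
    have "into_block n x = (\<Sum>l\<in>J. vscale block_quotient (into_block n x l) (unit_vector l))"
      using unit_vector_expansion[of J "into_block n x"] zero by (simp add: J_def vscale_block_quotient)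
    also have "\<dots> \<in> I.F.span (unit_vector ` J)"
      by (intro I.F.span_sum I.F.span_scale I.F.span_base) auto
    finally show "into_block n x \<in> I.F.span (unit_vector ` J)" .
  qed
qed

text \<open>Norm convergence of the series of the \<open>into_block n\<close> implies convergence of
  coordinates, and coordinate \<open>(n, i)\<close> of the partial sums no longer changes once
  \<open>N > n\<close>.\<close>

lemma ex_lift_operator:
  "\<exists>R\<in>approximable_ops E block_quotient. \<forall>x\<in>vcarrier E. \<forall>n i.
     R x (prod_encode (n, i)) = of_real ((1 / 2) ^ n) * A n x i"
proof -
  obtain R where R: "R \<in> approximable_ops E block_quotient"
    "\<And>x. x \<in> vcarrier E \<Longrightarrow> converges_to block_quotient (\<lambda>N. \<Sum>n<N. into_block n x) (R x)"
    using series_operator_approximable[OF normed_E banach_space_block_quotient into_block_finite_rank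
        into_block_bound(2)] by blast
  interpret X: normed_structure block_quotient by standard (rule normed_space_block_quotient)
  have "R x (prod_encode (n, i)) = of_real ((1 / 2) ^ n) * A n x i" if x: "x \<in> vcarrier E" for x n i
  proof -
    let ?l = "prod_encode (n, i)"
    have lim: "converges_to block_quotient (\<lambda>N. \<Sum>n<N. into_block n x) (R x)" by (rule R(2)[OF x])
    have mem: "(\<Sum>n<N. into_block n x) - R x \<in> vcarrier block_quotient" for N
      using lim into_block_bound(1)[OF x] by (intro X.diff_mem X.sum_mem) (auto simp: converges_to_def)
    have "norm (of_real ((1 / 2) ^ n) * A n x i - R x ?l)
        \<le> c n * vnorm block_quotient ((\<Sum>n<N. into_block n x) - R x)" if "n < N" for N
    proof -
      have "((\<Sum>n<N. into_block n x) - R x) ?l = (\<Sum>n'<N. if n = n' then of_real ((1 / 2) ^ n') * A n' x i else 0) - R x ?l"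
        by (simp add: sum_pointwise into_block_def if_distrib cong: if_cong)
      also have "\<dots> = of_real ((1 / 2) ^ n) * A n x i - R x ?l" using that by simp
      finally show ?thesis using block_quotient_coordinate_le[OF mem, of N n i] by simp
    qed
    moreover have "(\<lambda>N. c n * vnorm block_quotient ((\<Sum>n<N. into_block n x) - R x)) \<longlonglongrightarrow> c n * 0"
      using lim by (intro tendsto_intros) (simp add: converges_to_def)
    ultimately have "norm (of_real ((1 / 2) ^ n) * A n x i - R x ?l) \<le> c n * 0"
      by (intro LIMSEQ_le_const) (auto intro: exI[of _ "Suc n"])
    then show ?thesis by simp
  qed
  with R(1) show ?thesis by blast
qed

section \<open>The 1-compact middle factor\<close>

definition block_stretch :: "(nat \<Rightarrow> 'k) \<Rightarrow> nat \<Rightarrow> 'k" where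
  "block_stretch z l = of_real (4 ^ fst (prod_decode l)) * z l"

lemma block_stretch_coordinate:
  "block_stretch z (prod_encode (n, i)) = of_real (4 ^ n) * z (prod_encode (n, i))"
  by (simp add: block_stretch_def)

text \<open>After stretching by \<open>4 ^ n\<close> the coordinates of block \<open>n\<close> still
  decay like \<open>(1 / 4) ^ n\<close>. The stretched columns of the matrix are the witnesses of
  compactness, with a preimage of \<open>z\<close> supplying the coefficients.\<close>

lemma block_stretch_one_compact:
  assumes M: "\<And>n. c n \<le> M / 16 ^ n"
  shows "block_stretch \<in> one_compact_ops block_quotient seq_linf"
proof -
  interpret X: normed_structure block_quotient by standard (rule normed_space_block_quotient)
  interpret Y: normed_structure "seq_linf :: ('k, nat \<Rightarrow> 'k) nvs" by standard (rule normed_space_linf)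
  have M0: "M \<ge> 0" using M[of 0] c_nonneg[of 0] by simp
  have c4: "4 ^ n * c n \<le> M * (1 / 4) ^ n" for n
  proof -
    have "4 ^ n * c n \<le> 4 ^ n * (M / 16 ^ n)" using M by (intro mult_left_mono) auto
    also have "\<dots> = M * (1 / 4) ^ n"
      by (simp add: power_one_over field_simps flip: power_mult_distrib)
    finally show ?thesis .
  qed
  have coord: "norm (block_stretch z (prod_encode (n, i))) \<le> M * (1 / 4) ^ n * vnorm block_quotient z"
    if z: "z \<in> vcarrier block_quotient" for z n i
  proof -
    have "norm (block_stretch z (prod_encode (n, i))) \<le> 4 ^ n * (c n * vnorm block_quotient z)"
      unfolding block_stretch_coordinate norm_mult
      using block_quotient_coordinate_le[OF z] by (simp add: norm_power mult_left_mono)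
    also have "\<dots> \<le> M * (1 / 4) ^ n * vnorm block_quotient z"
      using mult_right_mono[OF c4 X.nonneg[OF z], of n] by (simp add: mult.assoc)
    finally show ?thesis .
  qed
  have bound: "norm (block_stretch z l) \<le> M * vnorm block_quotient z"
    if z: "z \<in> vcarrier block_quotient" for z l
  proof -
    obtain n i where l: "l = prod_encode (n, i)" by (rule prod_encode_cases)
    have "M * (1 / 4) ^ n \<le> M" using M0 by (intro mult_left_le power_le_one) auto
    then have "M * (1 / 4) ^ n * vnorm block_quotient z \<le> M * vnorm block_quotient z"
      by (rule mult_right_mono) (rule X.nonneg[OF z])
    then show ?thesis using coord[OF z, of n i] by (simp add: l)
  qed
  have "block_stretch \<in> bounded_ops block_quotient seq_linf"
  proof (rule bounded_opsI[where C = M])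
    fix z assume z: "z \<in> vcarrier block_quotient"
    show "block_stretch z \<in> vcarrier seq_linf" "vnorm seq_linf (block_stretch z) \<le> M * vnorm block_quotient z"
      by (rule linf_norm_le[OF bound[OF z]])+
  qed (auto simp: block_stretch_def fun_eq_iff vscale_block_quotient distrib_left)
  \<comment> \<open>A point of the unit ball is known to lift to an \<open>\<alpha>\<close> bounded
    by 2, the quotient norm perhaps not being attained, so the vectors are doubled and the
    coefficients are \<open>\<alpha> / 2\<close>. Block \<open>n\<close> costs at most
    \<open>2 ^ n * 2 * 4 ^ n * c n \<le> 2 * M * (1 / 2) ^ n\<close>.\<close>
  moreover have "Y.block_seq p (\<lambda>n k. at_block n (\<lambda>i. of_real (2 * 4 ^ n) * w n k i))
      \<in> compact_witnesses block_quotient seq_linf block_stretch" (is "Y.block_seq p ?b \<in> _")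
  proof -
    have b_le: "norm (?b n k l) \<le> 2 * 4 ^ n * lp_norm \<infinity> (m n) (w n k)" for n k l
    proof -
      obtain n' i where l: "l = prod_encode (n', i)" by (rule prod_encode_cases)
      show ?thesis
        using norm_w_le[of n k i] lp_norm_infinity_nonneg[of "m n" "w n k"] by (simp add: l norm_mult norm_power)
    qed
    have b_mem: "?b n k \<in> vcarrier seq_linf" for n k by (rule linf_norm_le(1)[OF b_le])
    have b_cost: "(\<Sum>k<p n. vnorm seq_linf (?b n k)) \<le> 2 * 4 ^ n * c n" for n
    proof -
      have "(\<Sum>k<p n. vnorm seq_linf (?b n k)) \<le> (\<Sum>k<p n. 2 * 4 ^ n * lp_norm \<infinity> (m n) (w n k))"
        by (intro sum_mono linf_norm_le(2)[OF b_le])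
      also have "\<dots> \<le> 2 * 4 ^ n * c n"
        unfolding sum_distrib_left[symmetric] by (intro mult_left_mono cost) simp
      finally show ?thesis .
    qed
    have b_sum: "summable (\<lambda>n. 2 ^ n * (2 * 4 ^ n * c n))"
    proof (rule summable_comparison_test'[of "\<lambda>n. 2 * M * (1 / 2) ^ n" 0])
      show "summable (\<lambda>n. 2 * M * (1 / 2) ^ n)" by (intro summable_mult) simp
      fix n
      have "2 ^ n * (2 * 4 ^ n * c n) = 2 * 2 ^ n * (4 ^ n * c n)" by simp
      also have "\<dots> \<le> 2 * 2 ^ n * (M * (1 / 4) ^ n)" using c4 by (intro mult_left_mono) auto
      also have "\<dots> = 2 * M * (2 * (1 / 4)) ^ n" unfolding power_mult_distrib by simp
      finally show "norm (2 ^ n * (2 * 4 ^ n * c n)) \<le> 2 * M * (1 / 2) ^ n"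
        using c_nonneg[of n] by simp
    qed
    have "block_stretch z \<in> c0_hull seq_linf (Y.block_seq p ?b)" if z: "z \<in> unit_ball block_quotient" for z
    proof -
      have zX: "z \<in> vcarrier block_quotient" and z1: "vnorm block_quotient z \<le> 1"
        using z by (auto simp: unit_ball_def)
      obtain \<alpha> where \<alpha>: "\<forall>j. norm (\<alpha> j) \<le> 2" "seq_map block_matrix block_index \<alpha> = z"
        using seq_quotient_lift[of z block_matrix block_index 2] zX z1 by (auto simp: block_quotient_def)
      show ?thesis
      proof (rule Y.c0_hull_block_seq[OF b_mem b_cost b_sum])
        show "norm (\<alpha> (prod_encode (n, k)) / 2) \<le> 1" for n k using \<alpha>(1) by (simp add: norm_divide)
        let ?s = "\<lambda>N. \<Sum>n<N. \<Sum>k<p n. vscale seq_linf (\<alpha> (prod_encode (n, k)) / 2) (?b n k)"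
        have s_eq: "?s N (prod_encode (n, i)) = (if n < N then block_stretch z (prod_encode (n, i)) else 0)" for N n i
        proof -
          have "?s N (prod_encode (n, i)) = (\<Sum>n'<N. if n = n' then
              (\<Sum>k<p n'. \<alpha> (prod_encode (n', k)) / 2 * (of_real (2 * 4 ^ n') * w n' k i)) else 0)"
            unfolding sum_pointwise by (intro sum.cong) (auto simp: sum_pointwise)
          also have "\<dots> = (if n < N then \<Sum>k<p n. \<alpha> (prod_encode (n, k)) / 2 * (of_real (2 * 4 ^ n) * w n k i) else 0)"
            by simp
          also have "(\<Sum>k<p n. \<alpha> (prod_encode (n, k)) / 2 * (of_real (2 * 4 ^ n) * w n k i))
              = block_stretch z (prod_encode (n, i))"
            unfolding block_stretch_coordinate \<alpha>(2)[symmetric] seq_map_block sum_distrib_left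
            by (intro sum.cong) auto
          finally show ?thesis .
        qed
        \<comment> \<open>The first \<open>N\<close> blocks are already exact, so the error is the
          part of \<open>block_stretch z\<close> from block \<open>N\<close> on.\<close>
        have s_diff: "norm ((?s N - block_stretch z) l) \<le> M * (1 / 4) ^ N" for N l
        proof -
          obtain n i where l: "l = prod_encode (n, i)" by (rule prod_encode_cases)
          show ?thesis
          proof (cases "n < N")
            case True
            then show ?thesis using s_eq[of N n i] M0 by (simp add: l)
          next
            case False
            have "norm (block_stretch z (prod_encode (n, i))) \<le> M * (1 / 4) ^ n * vnorm block_quotient z"
              by (rule coord[OF zX])
            also have "\<dots> \<le> M * (1 / 4) ^ n * 1" using M0 z1 by (intro mult_left_mono) auto
            also have "\<dots> \<le> M * (1 / 4) ^ N * 1"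
              using False M0 by (intro mult_right_mono mult_left_mono power_decreasing) auto
            finally show ?thesis using s_eq[of N n i] False by (simp add: l)
          qed
        qed
        have upper: "\<forall>N. vnorm seq_linf (?s N - block_stretch z) \<le> M * (1 / 4) ^ N"
          by (intro allI linf_norm_le(2)[OF s_diff])
        have lower: "\<forall>N. 0 \<le> vnorm seq_linf (?s N - block_stretch z)"
          by (intro allI Y.nonneg linf_norm_le(1)[OF s_diff])
        have "(\<lambda>N. M * (1 / 4) ^ N) \<longlonglongrightarrow> M * 0"
          by (intro tendsto_intros LIMSEQ_power_zero) simp
        then have lim0: "(\<lambda>N. M * (1 / 4) ^ N) \<longlonglongrightarrow> 0" by simp
        have "(\<lambda>N. vnorm seq_linf (?s N - block_stretch z)) \<longlonglongrightarrow> 0"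
          by (rule tendsto_sandwich[OF always_eventually[OF lower] always_eventually[OF upper] tendsto_const lim0])
        then show "converges_to seq_linf ?s (block_stretch z)"
          unfolding converges_to_def using linf_norm_le(1)[OF bound[OF zX]] by simp
      qed
    qed
    moreover have "Y.block_seq p ?b j \<in> vcarrier seq_linf" for j
      by (rule Y.block_seq_mem[OF b_mem])
    ultimately show ?thesis
      using Y.summable_block_seq(1)[OF b_mem b_cost b_sum]
      unfolding compact_witnesses_def by blast
  qed
  ultimately show ?thesis unfolding one_compact_ops_def by blast
qed

section \<open>The approximable last factor\<close>

definition from_block :: "nat \<Rightarrow> (nat \<Rightarrow> 'k) \<Rightarrow> nat \<Rightarrow> 'k" where
  "from_block n y i = (if i < m n then of_real ((1 / 2) ^ n) * y (prod_encode (n, i)) else 0)"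

text \<open>Each summand has finite rank because it passes through the finite dimensional
  \<open>\<ell>\<^sub>\<infinity>\<^sup>m\<close>. As \<open>v n\<close> is a contraction,
  \<open>from_block\<close> alone provides the rate \<open>(1 / 2) ^ n\<close>; completeness of
  \<open>F\<close> provides the sum.\<close>

lemma ex_descent_operator:
  assumes "banach_space F"
  shows "\<exists>S\<in>approximable_ops seq_linf F. \<forall>y\<in>vcarrier seq_linf.
    converges_to F (\<lambda>N. \<Sum>n<N. v n (from_block n y)) (S y)"
proof (rule series_operator_approximable[OF normed_space_linf assms])
  interpret Y: normed_structure "seq_linf :: ('k, nat \<Rightarrow> 'k) nvs" by standard (rule normed_space_linf)
  have le: "lp_norm \<infinity> (m n) (from_block n y) \<le> (1 / 2) ^ n * vnorm seq_linf y"
    if y: "y \<in> vcarrier seq_linf" for n y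
    using linf_coordinate_le[OF y] Y.nonneg[OF y]
    by (auto simp: lp_norm_infinity_le_iff from_block_def norm_mult norm_power norm_divide intro!: mult_left_mono)
  have mem: "from_block n y \<in> vcarrier (lp_space \<infinity> (m n))" for n y
    by (simp add: from_block_def)
  fix n
  have "from_block n \<in> bounded_ops seq_linf (lp_space \<infinity> (m n))"
    by (rule bounded_opsI[where C = "(1 / 2) ^ n"])
      (use le in \<open>auto simp: from_block_def fun_eq_iff distrib_left\<close>)
  from bounded_ops_compose[OF normed_space_linf normed_space_lp_infinity normed_F this v]
  have "(\<lambda>y. v n (from_block n y)) \<in> bounded_ops seq_linf F" .
  have idF: "(\<lambda>x. x) \<in> bounded_ops F F" by (rule bounded_opsI[where C = 1]) auto
  show "(\<lambda>y. v n (from_block n y)) \<in> finite_rank_ops seq_linf F"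
    using finite_rank_compose[OF normed_space_linf normed_space_lp_infinity normed_F normed_F
        \<open>from_block n \<in> _\<close> finite_rank_lp_domain[OF normed_F v] idF] .
  fix y :: "nat \<Rightarrow> 'k" assume "y \<in> vcarrier seq_linf"
  then show "vnorm F (v n (from_block n y)) \<le> (1 / 2) ^ n * vnorm seq_linf y"
    using v_le[OF mem, of n y] le[of y n] by linarith
qed

lemma mem_minimal_kernel:
  assumes "banach_space F" and M: "\<And>n. c n \<le> M / 16 ^ n"
  shows "T \<in> minimal_kernel E F"
proof -
  obtain R where R: "R \<in> approximable_ops E block_quotient"
    "\<And>x n i. x \<in> vcarrier E \<Longrightarrow> R x (prod_encode (n, i)) = of_real ((1 / 2) ^ n) * A n x i"
    using ex_lift_operator by blast
  obtain S where S: "S \<in> approximable_ops seq_linf F"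
    "\<And>y. y \<in> vcarrier seq_linf \<Longrightarrow> converges_to F (\<lambda>N. \<Sum>n<N. v n (from_block n y)) (S y)"
    using ex_descent_operator[OF assms(1)] by blast
  have T0: "block_stretch \<in> one_compact_ops block_quotient seq_linf"
    by (rule block_stretch_one_compact[OF M])
  have "T x = S (block_stretch (R x))" if x: "x \<in> vcarrier E" for x
  proof -
    have "R x \<in> vcarrier block_quotient"
      using R(1) x by (auto simp: approximable_ops_def bounded_ops_def)
    then have y: "block_stretch (R x) \<in> vcarrier seq_linf"
      using T0 by (auto simp: one_compact_ops_def bounded_ops_def)
    have "from_block n (block_stretch (R x)) = A n x" for n
    proof
      fix i
      have "A n x \<in> vcarrier (lp_space \<infinity> (m n))" using A[of n] x by (auto simp: bounded_ops_def)
      moreover have "of_real ((1 / 2) ^ n) * (of_real (4 ^ n) * R x (prod_encode (n, i))) = A n x i"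
      proof -
        have "of_real ((1 / 2) ^ n) * (of_real (4 ^ n) * R x (prod_encode (n, i)))
            = of_real ((1 / 2) ^ n * 4 ^ n * (1 / 2) ^ n) * A n x i"
          by (simp only: R(2)[OF x] of_real_mult mult.assoc)
        also have "(1 / 2) ^ n * 4 ^ n * (1 / 2 :: real) ^ n = 1"
          by (simp flip: power_mult_distrib)
        finally show ?thesis by simp
      qed
      ultimately show "from_block n (block_stretch (R x)) i = A n x i"
        by (simp add: from_block_def block_stretch_coordinate del: of_real_power)
    qed
    then have "converges_to F (\<lambda>N. \<Sum>n<N. v n (A n x)) (S (block_stretch (R x)))"
      using S(2)[OF y] by simp
    moreover have "(\<Sum>n<N. v n (A n x)) \<in> vcarrier F" for N
      by (intro F.sum_mem bounded_operator.mem[OF bounded_v]) (use A x in \<open>auto simp: bounded_ops_def\<close>)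
    ultimately show ?thesis using F.limit_unique[OF series[OF x]] by blast
  qed
  then have "T \<in> minimal_kernel_via E F block_quotient seq_linf"
    unfolding minimal_kernel_via_def using T R(1) T0 S(1) by blast
  then show ?thesis
    unfolding minimal_kernel_def using banach_space_block_quotient banach_space_linf by blast
qed

end

text \<open>The middle conjunct justifies the encoding of \<open>minimal_kernel\<close>:
  factorizations through Banach spaces over arbitrary types yield approximable operators, and these
  already factor through sequence spaces.\<close>

theorem corollary3p14:
  fixes E :: "('k::rc_field, 'a::ab_group_add) nvs"
    and F :: "('k, 'b::ab_group_add) nvs"
    and X :: "('k, 'x::ab_group_add) nvs"
    and Y :: "('k, 'y::ab_group_add) nvs"
    and lam lam' :: real
  assumes "banach_space E" and "banach_space F"
    and "1 \<le> lam" and "1 \<le> lam'"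
    and "script_Lp_space 2 lam' E"
    and "script_Lp_space \<infinity> lam F"
  shows "approximable_ops E F = minimal_kernel E F \<and>
         (banach_space X \<and> banach_space Y \<longrightarrow> minimal_kernel_via E F X Y \<subseteq> minimal_kernel E F) \<and>
         (\<forall>T\<in>approximable_ops E F.
           kappa1 E F T \<le> grothendieck_constant TYPE('k) * lam * lam' * opnorm E F T)"
proof -
  have sp: "normed_space E" "normed_space F" using assms by (simp_all add: banach_space_def)
  define G where "G = grothendieck_constant TYPE('k) * lam * lam'"
  have series: "\<exists>m p A v w \<tau>. block_series E F T m p A v w \<tau>
      (\<lambda>n. e / 16 ^ n + (if n = 0 then G * opnorm E F T else 0))"
    if "T \<in> approximable_ops E F" "e > 0" for T e
    unfolding G_def by (rule approximable_block_series[OF sp assms(3-6) that])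
  have kernel: "T \<in> minimal_kernel E F" if T: "T \<in> approximable_ops E F" for T
  proof -
    interpret T: bounded_operator E F T using sp T by (intro bounded_operatorI approximable_bounded)
    have "0 \<le> G * opnorm E F T"
      using assms(3,4) by (simp add: G_def grothendieck_constant_nonneg T.opnorm_nonneg)
    \<comment> \<open>For the factorization the decay rate alone matters, so \<open>e = 1\<close>
      will do, and the main term of block 0 is absorbed into the constant.\<close>
    then have "1 / 16 ^ n + (if n = 0 then G * opnorm E F T else 0) \<le> (1 + G * opnorm E F T) / 16 ^ n" for n
      by (simp add: divide_right_mono)
    then show ?thesis
      using series[OF T zero_less_one] block_series.mem_minimal_kernel[OF _ assms(2)] by blast
  qed
  note via = minimal_kernel_via_approximable[OF sp]
  have "minimal_kernel E F \<subseteq> approximable_ops E F"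
    using via unfolding minimal_kernel_def banach_space_def by blast
  then have "approximable_ops E F = minimal_kernel E F"
    using kernel by blast
  moreover have "minimal_kernel_via E F X Y \<subseteq> minimal_kernel E F" if "banach_space X" "banach_space Y"
    using minimal_kernel_via_approximable[OF sp, of X Y] kernel that unfolding banach_space_def by blast
  moreover have "kappa1 E F T \<le> G * opnorm E F T" if T: "T \<in> approximable_ops E F" for T
  proof (rule field_le_epsilon)
    fix e :: real assume "e > 0"
    \<comment> \<open>The weights \<open>2 ^ n\<close> turn \<open>16 ^ n\<close> into
      \<open>8 ^ n\<close>, so the errors add up to \<open>e / 2 * (8 / 7)\<close>, which is at most
      \<open>e\<close>.\<close>
    define c where "c n = e / 2 / 16 ^ n + (if n = 0 then G * opnorm E F T else 0)" for n :: nat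
    obtain m p A v w \<tau> where "block_series E F T m p A v w \<tau> c"
      using series[OF T, of "e / 2"] \<open>e > 0\<close> unfolding c_def by auto
    then interpret block_series E F T m p A v w \<tau> c .
    have "(\<lambda>n. e / 2 * (1 / 8) ^ n) sums (e / 2 * (1 / (1 - 1 / 8)))"
      by (intro sums_mult geometric_sums) simp
    moreover have "(\<lambda>n. if n = 0 then G * opnorm E F T else 0) sums (G * opnorm E F T)"
      by (rule sums_single)
    ultimately have "(\<lambda>n. e / 2 * (1 / 8) ^ n + (if n = 0 then G * opnorm E F T else 0)) sums
        (e / 2 * (1 / (1 - 1 / 8)) + G * opnorm E F T)"
      by (rule sums_add)
    moreover have "2 ^ n * c n = e / 2 * (1 / 8) ^ n + (if n = 0 then G * opnorm E F T else 0)" for n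
    proof -
      have "(16::real) ^ n = 2 ^ n * 8 ^ n" by (simp flip: power_mult_distrib)
      then show ?thesis by (simp add: c_def distrib_left power_one_over)
    qed
    ultimately have sums: "(\<lambda>n. 2 ^ n * c n) sums (e / 2 * (1 / (1 - 1 / 8)) + G * opnorm E F T)"
      by simp
    have "kappa1 E F T \<le> e / 2 * (1 / (1 - 1 / 8)) + G * opnorm E F T"
      using compact_witness(2)[OF sums_summable[OF sums]] sums_unique[OF sums] by simp
    also have "\<dots> \<le> G * opnorm E F T + e" using \<open>e > 0\<close> by simp
    finally show "kappa1 E F T \<le> G * opnorm E F T + e" .
  qed
  ultimately show ?thesis unfolding G_def by blast
qed

end
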